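(* Fix integers $\ell\ge r\ge 2$. There exist constants $N_0$ and $c=c(\ell,r)>0$ such that for all integers $n\ge N_0$ and all integers $t\in[0,cn]$ we have \[ \mathrm{EX}(n,(t+1)H_{\ell+1}^r)=\{K_t^r\bowtie T_r(n-t,\ell)\}. \]
   Context: $H_{\ell+1}^r$ (the expansion of $K_{\ell+1}$) is the $r$-graph obtained from the complete graph $K_{\ell+1}$ by adding to each edge a set of $r-2$ new vertices, these new $(r-2)$-sets being pairwise disjoint; it has $\ell+1+(r-2)\binom{\ell+1}{2}$ vertices and $\binom{\ell+1}{2}$ edges. $T_r(n,\ell)$ is the $r$-graph on $[n]=V_1\cup\dots\cup V_\ell$ with $|V_i|\in\{\lfloor n/\ell\rfloor,\lceil n/\ell\rceil\}$ whose edges are all $r$-sets with at most one vertex in each $V_i$. $K_t^r$ is the complete $r$-graph on $t$ vertices; $\mathcal{G}\bowtie\mathcal{H}$ (disjoint vertex sets) consists of the edges of both plus all $r$-subsets meeting both vertex sets. $\mathrm{EX}(n,(t+1)F)$ is the set (up to isomorphism) of $n$-vertex $r$-graphs not containing $t+1$ pairwise vertex-disjoint copies of $F$ with the maximum number of edges among such. *)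

theory Defs
  imports Complex_Main
begin

datatype 'a hypergraph = Hypergraph (verts: "'a set") (edges: "'a set set")

definition is_rgraph :: "nat \<Rightarrow> 'a hypergraph \<Rightarrow> bool" where
  "is_rgraph r G \<longleftrightarrow> finite (verts G) \<and> (\<forall>e\<in>edges G. e \<subseteq> verts G \<and> card e = r)"

definition isomorphic :: "'a hypergraph \<Rightarrow> 'b hypergraph \<Rightarrow> bool" where
  "isomorphic G H \<longleftrightarrow> (\<exists>f. bij_betw f (verts G) (verts H) \<and> edges H = (\<lambda>e. f ` e) ` edges G)"

definition subhypergraph :: "'a hypergraph \<Rightarrow> 'a hypergraph \<Rightarrow> bool" where
  "subhypergraph H G \<longleftrightarrow> verts H \<subseteq> verts G \<and> edges H \<subseteq> edges G"

text \<open>Copies are not required to be induced.\<close>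
definition contains_disjoint_copies :: "'a hypergraph \<Rightarrow> nat \<Rightarrow> 'b hypergraph \<Rightarrow> bool" where
  "contains_disjoint_copies G k F \<longleftrightarrow>
     (\<exists>C :: nat \<Rightarrow> 'a hypergraph.
        (\<forall>i<k. subhypergraph (C i) G \<and> isomorphic F (C i)) \<and>
        (\<forall>i<k. \<forall>j<k. i \<noteq> j \<longrightarrow> verts (C i) \<inter> verts (C j) = {}))"

definition complete_hypergraph :: "nat \<Rightarrow> 'a set \<Rightarrow> 'a hypergraph" where
  "complete_hypergraph r V = Hypergraph V {e. e \<subseteq> V \<and> card e = r}"

text \<open>The expansion of a graph (a hypergraph with \<open>r = 2\<close>): the original vertices are the
  \<open>Inl v\<close>, and the new vertices added to the edge \<open>e\<close> are \<open>Inr (e, j)\<close> for \<open>j < r - 2\<close>.\<close>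
definition expansion :: "nat \<Rightarrow> 'a hypergraph \<Rightarrow> ('a + 'a set \<times> nat) hypergraph" where
  "expansion r F = Hypergraph
     (Inl ` verts F \<union> Inr ` (edges F \<times> {..<r - 2}))
     ((\<lambda>e. Inl ` e \<union> (\<lambda>j. Inr (e, j)) ` {..<r - 2}) ` edges F)"

text \<open>\<open>H_expansion r l\<close> is the expansion of the complete graph on \<open>l + 1\<close> vertices.\<close>
definition H_expansion :: "nat \<Rightarrow> nat \<Rightarrow> (nat + nat set \<times> nat) hypergraph" where
  "H_expansion r l = expansion r (complete_hypergraph 2 {..<l + 1})"

definition complete_multipartite :: "nat \<Rightarrow> nat \<Rightarrow> (nat \<Rightarrow> 'a set) \<Rightarrow> 'a hypergraph" where
  "complete_multipartite r l V = Hypergraph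
     (\<Union>i<l. V i)
     {e. e \<subseteq> (\<Union>i<l. V i) \<and> card e = r \<and> (\<forall>i<l. card (e \<inter> V i) \<le> 1)}"

text \<open>The Turan hypergraph is determined up to isomorphism by the balancedness of its parts;
  on \<open>{..<n}\<close> we take the residue classes modulo \<open>l\<close>. The lemmas below show that they form
  a balanced partition.\<close>
definition turan_part :: "nat \<Rightarrow> nat \<Rightarrow> nat \<Rightarrow> nat set" where
  "turan_part n l i = {v. v < n \<and> v mod l = i}"

definition turan :: "nat \<Rightarrow> nat \<Rightarrow> nat \<Rightarrow> nat hypergraph" where
  "turan r n l = complete_multipartite r l (turan_part n l)"

lemma turan_part_Union: "0 < l \<Longrightarrow> (\<Union>i<l. turan_part n l i) = {..<n}"
  by (auto simp: turan_part_def)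

lemma turan_part_disjoint: "i \<noteq> j \<Longrightarrow> turan_part n l i \<inter> turan_part n l j = {}"
  by (auto simp: turan_part_def)

lemma turan_part_card:
  assumes "i < l"
  shows "int (card (turan_part n l i)) \<in> {\<lfloor>real n / real l\<rfloor>, \<lceil>real n / real l\<rceil>}"
proof -
  define q where "q = (n + (l - 1 - i)) div l"
  have l: "0 < l" using assms by simp
  have mem: "i + k * l < n \<longleftrightarrow> k < q" for k
  proof -
    have "k < q \<longleftrightarrow> Suc k * l \<le> n + (l - 1 - i)"
      using less_eq_div_iff_mult_less_eq[OF l, of "Suc k" "n + (l - 1 - i)"]
      unfolding q_def Suc_le_eq .
    also have "\<dots> \<longleftrightarrow> l + k * l \<le> n + (l - 1 - i)" by simp
    also have "\<dots> \<longleftrightarrow> i + k * l < n" using assms by linarith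
    finally show ?thesis by simp
  qed
  have "turan_part n l i = (\<lambda>k. i + k * l) ` {..<q}"
  proof (intro set_eqI iffI)
    fix v assume "v \<in> turan_part n l i"
    then have v: "v < n" "v mod l = i" by (auto simp: turan_part_def)
    have eq: "v = i + (v div l) * l" using mod_div_mult_eq[of v l] unfolding v(2) by (rule sym)
    with v(1) have "i + (v div l) * l < n" by metis
    then have "v div l < q" unfolding mem .
    then have "v div l \<in> {..<q}" by simp
    with eq show "v \<in> (\<lambda>k. i + k * l) ` {..<q}" by (rule image_eqI)
  next
    fix v assume "v \<in> (\<lambda>k. i + k * l) ` {..<q}"
    then obtain k where "k < q" and v: "v = i + k * l" by blast
    then have "v < n" unfolding v mem by simp
    moreover have "v mod l = i" unfolding v using assms by simp
    ultimately show "v \<in> turan_part n l i" unfolding turan_part_def by simp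
  qed
  moreover have "inj_on (\<lambda>k. i + k * l) {..<q}" using l by (auto simp: inj_on_def)
  ultimately have c: "card (turan_part n l i) = q" by (simp add: card_image)
  have "n div l \<le> q" unfolding q_def by (rule div_le_mono) simp
  then have lo: "\<lfloor>real n / real l\<rfloor> \<le> int q"
    unfolding floor_divide_of_nat_eq by simp
  have "q * l \<le> n + (l - 1 - i)" unfolding q_def by (rule div_times_less_eq_dividend)
  then have "q * l < n + l" using l by linarith
  then have "real q * real l < real n + real l" by (metis of_nat_add of_nat_less_iff of_nat_mult)
  then have "real q < real n / real l + 1" using l by (simp add: field_simps)
  then have "int q < \<lceil>real n / real l\<rceil> + 1" by linarith
  moreover have "\<lceil>real n / real l\<rceil> \<le> \<lfloor>real n / real l\<rfloor> + 1"
    using ceiling_diff_floor_le_1[of "real n / real l"] by linarith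
  ultimately have "int q = \<lfloor>real n / real l\<rfloor> \<or> int q = \<lceil>real n / real l\<rceil>"
    using lo by linarith
  then show ?thesis unfolding c by blast
qed

text \<open>To be used for hypergraphs with disjoint vertex sets.\<close>
definition join :: "nat \<Rightarrow> 'a hypergraph \<Rightarrow> 'a hypergraph \<Rightarrow> 'a hypergraph" where
  "join r G H = Hypergraph
     (verts G \<union> verts H)
     (edges G \<union> edges H \<union>
      {e. e \<subseteq> verts G \<union> verts H \<and> card e = r \<and> e \<inter> verts G \<noteq> {} \<and> e \<inter> verts H \<noteq> {}})"

definition free_rgraph :: "nat \<Rightarrow> nat \<Rightarrow> nat \<Rightarrow> 'b hypergraph \<Rightarrow> 'a hypergraph \<Rightarrow> bool" where
  "free_rgraph r n k F G \<longleftrightarrow>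
     is_rgraph r G \<and> card (verts G) = n \<and> \<not> contains_disjoint_copies G k F"

text \<open>Isomorphism classes are taken among hypergraphs with vertices in \<open>nat\<close>; every finite
  hypergraph is isomorphic to one of these.\<close>
definition iso_class :: "'a hypergraph \<Rightarrow> nat hypergraph set" where
  "iso_class G = {G'. isomorphic G G'}"

text \<open>\<open>extremal r n k F\<close>, usually written \<open>EX(n, k F)\<close>, is the set of isomorphism
  classes of the extremal \<open>n\<close>-vertex \<open>r\<close>-graphs without \<open>k\<close> pairwise vertex-disjoint copies of \<open>F\<close>.\<close>
definition extremal :: "nat \<Rightarrow> nat \<Rightarrow> nat \<Rightarrow> 'b hypergraph \<Rightarrow> nat hypergraph set set" where
  "extremal r n k F = iso_class `
     {G. free_rgraph r n k F (G :: nat hypergraph) \<and>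
        (\<forall>G' :: nat hypergraph. free_rgraph r n k F G' \<longrightarrow> card (edges G') \<le> card (edges G))}"

end

(* Call a pair of vertices robust if, for every small vertex set S, some edge contains the pair and
   avoids S. Only few edges contain a pair that is not robust, and an (l+1)-clique of robust pairs
   extends greedily to a copy of the expansion of K_{l+1}. So an r-graph without many disjoint copies
   has, up to few edges, at most as many edges as a K_{l+1}-free graph has r-cliques, and Zykov's
   bound together with a stability argument after Fueredi shows that a nearly extremal r-graph is
   close to the Turan hypergraph.

   In such an r-graph a vertex of degree noticeably above the Turan degree lies in a copy that avoids any
   prescribed small set. Without copies, vertex deletion gives minimum degree about the Turan degree,
   and then every edge is crossing: this is the exact result for t = 0. In general let L be the set of
   vertices of large degree. Extending disjoint copies greedily through L gives |L| <= t, and that G - L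
   has at most t - |L| disjoint copies. If |L| < t, removing these copies from G - L loses too few edges
   compared with replacing them by joined vertices; if |L| = t, the exact result applies to G - L. *)
theory Submission
  imports Defs "HOL-Library.Disjoint_Sets"
begin

section \<open>Cliques in graphs without large cliques\<close>

text \<open>The obstacle is that \<open>t\<close> may be linear in \<open>n\<close>: the set that a
  copy has to avoid then has linear size. So pairs are robust against \<open>M\<close> vertices with
  \<open>M\<close> a small multiple of \<open>n\<close>, and errors are small multiples of the main
  term instead of being of lower order. What must beat them is one fixed gap: a joined vertex lies
  on about \<open>n ^ (r - 1) / fact (r - 1)\<close> edges, a vertex of the Turan hypergraph on
  about \<open>(l - 1 choose (r - 1)) * (n / l) ^ (r - 1)\<close>. If \<open>card L < t\<close>,
  every removed copy takes away a fixed number \<open>m\<close> of vertices outside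
  \<open>L\<close>. The degree threshold that defines \<open>L\<close> must therefore exceed the
  Turan degree by only a small fraction of the gap divided by \<open>m\<close>, so the statement
  about large degrees has to be asymptotically sharp. Constants are chosen backwards: gap, degree
  tolerance, \<open>\<kappa>\<close>, \<open>\<delta>\<close>, \<open>c\<close>. Stability needs a
  copy-free hypergraph. It is applied after deleting a maximal family of disjoint copies, and the
  structure carries over to all edges because robustness only grows with the edge set.\<close>

definition ksubsets :: "nat \<Rightarrow> 'a set \<Rightarrow> 'a set set" where
  "ksubsets k V = {e. e \<subseteq> V \<and> card e = k}"

lemma finite_ksubsets: "finite V \<Longrightarrow> finite (ksubsets k V)"
  unfolding ksubsets_def by simp

lemma card_ksubsets: "finite V \<Longrightarrow> card (ksubsets k V) = card V choose k"
  unfolding ksubsets_def by (rule n_subsets)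

lemma card_ksubsets_supset:
  assumes "finite V" "card A \<le> k" "finite A"
  shows "card {e \<in> ksubsets k V. A \<subseteq> e} \<le> card V ^ (k - card A)"
proof -
  have inj: "inj_on (\<lambda>e. e - A) {e \<in> ksubsets k V. A \<subseteq> e}"
    by (rule inj_onI) blast
  have "(\<lambda>e. e - A) ` {e \<in> ksubsets k V. A \<subseteq> e} \<subseteq> ksubsets (k - card A) V"
    using assms by (auto simp: ksubsets_def card_Diff_subset)
  from card_mono[OF finite_ksubsets[OF assms(1)] this]
  have "card {e \<in> ksubsets k V. A \<subseteq> e} \<le> card V choose (k - card A)"
    using assms(1) by (simp add: card_image[OF inj] card_ksubsets)
  also have "\<dots> \<le> card V ^ (k - card A)"
    by (cases "k - card A \<le> card V") (simp_all add: binomial_le_pow binomial_eq_0)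
  finally show ?thesis .
qed

lemma card_ksubsets_Int:
  assumes V: "finite V" and X: "finite X" and k: "k \<ge> 1"
  shows "card {e \<in> ksubsets k V. e \<inter> X \<noteq> {}} \<le> card X * card V ^ (k - 1)"
proof -
  have "{e \<in> ksubsets k V. e \<inter> X \<noteq> {}} = (\<Union>x\<in>X. {e \<in> ksubsets k V. {x} \<subseteq> e})" by auto
  then have "card {e \<in> ksubsets k V. e \<inter> X \<noteq> {}} \<le> (\<Sum>x\<in>X. card {e \<in> ksubsets k V. {x} \<subseteq> e})"
    by (simp only: card_UN_le[OF X])
  also have "\<dots> \<le> (\<Sum>x\<in>X. card V ^ (k - 1))"
    using card_ksubsets_supset[OF V, of "{x}" k for x] k by (intro sum_mono) auto
  finally show ?thesis by simp
qed

lemma card_ksubsets_mem_Int: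
  assumes V: "finite V" and X: "finite X" and k: "k \<ge> 2" and v: "v \<notin> X"
  shows "card {e \<in> ksubsets k V. v \<in> e \<and> e \<inter> X \<noteq> {}} \<le> card X * card V ^ (k - 2)"
proof -
  have "{e \<in> ksubsets k V. v \<in> e \<and> e \<inter> X \<noteq> {}} = (\<Union>x\<in>X. {e \<in> ksubsets k V. {v,x} \<subseteq> e})" by auto
  then have "card {e \<in> ksubsets k V. v \<in> e \<and> e \<inter> X \<noteq> {}}
      \<le> (\<Sum>x\<in>X. card {e \<in> ksubsets k V. {v,x} \<subseteq> e})"
    by (simp only: card_UN_le[OF X])
  also have "\<dots> \<le> (\<Sum>x\<in>X. card V ^ (k - 2))"
  proof (rule sum_mono)
    fix x assume "x \<in> X"
    then have "v \<noteq> x" using v by auto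
    then have "card {v,x} = 2" by simp
    then show "card {e \<in> ksubsets k V. {v,x} \<subseteq> e} \<le> card V ^ (k - 2)"
      using card_ksubsets_supset[OF V, of "{v,x}" k] k by auto
  qed
  finally show ?thesis by simp
qed

definition clique :: "('a \<Rightarrow> 'a \<Rightarrow> bool) \<Rightarrow> 'a set \<Rightarrow> bool" where
  "clique adj A \<longleftrightarrow> (\<forall>x\<in>A. \<forall>y\<in>A. x \<noteq> y \<longrightarrow> adj x y)"

definition cliques :: "('a \<Rightarrow> 'a \<Rightarrow> bool) \<Rightarrow> nat \<Rightarrow> 'a set \<Rightarrow> 'a set set" where
  "cliques adj k V = {A \<in> ksubsets k V. clique adj A}"

definition nbrs :: "('a \<Rightarrow> 'a \<Rightarrow> bool) \<Rightarrow> 'a set \<Rightarrow> 'a \<Rightarrow> 'a set" where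
  "nbrs adj V x = {y \<in> V. adj x y}"

lemma finite_cliques: "finite V \<Longrightarrow> finite (cliques adj k V)"
  unfolding cliques_def by (simp add: finite_ksubsets)

lemma finite_nbrs: "finite V \<Longrightarrow> finite (nbrs adj V x)"
  unfolding nbrs_def by simp

lemma card_cliques_mem:
  assumes "finite V" "v \<in> V"
  shows "card {A \<in> cliques adj (Suc k) V. v \<in> A} \<le> card (cliques adj k (nbrs adj V v))"
proof -
  have inj: "inj_on (\<lambda>A. A - {v}) {A \<in> cliques adj (Suc k) V. v \<in> A}"
    by (rule inj_onI) blast
  have "(\<lambda>A. A - {v}) ` {A \<in> cliques adj (Suc k) V. v \<in> A} \<subseteq> cliques adj k (nbrs adj V v)"
    using assms finite_subset by (auto simp: cliques_def ksubsets_def nbrs_def clique_def)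
  from card_mono[OF finite_cliques[OF finite_nbrs[OF assms(1)]] this] show ?thesis
    by (simp add: card_image[OF inj])
qed

lemma nbrs_clique_free:
  assumes "finite V" "v \<in> V" "\<And>x y. adj x y \<Longrightarrow> adj y x" "\<And>x. \<not> adj x x"
    and "cliques adj (Suc (Suc l)) V = {}"
  shows "cliques adj (Suc l) (nbrs adj V v) = {}"
proof (rule ccontr)
  assume "cliques adj (Suc l) (nbrs adj V v) \<noteq> {}"
  then obtain A where A: "A \<subseteq> nbrs adj V v" "card A = Suc l" "clique adj A"
    by (auto simp: cliques_def ksubsets_def)
  then have "v \<notin> A" "finite A" using assms(4) card_ge_0_finite[of A] by (auto simp: nbrs_def)
  then have "insert v A \<in> cliques adj (Suc (Suc l)) V"
    using A assms by (fastforce simp: cliques_def ksubsets_def nbrs_def clique_def)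
  then show False using assms(5) by simp
qed

lemma exists_max_degree:
  assumes "finite V" "V \<noteq> {}"
  obtains x where "x \<in> V" "\<And>y. y \<in> V \<Longrightarrow> card (nbrs adj V y) \<le> card (nbrs adj V x)"
proof -
  let ?D = "(\<lambda>x. card (nbrs adj V x)) ` V"
  have "Max ?D \<in> ?D" using assms by (intro Max_in) auto
  then obtain x where "x \<in> V" "card (nbrs adj V x) = Max ?D" by auto
  then show ?thesis using that[of x] assms by simp
qed

text \<open>The first two terms are the tangent of \<open>x ^ (k + 2)\<close> at \<open>y\<close>,
  taken at \<open>A\<close>; the third keeps a quadratic part of the convexity surplus, on which
  stability rests. In the induction, multiplying by \<open>A\<close> leaves exactly the nonnegative
  remainder \<open>(k + 2) * y ^ (k + 1) * (A - y)^2\<close>.\<close>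

lemma strong_bernoulli:
  fixes A y :: real
  assumes "0 \<le> A" "0 \<le> y"
  shows "y ^ Suc (Suc k) + real (Suc (Suc k)) * y ^ Suc k * (A - y) + (A - y)^2 * A ^ k \<le> A ^ Suc (Suc k)"
proof (induction k)
  case 0 show ?case by (simp add: algebra_simps power2_eq_square)
next
  case (Suc k)
  have "A ^ Suc (Suc (Suc k)) \<ge> A * (y ^ Suc (Suc k) + real (Suc (Suc k)) * y ^ Suc k * (A - y) + (A - y)^2 * A ^ k)"
    using mult_left_mono[OF Suc.IH assms(1)] by simp
  moreover have "A * (y ^ Suc (Suc k) + real (Suc (Suc k)) * y ^ Suc k * (A - y) + (A - y)^2 * A ^ k)
     - (y ^ Suc (Suc (Suc k)) + real (Suc (Suc (Suc k))) * y ^ Suc (Suc k) * (A - y) + (A - y)^2 * A ^ Suc k)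
     = real (Suc (Suc k)) * y ^ Suc k * (A - y)^2"
    by (simp add: algebra_simps power2_eq_square)
  moreover have "real (Suc (Suc k)) * y ^ Suc k * (A - y)^2 \<ge> 0"
    using assms by simp
  ultimately show ?case by linarith
qed

lemma bernoulli_tangent:
  fixes A y :: real
  assumes "0 \<le> A" "0 \<le> y"
  shows "y ^ Suc k + real (Suc k) * y ^ k * (A - y) \<le> A ^ Suc k"
proof (cases k)
  case (Suc j)
  have "(A - y)^2 * A ^ j \<ge> 0" using assms by simp
  then show ?thesis using strong_bernoulli[OF assms, of j] Suc by simp
qed simp

lemma no_singleton_clique: "cliques adj (Suc 0) V = {} \<Longrightarrow> V = {}"
proof (rule ccontr)
  assume "V \<noteq> {}"
  then obtain x where "x \<in> V" by auto
  then have "{x} \<in> cliques adj (Suc 0) V" by (auto simp: cliques_def ksubsets_def clique_def)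
  moreover assume "cliques adj (Suc 0) V = {}"
  ultimately show False by simp
qed

text \<open>Cliques meeting the complement of the neighbourhood of \<open>x\<close> are counted from their
  vertices there, whose neighbourhoods are at most as large as that of \<open>x\<close>.\<close>
lemma card_cliques_max_degree:
  assumes V: "finite V" and x: "x \<in> V"
    and b: "\<And>v. v \<in> V \<Longrightarrow> card (cliques adj k (nbrs adj V v)) \<le> b"
  shows "card (cliques adj (Suc k) V)
    \<le> (card V - card (nbrs adj V x)) * b + card (cliques adj (Suc k) (nbrs adj V x))"
proof -
  let ?N = "nbrs adj V x"
  have N: "?N \<subseteq> V" by (auto simp: nbrs_def)
  have "cliques adj (Suc k) V \<subseteq> (\<Union>v\<in>V - ?N. {A \<in> cliques adj (Suc k) V. v \<in> A}) \<union> cliques adj (Suc k) ?N"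
    by (auto simp: cliques_def ksubsets_def)
  then have "card (cliques adj (Suc k) V)
     \<le> card ((\<Union>v\<in>V - ?N. {A \<in> cliques adj (Suc k) V. v \<in> A}) \<union> cliques adj (Suc k) ?N)"
    using V by (intro card_mono) (auto simp: finite_cliques finite_nbrs)
  also have "\<dots> \<le> card (\<Union>v\<in>V - ?N. {A \<in> cliques adj (Suc k) V. v \<in> A}) + card (cliques adj (Suc k) ?N)"
    by (rule card_Un_le)
  also have "card (\<Union>v\<in>V - ?N. {A \<in> cliques adj (Suc k) V. v \<in> A})
      \<le> (\<Sum>v\<in>V - ?N. card {A \<in> cliques adj (Suc k) V. v \<in> A})"
    using V by (intro card_UN_le) simp
  also have "\<dots> \<le> (\<Sum>v\<in>V - ?N. b)"
    using card_cliques_mem[OF V] b by (intro sum_mono) (meson Diff_iff le_trans)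
  also have "\<dots> = (card V - card ?N) * b"
    using V N by (simp add: card_Diff_subset finite_nbrs)
  finally show ?thesis by simp
qed

lemma real_choose_Suc_Suc:
  "real (Suc l) * real (l choose k) = real (Suc k) * real (Suc l choose Suc k)"
  using Suc_times_binomial[of k l] by (metis of_nat_mult)

text \<open>The left side is what clique counting at a vertex of degree \<open>l * y\<close> yields.
  Pulling out one binomial coefficient exposes the tangent of \<open>x ^ Suc k\<close> at
  \<open>y\<close>, evaluated at \<open>n / Suc l\<close>, so convexity can finish.\<close>

lemma choose_weight_identity:
  fixes n y :: real
  shows "(n - real l * y) * real (l choose k) * y ^ k + real (l choose Suc k) * y ^ Suc k
    = real (Suc l choose Suc k) * (y ^ Suc k + real (Suc k) * y ^ k * (n / real (Suc l) - y))"
proof -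
  define c where "c = real (Suc l choose Suc k)"
  have a: "real (l choose k) = real (Suc k) * c / real (Suc l)"
    using real_choose_Suc_Suc[of l k] unfolding c_def by (simp add: field_simps del: of_nat_Suc)
  have "real (l choose Suc k) = c - real (l choose k)" unfolding c_def by simp
  then have b: "real (l choose Suc k) = c - real (Suc k) * c / real (Suc l)" using a by simp
  have l: "real l = real (Suc l) - 1" by simp
  have "real (Suc l) \<noteq> 0" by simp
  then show ?thesis unfolding a b l c_def[symmetric]
    by (simp add: field_simps del: of_nat_Suc)
qed

text \<open>Hypothesis \<open>Z\<close> is Zykov's bound inside neighbourhoods, and \<open>y\<close>
  is the class size of a Turan graph of degree \<open>l * y\<close>. The conclusion stays a tangent
  because it is relaxed twice: by convexity alone for Zykov's bound, and with the quadratic surplus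
  for stability.\<close>

lemma card_cliques_max_degree_weight:
  assumes V: "finite V" and x: "x \<in> V" and y0: "0 \<le> y"
    and deg: "real (card (nbrs adj V x)) = real l * y"
    and Z: "\<And>v i. v \<in> V \<Longrightarrow> real (card (cliques adj i (nbrs adj V v))) \<le> real (l choose i) * y ^ i"
  shows "real (card (cliques adj (Suc j) V))
    \<le> real (Suc l choose Suc j) * (y ^ Suc j + real (Suc j) * y ^ j * (real (card V) / real (Suc l) - y))"
proof -
  \<comment> \<open>Rounding down is needed because \<open>card_cliques_max_degree\<close> takes a
    natural number as its bound.\<close>
  define b where "b = nat \<lfloor>real (l choose j) * y ^ j\<rfloor>"
  have b1: "real b \<le> real (l choose j) * y ^ j" unfolding b_def using y0 by simp
  have b2: "card (cliques adj j (nbrs adj V v)) \<le> b" if "v \<in> V" for v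
    unfolding b_def using Z[OF that, of j] by (simp add: le_nat_floor)
  have c: "card (nbrs adj V x) \<le> card V" using V by (intro card_mono) (auto simp: nbrs_def)
  have "real (card (cliques adj (Suc j) V))
     \<le> real ((card V - card (nbrs adj V x)) * b + card (cliques adj (Suc j) (nbrs adj V x)))"
    using card_cliques_max_degree[OF V x b2] by (simp only: of_nat_le_iff)
  also have "\<dots> = (real (card V) - real l * y) * real b + real (card (cliques adj (Suc j) (nbrs adj V x)))"
    using c deg by (simp add: of_nat_diff)
  also have "\<dots> \<le> (real (card V) - real l * y) * (real (l choose j) * y ^ j) + real (l choose Suc j) * y ^ Suc j"
    using c deg b1 Z[OF x, of "Suc j"] by (intro add_mono mult_left_mono) auto
  also have "\<dots> = real (Suc l choose Suc j) * (y ^ Suc j + real (Suc j) * y ^ j * (real (card V) / real (Suc l) - y))"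
    using choose_weight_identity[of "real (card V)" l y j] by (simp only: mult.assoc)
  finally show ?thesis .
qed

text \<open>Induction on \<open>l\<close>, since the admissible clique size drops by one in a
  neighbourhood. A tangent at \<open>y\<close> lies below the power at \<open>card V / Suc l\<close>
  whatever \<open>y\<close> is, so the value of the maximum degree does not matter. For
  \<open>l = 0\<close> the graph is empty.\<close>

theorem zykov_clique_bound:
  assumes "finite V" "\<And>x y. adj x y \<Longrightarrow> adj y x" "\<And>x. \<not> adj x x"
    and "cliques adj (Suc l) V = {}"
  shows "real (card (cliques adj k V)) \<le> real (l choose k) * (real (card V) / real l) ^ k"
  using assms(1,4)
proof (induction l arbitrary: k V)
  case 0
  have "V = {}" using no_singleton_clique 0 by blast
  have "cliques adj k V \<subseteq> (if k = 0 then {{}} else {})"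
    using \<open>V = {}\<close> by (auto simp: cliques_def ksubsets_def)
  then have "card (cliques adj k V) \<le> card (if k = 0 then {{}} else {} :: 'a set set)"
    by (intro card_mono) auto
  then show ?case by (cases k) auto
next
  case (Suc l)
  show ?case
  proof (cases k)
    case 0
    have "cliques adj 0 V \<subseteq> {{}}" using Suc.prems by (auto simp: cliques_def ksubsets_def dest: finite_subset)
    then have "card (cliques adj 0 V) \<le> card {{} :: 'a set}" by (intro card_mono) auto
    then show ?thesis using 0 by simp
  next
    case k: (Suc j)
    show ?thesis
    proof (cases "V = {}")
      case True
      then show ?thesis using k by (auto simp: cliques_def ksubsets_def)
    next
      case False
      obtain x where x: "x \<in> V" "\<And>y. y \<in> V \<Longrightarrow> card (nbrs adj V y) \<le> card (nbrs adj V x)"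
        using exists_max_degree[OF Suc.prems(1) False] by blast
      define y where "y = real (card (nbrs adj V x)) / real l"
      let ?b = "card (cliques adj j (nbrs adj V x))"
      have free: "cliques adj (Suc l) (nbrs adj V v) = {}" if "v \<in> V" for v
        by (rule nbrs_clique_free[OF Suc.prems(1) that assms(2,3) Suc.prems(2)])
      \<comment> \<open>For \<open>l = 0\<close> the definition of \<open>y\<close> divides by zero;
        then neighbourhoods are empty and both sides vanish.\<close>
      have deg: "real (card (nbrs adj V x)) = real l * y"
      proof (cases l)
        case 0
        then have "nbrs adj V x = {}" using no_singleton_clique free[OF x(1)] by blast
        then show ?thesis using 0 by simp
      qed (simp add: y_def)
      have IH: "real (card (cliques adj i (nbrs adj V v))) \<le> real (l choose i) * y ^ i" if "v \<in> V" for v i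
      proof -
        have "real (card (cliques adj i (nbrs adj V v)))
           \<le> real (l choose i) * (real (card (nbrs adj V v)) / real l) ^ i"
          using Suc.IH[OF finite_nbrs[OF Suc.prems(1)] free[OF that]] .
        also have "\<dots> \<le> real (l choose i) * y ^ i"
          unfolding y_def using x(2)[OF that]
          by (intro mult_left_mono power_mono divide_right_mono) auto
        finally show ?thesis .
      qed
      have y0: "y \<ge> 0" unfolding y_def by simp
      have "real (card (cliques adj (Suc j) V))
         \<le> real (Suc l choose Suc j) * (y ^ Suc j + real (Suc j) * y ^ j * (real (card V) / real (Suc l) - y))"
        by (rule card_cliques_max_degree_weight[OF Suc.prems(1) x(1) y0 deg IH])
      also have "\<dots> \<le> real (Suc l choose Suc j) * (real (card V) / real (Suc l)) ^ Suc j"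
        using y0 by (intro mult_left_mono bernoulli_tangent) auto
      finally show ?thesis using k by simp
    qed
  qed
qed

text \<open>Writing \<open>A = n / l\<close> and \<open>y\<close> for the maximum degree divided by \<open>l - 1\<close>, the square term
  is what forces \<open>y\<close> to be close to \<open>A\<close> in a nearly extremal graph.\<close>
lemma zykov_max_degree_bound:
  fixes V :: "'a set"
  assumes V: "finite V" and sym: "\<And>x y. adj x y \<Longrightarrow> adj y x" and irr: "\<And>x. \<not> adj x x"
    and free: "cliques adj (Suc l) V = {}" and l: "l \<ge> 2" and x: "x \<in> V"
    and max: "\<And>v. v \<in> V \<Longrightarrow> card (nbrs adj V v) \<le> card (nbrs adj V x)"
  defines "A \<equiv> real (card V) / real l" and "y \<equiv> real (card (nbrs adj V x)) / real (l - 1)"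
  shows "real (card (cliques adj (Suc (Suc k)) V))
    \<le> real (l choose Suc (Suc k)) * (A ^ Suc (Suc k) - (A - y)^2 * A ^ k)"
proof -
  obtain l' where l': "l = Suc l'" "l' \<ge> 1" using l by (cases l) auto
  have y0: "y \<ge> 0" unfolding y_def by simp
  have deg: "real (card (nbrs adj V x)) = real l' * y" using l' unfolding y_def by simp
  have Z: "real (card (cliques adj i (nbrs adj V v))) \<le> real (l' choose i) * y ^ i" if "v \<in> V" for v i
  proof -
    have "cliques adj (Suc l') (nbrs adj V v) = {}"
      using nbrs_clique_free[where adj=adj, OF V that sym irr] free l' by simp
    then have "real (card (cliques adj i (nbrs adj V v)))
       \<le> real (l' choose i) * (real (card (nbrs adj V v)) / real l') ^ i"
      using zykov_clique_bound[where adj=adj, OF finite_nbrs[OF V] sym irr] by blast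
    also have "\<dots> \<le> real (l' choose i) * y ^ i"
      unfolding y_def using max[OF that] l'
      by (intro mult_left_mono power_mono) (auto intro: divide_right_mono)
    finally show ?thesis .
  qed
  let ?j = "Suc k"
  have "real (card (cliques adj (Suc ?j) V))
      \<le> real (Suc l' choose Suc ?j) * (y ^ Suc ?j + real (Suc ?j) * y ^ ?j * (real (card V) / real (Suc l') - y))"
    by (rule card_cliques_max_degree_weight[OF V x y0 deg Z])
  also have "\<dots> \<le> real (l choose Suc ?j) * (A ^ Suc ?j - (A - y)^2 * A ^ k)"
    using strong_bernoulli[of A y k] y0 unfolding A_def l'
    by (intro mult_left_mono) auto
  finally show ?thesis .
qed

section \<open>Stability\<close>

text \<open>Ordered pairs, so that row sums are degrees and the total is the degree sum; an edge
  inside \<open>A = B\<close> counts twice.\<close>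

definition adj_pairs :: "('a \<Rightarrow> 'a \<Rightarrow> bool) \<Rightarrow> 'a set \<Rightarrow> 'a set \<Rightarrow> ('a \<times> 'a) set" where
  "adj_pairs P A B = {(u, v) \<in> A \<times> B. P u v}"

lemma finite_adj_pairs: "finite A \<Longrightarrow> finite B \<Longrightarrow> finite (adj_pairs P A B)"
  unfolding adj_pairs_def by (rule finite_subset[of _ "A \<times> B"]) auto

lemma card_adj_pairs: "finite A \<Longrightarrow> finite B \<Longrightarrow> card (adj_pairs P A B) = (\<Sum>a\<in>A. card {b\<in>B. P a b})"
proof -
  assume f: "finite A" "finite B"
  have "adj_pairs P A B = Sigma A (\<lambda>a. {b\<in>B. P a b})" by (auto simp: adj_pairs_def)
  then show ?thesis using f by (simp add: card_SigmaI)
qed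

lemma card_adj_pairs_Un:
  assumes "finite N" "finite W" "N \<inter> W = {}" "\<And>x y. P x y \<Longrightarrow> P y x"
  shows "card (adj_pairs P (N \<union> W) (N \<union> W))
    = card (adj_pairs P N N) + 2 * card (adj_pairs P W N) + card (adj_pairs P W W)"
proof -
  have "prod.swap ` adj_pairs P W N = adj_pairs P N W"
    using assms(4) by (force simp: adj_pairs_def)
  moreover have "card (prod.swap ` adj_pairs P W N) = card (adj_pairs P W N)"
    by (intro card_image inj_onI) auto
  ultimately have sw: "card (adj_pairs P N W) = card (adj_pairs P W N)" by simp
  have eq: "adj_pairs P (N \<union> W) (N \<union> W)
     = (adj_pairs P N N \<union> adj_pairs P N W) \<union> (adj_pairs P W N \<union> adj_pairs P W W)"
    by (auto simp: adj_pairs_def)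
  have "card (adj_pairs P (N \<union> W) (N \<union> W))
    = (card (adj_pairs P N N) + card (adj_pairs P N W)) + (card (adj_pairs P W N) + card (adj_pairs P W W))"
  proof -
    have "adj_pairs P N N \<inter> adj_pairs P N W = {}" "adj_pairs P W N \<inter> adj_pairs P W W = {}"
      "(adj_pairs P N N \<union> adj_pairs P N W) \<inter> (adj_pairs P W N \<union> adj_pairs P W W) = {}"
      using assms(3) by (auto simp: adj_pairs_def)
    then show ?thesis
      unfolding eq using assms(1,2) by (simp add: card_Un_disjoint finite_adj_pairs)
  qed
  then show ?thesis using sw by simp
qed

text \<open>Fueredi's argument: the colour classes are obtained by repeatedly splitting off the
  non-neighbours of a vertex of maximum degree.\<close>
lemma furedi_coloring:
  assumes "finite V" "\<And>x y. adj x y \<Longrightarrow> adj y x" "\<And>x. \<not> adj x x"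
    and "cliques adj (Suc l) V = {}"
  shows "\<exists>f. (\<forall>v\<in>V. f v < l) \<and>
    card (adj_pairs adj V V) + card (adj_pairs (\<lambda>u v. adj u v \<and> f u = f v) V V)
      \<le> card (adj_pairs (\<lambda>u v. f u \<noteq> (f v :: nat)) V V)"
  using assms(1,4)
proof (induction l arbitrary: V)
  case 0
  have "V = {}" using no_singleton_clique 0 by blast
  then show ?case by (auto simp: adj_pairs_def)
next
  case (Suc l)
  show ?case
  proof (cases "V = {}")
    case True then show ?thesis by (auto simp: adj_pairs_def)
  next
    case False
    obtain x where x: "x \<in> V" "\<And>y. y \<in> V \<Longrightarrow> card (nbrs adj V y) \<le> card (nbrs adj V x)"
      using exists_max_degree[OF Suc.prems(1) False] by blast
    define N where "N = nbrs adj V x"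
    define W where "W = V - N"
    have N: "N \<subseteq> V" "finite N" using Suc.prems(1) by (auto simp: N_def nbrs_def)
    have W: "finite W" "N \<inter> W = {}" "V = N \<union> W" using Suc.prems(1) N by (auto simp: W_def)
    have "cliques adj (Suc l) N = {}"
      unfolding N_def by (rule nbrs_clique_free[OF Suc.prems(1) x(1) assms(2,3) Suc.prems(2)])
    from Suc.IH[OF N(2) this] obtain f where f: "\<forall>v\<in>N. f v < l"
      "card (adj_pairs adj N N) + card (adj_pairs (\<lambda>u v. adj u v \<and> f u = f v) N N)
        \<le> card (adj_pairs (\<lambda>u v. f u \<noteq> (f v :: nat)) N N)" by blast
    define g where "g v = (if v \<in> N then f v else l)" for v
    let ?mono = "\<lambda>g u v. adj u v \<and> g u = g v"
    let ?dif = "\<lambda>g u v. g u \<noteq> (g v :: nat)"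
    have m: "adj_pairs (?mono g) N N = adj_pairs (?mono f) N N"
      "adj_pairs (?mono g) W N = {}" "adj_pairs (?mono g) W W = adj_pairs adj W W"
      "adj_pairs (?dif g) N N = adj_pairs (?dif f) N N"
      "adj_pairs (?dif g) W N = W \<times> N" "adj_pairs (?dif g) W W = {}"
      using f(1) W by (auto simp: adj_pairs_def g_def disjoint_iff split: if_splits) (metis less_irrefl)?
    \<comment> \<open>A vertex of \<open>W\<close> has degree at most \<open>card N\<close>, its
      number of pairs in the complete bipartite graph between \<open>W\<close> and \<open>N\<close>.
      Edges inside \<open>W\<close>, which become monochromatic, are paid for in this
      comparison.\<close>
    have "card (adj_pairs adj W N) + card (adj_pairs adj W W) = card (adj_pairs adj W V)"
    proof -
      have "adj_pairs adj W V = adj_pairs adj W N \<union> adj_pairs adj W W" using W by (auto simp: adj_pairs_def)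
      moreover have "adj_pairs adj W N \<inter> adj_pairs adj W W = {}" using W by (auto simp: adj_pairs_def)
      ultimately show ?thesis using W N by (simp add: card_Un_disjoint finite_adj_pairs)
    qed
    also have "\<dots> = (\<Sum>a\<in>W. card (nbrs adj V a))"
      using W Suc.prems by (simp add: card_adj_pairs nbrs_def)
    also have "\<dots> \<le> (\<Sum>a\<in>W. card N)" unfolding N_def using x(2) W by (intro sum_mono) auto
    also have "\<dots> = card (adj_pairs (?dif g) W N)" using m by (simp add: card_cartesian_product)
    finally have key: "card (adj_pairs adj W N) + card (adj_pairs adj W W) \<le> card (adj_pairs (?dif g) W N)" .
    have s: "card (adj_pairs P V V)
       = card (adj_pairs P N N) + 2 * card (adj_pairs P W N) + card (adj_pairs P W W)"
      if "\<And>x y. P x y \<Longrightarrow> P y x" for P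
      unfolding W(3) by (rule card_adj_pairs_Un[OF N(2) W(1,2) that])
    have a: "card (adj_pairs adj V V)
       = card (adj_pairs adj N N) + 2 * card (adj_pairs adj W N) + card (adj_pairs adj W W)"
      by (rule s) (rule assms(2))
    have b: "card (adj_pairs (?mono g) V V) = card (adj_pairs (?mono f) N N) + card (adj_pairs adj W W)"
      by (subst s) (auto simp: m intro: assms(2))
    have c: "card (adj_pairs (?dif g) V V) = card (adj_pairs (?dif f) N N) + 2 * card (adj_pairs (?dif g) W N)"
      by (subst s) (auto simp: m)
    have "card (adj_pairs adj V V) + card (adj_pairs (?mono g) V V) \<le> card (adj_pairs (?dif g) V V)"
      using a b c f(2) key by linarith
    moreover have "\<forall>v\<in>V. g v < Suc l" using f(1) by (auto simp: g_def less_Suc_eq)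
    ultimately show ?thesis by blast
  qed
qed

lemma sum_cliques_mem:
  assumes "finite V"
  shows "(\<Sum>v\<in>V. card {A \<in> cliques adj k V. v \<in> A}) = k * card (cliques adj k V)"
proof -
  have "(\<Sum>v\<in>V. card {A \<in> cliques adj k V. v \<in> A}) = (\<Sum>A\<in>cliques adj k V. card {v \<in> V. v \<in> A})"
    using sum_multicount_gen[of V "cliques adj k V" "\<lambda>v A. v \<in> A" "\<lambda>A. card {v \<in> V. v \<in> A}"]
      assms finite_cliques[OF assms] by simp
  also have "\<dots> = (\<Sum>A\<in>cliques adj k V. k)"
  proof (rule sum.cong)
    fix A assume "A \<in> cliques adj k V"
    then have "{v \<in> V. v \<in> A} = A" "card A = k" by (auto simp: cliques_def ksubsets_def)
    then show "card {v \<in> V. v \<in> A} = k" by simp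
  qed simp
  finally show ?thesis by simp
qed

text \<open>Each clique is counted at all its vertices, and those through \<open>v\<close> are
  bounded by Zykov inside the neighbourhood. Replacing all but one power of the degree by its
  maximum leaves a term linear in the degree, and the degrees sum to the number of adjacent
  pairs.\<close>

lemma degree_sum_bound:
  fixes V :: "'a set"
  assumes V: "finite V" and sym: "\<And>x y. adj x y \<Longrightarrow> adj y x" and irr: "\<And>x. \<not> adj x x"
    and free: "cliques adj (Suc l) V = {}" and l: "l \<ge> 2"
    and max: "\<And>v. v \<in> V \<Longrightarrow> real (card (nbrs adj V v)) \<le> real (l - 1) * y"
  shows "real (Suc (Suc k)) * real (card (cliques adj (Suc (Suc k)) V))
    \<le> real (l - 1 choose Suc k) * y ^ k * (real (card (adj_pairs adj V V)) / real (l - 1))"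
proof -
  have "real (card {A \<in> cliques adj (Suc (Suc k)) V. v \<in> A})
      \<le> real (l - 1 choose Suc k) * y ^ k * (real (card (nbrs adj V v)) / real (l - 1))" if v: "v \<in> V" for v
  proof -
    define z where "z = real (card (nbrs adj V v)) / real (l - 1)"
    have z: "0 \<le> z" "z \<le> y" unfolding z_def using max[OF v] l by (auto simp: field_simps)
    have "real (card {A \<in> cliques adj (Suc (Suc k)) V. v \<in> A}) \<le> real (card (cliques adj (Suc k) (nbrs adj V v)))"
      using card_cliques_mem[OF V v] by (simp only: of_nat_le_iff)
    also have "\<dots> \<le> real (l - 1 choose Suc k) * z ^ Suc k"
    proof -
      have "cliques adj (Suc (l - 1)) (nbrs adj V v) = {}"
        using nbrs_clique_free[where adj=adj and l="l - 1", OF V v sym irr] free l by simp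
      then show ?thesis unfolding z_def
        using zykov_clique_bound[where adj=adj, OF finite_nbrs[OF V] sym irr] by blast
    qed
    also have "\<dots> = real (l - 1 choose Suc k) * z ^ k * z" by simp
    also have "\<dots> \<le> real (l - 1 choose Suc k) * y ^ k * z"
      using z by (intro mult_right_mono mult_left_mono power_mono) auto
    finally show ?thesis unfolding z_def .
  qed
  then have "(\<Sum>v\<in>V. real (card {A \<in> cliques adj (Suc (Suc k)) V. v \<in> A}))
      \<le> (\<Sum>v\<in>V. real (l - 1 choose Suc k) * y ^ k * (real (card (nbrs adj V v)) / real (l - 1)))"
    by (rule sum_mono)
  also have "\<dots> = real (l - 1 choose Suc k) * y ^ k * (real (\<Sum>v\<in>V. card (nbrs adj V v)) / real (l - 1))"
    by (simp add: sum_distrib_left sum_divide_distrib)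
  also have "(\<Sum>v\<in>V. card (nbrs adj V v)) = card (adj_pairs adj V V)"
    using V by (simp add: card_adj_pairs nbrs_def)
  also have "(\<Sum>v\<in>V. real (card {A \<in> cliques adj (Suc (Suc k)) V. v \<in> A}))
     = real (Suc (Suc k) * card (cliques adj (Suc (Suc k)) V))"
    using sum_cliques_mem[OF V, where k = "Suc (Suc k)" and adj = adj]
    by (simp only: of_nat_sum[symmetric])
  finally show ?thesis by (simp only: of_nat_mult)
qed

lemma card_different_color_pairs:
  assumes V: "finite V" and f: "\<And>v. v \<in> V \<Longrightarrow> f v < (l :: nat)"
  shows "card (adj_pairs (\<lambda>u v. f u \<noteq> f v) V V) + (\<Sum>i<l. (card {v \<in> V. f v = i})\<^sup>2) = (card V)\<^sup>2"
proof -
  let ?D = "adj_pairs (\<lambda>u v. f u \<noteq> f v) V V" and ?S = "adj_pairs (\<lambda>u v. f u = f v) V V"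
  have "?D \<union> ?S = V \<times> V" "?D \<inter> ?S = {}" by (auto simp: adj_pairs_def)
  then have 1: "card ?D + card ?S = (card V)\<^sup>2"
    using V by (metis card_Un_disjoint card_cartesian_product finite_adj_pairs power2_eq_square)
  have "?S = (\<Union>i<l. {v \<in> V. f v = i} \<times> {v \<in> V. f v = i})" using f by (auto simp: adj_pairs_def)
  also have "card \<dots> = (\<Sum>i<l. card ({v \<in> V. f v = i} \<times> {v \<in> V. f v = i}))"
    using V by (subst card_UN_disjoint) auto
  finally show ?thesis using 1 by (simp add: card_cartesian_product power2_eq_square)
qed

lemma sum_card_color_classes:
  assumes V: "finite V" and f: "\<And>v. v \<in> V \<Longrightarrow> f v < (l :: nat)"
  shows "(\<Sum>i<l. card {v \<in> V. f v = i}) = card V"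
proof -
  have "card V = card (\<Union>i<l. {v \<in> V. f v = i})" by (rule arg_cong[where f=card]) (use f in auto)
  also have "\<dots> = (\<Sum>i<l. card {v \<in> V. f v = i})" using V by (subst card_UN_disjoint) auto
  finally show ?thesis by simp
qed

text \<open>Solved for \<open>s\<close>, the assumption gives a lower bound that is continuous in
  \<open>\<epsilon>\<close> at \<open>0\<close> and equals \<open>1 / l\<close> there. In the
  application \<open>s\<close> is the normalised number of adjacent pairs, and
  \<open>1 / l + sqrt \<epsilon>\<close> bounds the maximum degree divided by
  \<open>(l - 1) * n\<close>.\<close>

lemma stability_limit:
  assumes l: "l \<ge> 2" and \<kappa>: "(0::real) < \<kappa>"
  shows "\<exists>\<epsilon>>0. \<forall>s. (1 / real l) ^ Suc k - \<epsilon> \<le> (1 / real l + sqrt \<epsilon>) ^ k * s \<longrightarrow> 0 \<le> s \<longrightarrow> 1 / real l - \<kappa> \<le> s"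
proof -
  let ?g = "\<lambda>\<epsilon>. ((1 / real l) ^ Suc k - \<epsilon>) / (1 / real l + sqrt \<epsilon>) ^ k"
  have "isCont ?g 0" using l by (intro continuous_intros) auto
  then have "(?g \<longlongrightarrow> ?g 0) (at_right 0)"
    unfolding isCont_def by (simp add: filterlim_at_split)
  moreover have "?g 0 = 1 / real l" using l by simp
  ultimately have "(?g \<longlongrightarrow> 1 / real l) (at_right 0)" by simp
  then have "\<forall>\<^sub>F \<epsilon> in at_right 0. 1 / real l - \<kappa> < ?g \<epsilon>"
    using \<kappa> by (intro order_tendstoD) auto
  then obtain b where b: "b > 0" "\<And>\<epsilon>. 0 < \<epsilon> \<Longrightarrow> \<epsilon> < b \<Longrightarrow> 1 / real l - \<kappa> < ?g \<epsilon>"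
    unfolding eventually_at_right_field by auto
  define \<epsilon> where "\<epsilon> = b / 2"
  have e: "0 < \<epsilon>" "1 / real l - \<kappa> < ?g \<epsilon>" using b unfolding \<epsilon>_def by auto
  have p: "(1 / real l + sqrt \<epsilon>) ^ k > 0" using e l by (intro zero_less_power add_pos_pos) auto
  show ?thesis
  proof (intro exI[of _ \<epsilon>] conjI allI impI)
    fix s assume "(1 / real l) ^ Suc k - \<epsilon> \<le> (1 / real l + sqrt \<epsilon>) ^ k * s"
    then have "?g \<epsilon> \<le> s" using p by (simp add: divide_le_eq mult.commute)
    then show "1 / real l - \<kappa> \<le> s" using e by linarith
  qed (use e in auto)
qed

lemma sum_square_deviation:
  fixes a :: "nat \<Rightarrow> real"
  assumes "(\<Sum>i<l. a i) = n" "l > 0"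
  shows "(\<Sum>i<l. (a i - n / real l)\<^sup>2) = (\<Sum>i<l. (a i)\<^sup>2) - n\<^sup>2 / real l"
proof -
  have "(\<Sum>i<l. (a i - n / real l)\<^sup>2) = (\<Sum>i<l. (a i)\<^sup>2 - 2 * (n / real l) * a i + (n / real l)\<^sup>2)"
    by (intro sum.cong) (auto simp: power2_eq_square algebra_simps)
  also have "\<dots> = (\<Sum>i<l. (a i)\<^sup>2) - 2 * (n / real l) * n + real l * (n / real l)\<^sup>2"
    by (simp only: sum.distrib sum_subtractf sum_distrib_left[symmetric] assms(1)) simp
  also have "\<dots> = (\<Sum>i<l. (a i)\<^sup>2) - n\<^sup>2 / real l"
    using assms(2) by (simp add: power2_eq_square field_simps)
  finally show ?thesis .
qed

lemma abs_diff_le_of_sum_squares: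
  fixes a :: "nat \<Rightarrow> real"
  assumes "(\<Sum>i<l. a i) = n" "(\<Sum>i<l. (a i)\<^sup>2) \<le> n\<^sup>2 / real l + d\<^sup>2" "i < l" "d \<ge> 0"
  shows "\<bar>a i - n / real l\<bar> \<le> d"
proof -
  have "(\<Sum>i<l. (a i - n / real l)\<^sup>2) \<le> d\<^sup>2"
    using sum_square_deviation[OF assms(1)] assms(2,3) by simp
  moreover have "(a i - n / real l)\<^sup>2 \<le> (\<Sum>i<l. (a i - n / real l)\<^sup>2)"
    using assms(3) by (intro member_le_sum) auto
  ultimately have "\<bar>a i - n / real l\<bar>\<^sup>2 \<le> d\<^sup>2" by simp
  then show ?thesis using assms(4) by (rule power2_le_imp_le)
qed

text \<open>By the quadratic term of \<open>zykov_max_degree_bound\<close>, many cliques force the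
  maximum degree divided by \<open>l - 1\<close> close to \<open>n / l\<close>. This upper bound for
  the degrees is what \<open>degree_sum_bound\<close> needs to turn the clique count into many
  adjacent pairs.\<close>

lemma stability_degree_sum:
  assumes l: "l \<ge> 2" and k: "Suc (Suc k) \<le> l" and \<kappa>: "(0::real) < \<kappa>"
  shows "\<exists>\<epsilon>>0. \<forall>(V :: 'a set) adj. finite V \<longrightarrow> (\<forall>x y. adj x y \<longrightarrow> adj y x) \<longrightarrow> (\<forall>x. \<not> adj x x) \<longrightarrow>
     cliques adj (Suc l) V = {} \<longrightarrow>
     (real (l choose Suc (Suc k)) / real l ^ Suc (Suc k) - \<epsilon>) * real (card V) ^ Suc (Suc k)
        \<le> real (card (cliques adj (Suc (Suc k)) V)) \<longrightarrow>
     (1 - 1 / real l - \<kappa>) * (real (card V))\<^sup>2 \<le> real (card (adj_pairs adj V V))"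
proof -
  define C where "C = real (l choose Suc (Suc k))"
  define C' where "C' = real (l - 1 choose Suc k)"
  have C: "C \<ge> 1" "C' \<ge> 1" unfolding C_def C'_def using k l by (auto simp: Suc_le_eq)
  have CC: "real (Suc (Suc k)) * C = real l * C'"
    using real_choose_Suc_Suc[of "l - 1" "Suc k"] l unfolding C_def C'_def by simp
  obtain e where e: "e > 0" "\<And>s. (1 / real l) ^ Suc k - e \<le> (1 / real l + sqrt e) ^ k * s \<Longrightarrow> 0 \<le> s
      \<Longrightarrow> 1 / real l - \<kappa> / real l \<le> s"
    using stability_limit[OF l, of "\<kappa> / real l" k] \<kappa> l by auto
  \<comment> \<open>The first entry gives the deviation \<open>sqrt e * n\<close> of
    \<open>y\<close> from \<open>n / l\<close>, the second a loss of at most \<open>e\<close> when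
    cliques are counted at each of their \<open>Suc (Suc k)\<close> vertices.\<close>
  define \<epsilon> where "\<epsilon> = min (e / real l ^ k) (e / real (Suc (Suc k)))"
  have \<epsilon>: "\<epsilon> > 0" unfolding \<epsilon>_def using e l by simp
  have \<epsilon>1: "\<epsilon> * real l ^ k \<le> e" 
  proof -
    have "\<epsilon> \<le> e / real l ^ k" unfolding \<epsilon>_def by simp
    then show ?thesis using l by (simp add: le_divide_eq)
  qed
  have \<epsilon>2: "real (Suc (Suc k)) * \<epsilon> \<le> e"
  proof -
    have "\<epsilon> \<le> e / real (Suc (Suc k))" unfolding \<epsilon>_def by simp
    then show ?thesis by (simp add: le_divide_eq mult.commute del: of_nat_Suc)
  qed
  show ?thesis
  proof (intro exI[of _ \<epsilon>] conjI allI impI)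
    fix V :: "'a set" and adj :: "'a \<Rightarrow> 'a \<Rightarrow> bool"
    assume V: "finite V" and sym: "\<forall>x y. adj x y \<longrightarrow> adj y x" and irr: "\<forall>x. \<not> adj x x"
      and free: "cliques adj (Suc l) V = {}"
      and many: "(real (l choose Suc (Suc k)) / real l ^ Suc (Suc k) - \<epsilon>) * real (card V) ^ Suc (Suc k)
        \<le> real (card (cliques adj (Suc (Suc k)) V))"
    show "(1 - 1 / real l - \<kappa>) * (real (card V))\<^sup>2 \<le> real (card (adj_pairs adj V V))"
    proof (cases "V = {}")
      case True then show ?thesis by simp
    next
      case False
      define n where "n = real (card V)"
      have n: "n > 0" using False V unfolding n_def by (simp add: card_gt_0_iff)
      obtain x where x: "x \<in> V" "\<And>v. v \<in> V \<Longrightarrow> card (nbrs adj V v) \<le> card (nbrs adj V x)"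
        using exists_max_degree[OF V False] by blast
      define y where "y = real (card (nbrs adj V x)) / real (l - 1)"
      have sym': "\<And>x y. adj x y \<Longrightarrow> adj y x" and irr': "\<And>x. \<not> adj x x" using sym irr by blast+
      have "(C / real l ^ Suc (Suc k) - \<epsilon>) * n ^ Suc (Suc k)
          \<le> C * ((n / real l) ^ Suc (Suc k) - (n / real l - y)\<^sup>2 * (n / real l) ^ k)"
        using order_trans[OF many zykov_max_degree_bound[where adj=adj, OF V sym' irr' free l x]]
        unfolding C_def n_def y_def by simp
      then have "C * ((n / real l - y)\<^sup>2 * (n / real l) ^ k) \<le> \<epsilon> * n ^ Suc (Suc k)"
        by (simp add: algebra_simps power_divide)
      moreover have "1 * ((n / real l - y)\<^sup>2 * (n / real l) ^ k) \<le> C * ((n / real l - y)\<^sup>2 * (n / real l) ^ k)"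
        using C n by (intro mult_right_mono) auto
      ultimately have "(n / real l - y)\<^sup>2 * (n / real l) ^ k \<le> \<epsilon> * n ^ Suc (Suc k)" by linarith
      then have "(n / real l - y)\<^sup>2 * n ^ k \<le> (\<epsilon> * real l ^ k * n\<^sup>2) * n ^ k"
        using l by (simp add: power_divide field_simps power2_eq_square)
      then have "(n / real l - y)\<^sup>2 \<le> \<epsilon> * real l ^ k * n\<^sup>2" using n by simp
      also have "\<dots> \<le> e * n\<^sup>2" using \<epsilon>1 by (intro mult_right_mono) auto
      also have "\<dots> = (sqrt e * n)\<^sup>2" using e(1) by (simp add: power_mult_distrib)
      finally have sq: "\<bar>n / real l - y\<bar>\<^sup>2 \<le> (sqrt e * n)\<^sup>2" by simp
      have "0 \<le> sqrt e * n" using n e(1) by simp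
      with sq have "\<bar>n / real l - y\<bar> \<le> sqrt e * n" by (rule power2_le_imp_le)
      then have "y \<le> (1 / real l + sqrt e) * n" by (simp add: algebra_simps)
      moreover define z where "z = (1 / real l + sqrt e)"
      ultimately have yz: "y \<le> z * n" by simp
      have max: "real (card (nbrs adj V v)) \<le> real (l - 1) * (z * n)" if "v \<in> V" for v
      proof -
        have "real (card (nbrs adj V v)) \<le> real (card (nbrs adj V x))" using x(2)[OF that] by simp
        also have "\<dots> = real (l - 1) * y" using l unfolding y_def by simp
        also have "\<dots> \<le> real (l - 1) * (z * n)" using yz by (intro mult_left_mono) auto
        finally show ?thesis .
      qed
      define s where "s = real (card (adj_pairs adj V V)) / (real (l - 1) * n\<^sup>2)"
      have s: "real (card (adj_pairs adj V V)) = real (l - 1) * n\<^sup>2 * s" "s \<ge> 0"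
        unfolding s_def using n l by auto
      have "real (Suc (Suc k)) * ((C / real l ^ Suc (Suc k) - \<epsilon>) * n ^ Suc (Suc k))
          \<le> real (Suc (Suc k)) * real (card (cliques adj (Suc (Suc k)) V))"
        using many unfolding C_def n_def by (intro mult_left_mono) auto
      also have "\<dots> \<le> C' * (z * n) ^ k * (real (card (adj_pairs adj V V)) / real (l - 1))"
        using degree_sum_bound[where adj=adj, OF V sym' irr' free l max] unfolding C'_def by simp
      also have "\<dots> = (C' * z ^ k * s) * n ^ Suc (Suc k)"
        unfolding s(1) using l by (simp add: power_mult_distrib power2_eq_square)
      finally have "(real (Suc (Suc k)) * (C / real l ^ Suc (Suc k) - \<epsilon>)) * n ^ Suc (Suc k)
          \<le> (C' * z ^ k * s) * n ^ Suc (Suc k)" by (simp only: mult.assoc)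
      then have "real (Suc (Suc k)) * (C / real l ^ Suc (Suc k) - \<epsilon>) \<le> C' * z ^ k * s"
        using n by (simp del: of_nat_Suc power_Suc)
      moreover have "real (Suc (Suc k)) * (C / real l ^ Suc (Suc k)) = C' * (1 / real l) ^ Suc k"
      proof -
        have "real (Suc (Suc k)) * (C / real l ^ Suc (Suc k)) = (real l * C') / real l ^ Suc (Suc k)"
          unfolding CC[symmetric] by simp
        also have "\<dots> = C' * (1 / real l) ^ Suc k" using l by (simp add: power_divide)
        finally show ?thesis .
      qed
      moreover have "real (Suc (Suc k)) * \<epsilon> \<le> C' * e"
        using \<epsilon>2 C mult_right_mono[of 1 C' e] e(1) by linarith
      ultimately have "C' * ((1 / real l) ^ Suc k - e) \<le> C' * (z ^ k * s)"
        by (simp only: right_diff_distrib mult.assoc)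
      then have "(1 / real l) ^ Suc k - e \<le> z ^ k * s" using C by (simp only: mult_le_cancel_left_pos)
      from e(2)[OF this[unfolded z_def] s(2)] have "1 / real l - \<kappa> / real l \<le> s" .
      then have "real (l - 1) * n\<^sup>2 * (1 / real l - \<kappa> / real l) \<le> real (card (adj_pairs adj V V))"
        unfolding s(1) by (intro mult_left_mono) auto
      moreover have "real (l - 1) * (1 / real l - \<kappa> / real l) \<ge> 1 - 1 / real l - \<kappa>"
        using l \<kappa> by (simp add: field_simps of_nat_diff)
      then have "real (l - 1) * (1 / real l - \<kappa> / real l) * n\<^sup>2 \<ge> (1 - 1 / real l - \<kappa>) * n\<^sup>2"
        by (intro mult_right_mono) auto
      ultimately show ?thesis unfolding n_def[symmetric] by (simp add: mult.commute mult.left_commute)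
    qed
  qed (use \<epsilon> in auto)
qed

text \<open>In Fueredi's colouring the bichromatic pairs are at least as many as the adjacent ones,
  which nearly reach \<open>(1 - 1 / l) * n^2\<close>. Hence the class sizes have small variance. As
  the bichromatic pairs cannot exceed that value, few of them are non-adjacent.\<close>

theorem clique_stability:
  assumes l: "l \<ge> 2" and k: "2 \<le> k" "k \<le> l" and \<kappa>: "(0::real) < \<kappa>"
  shows "\<exists>\<epsilon>>0. \<forall>(V :: 'a set) adj. finite V \<longrightarrow> (\<forall>x y. adj x y \<longrightarrow> adj y x) \<longrightarrow> (\<forall>x. \<not> adj x x) \<longrightarrow>
     cliques adj (Suc l) V = {} \<longrightarrow>
     (real (l choose k) / real l ^ k - \<epsilon>) * real (card V) ^ k \<le> real (card (cliques adj k V)) \<longrightarrow>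
     (\<exists>f. (\<forall>v\<in>V. f v < l) \<and>
        (\<forall>i<l. \<bar>real (card {v \<in> V. f v = i}) - real (card V) / real l\<bar> \<le> \<kappa> * real (card V)) \<and>
        real (card (adj_pairs (\<lambda>u v. f u \<noteq> f v \<and> \<not> adj u v) V V)) \<le> \<kappa> * (real (card V))\<^sup>2)"
proof -
  \<comment> \<open>The square is for the class sizes, which are controlled through squares;
    \<open>\<kappa> / 2\<close> pays for a factor 2 in the count of missing pairs.\<close>
  define \<eta> where "\<eta> = min (\<kappa> / 2) (\<kappa>\<^sup>2)"
  have \<eta>: "\<eta> > 0" "2 * \<eta> \<le> \<kappa>" "\<eta> \<le> \<kappa>\<^sup>2" unfolding \<eta>_def using \<kappa> by auto
  obtain j where j: "k = Suc (Suc j)" using k by (metis add_2_eq_Suc le_Suc_ex)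
  obtain \<epsilon> where \<epsilon>: "\<epsilon> > 0" and st: "\<And>(V :: 'a set) adj. finite V \<Longrightarrow> (\<forall>x y. adj x y \<longrightarrow> adj y x) \<Longrightarrow> (\<forall>x. \<not> adj x x) \<Longrightarrow>
     cliques adj (Suc l) V = {} \<Longrightarrow>
     (real (l choose k) / real l ^ k - \<epsilon>) * real (card V) ^ k \<le> real (card (cliques adj k V)) \<Longrightarrow>
     (1 - 1 / real l - \<eta>) * (real (card V))\<^sup>2 \<le> real (card (adj_pairs adj V V))"
    using stability_degree_sum[OF l k(2)[unfolded j] \<eta>(1)] unfolding j by blast
  show ?thesis
  proof (intro exI[of _ \<epsilon>] conjI allI impI)
    fix V :: "'a set" and adj :: "'a \<Rightarrow> 'a \<Rightarrow> bool"
    assume V: "finite V" and sym: "\<forall>x y. adj x y \<longrightarrow> adj y x" and irr: "\<forall>x. \<not> adj x x"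
      and free: "cliques adj (Suc l) V = {}"
      and many: "(real (l choose k) / real l ^ k - \<epsilon>) * real (card V) ^ k \<le> real (card (cliques adj k V))"
    define n where "n = real (card V)"
    have P: "(1 - 1 / real l - \<eta>) * n\<^sup>2 \<le> real (card (adj_pairs adj V V))"
      using st[OF V sym irr free many] unfolding n_def .
    obtain f where f: "\<forall>v\<in>V. f v < l" and fu: "card (adj_pairs adj V V) + card (adj_pairs (\<lambda>u v. adj u v \<and> f u = f v) V V)
      \<le> card (adj_pairs (\<lambda>u v. f u \<noteq> (f v :: nat)) V V)"
      using furedi_coloring[where adj=adj, OF V sym[rule_format] irr[rule_format] free] by blast
    let ?D = "adj_pairs (\<lambda>u v. f u \<noteq> f v) V V" and ?P = "adj_pairs adj V V"
    let ?M = "adj_pairs (\<lambda>u v. f u \<noteq> f v \<and> \<not> adj u v) V V" and ?S = "adj_pairs (\<lambda>u v. adj u v \<and> f u = f v) V V"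
    have sq: "real (card ?D) + (\<Sum>i<l. (real (card {v \<in> V. f v = i}))\<^sup>2) = n\<^sup>2"
      using card_different_color_pairs[OF V f[rule_format]] unfolding n_def
      by (simp only: of_nat_sum[symmetric] of_nat_add[symmetric] of_nat_power[symmetric])
    have sm: "(\<Sum>i<l. real (card {v \<in> V. f v = i})) = n"
      using sum_card_color_classes[OF V f[rule_format]] unfolding n_def by (simp only: of_nat_sum[symmetric])
    have DP: "real (card ?P) + real (card ?S) \<le> real (card ?D)" using fu by linarith
    have "(\<Sum>i<l. (real (card {v \<in> V. f v = i}))\<^sup>2) \<le> n\<^sup>2 - (1 - 1 / real l - \<eta>) * n\<^sup>2"
      using sq DP P by linarith
    also have "\<dots> = n\<^sup>2 / real l + \<eta> * n\<^sup>2" by (simp add: algebra_simps)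
    also have "\<dots> \<le> n\<^sup>2 / real l + (\<kappa> * n)\<^sup>2"
      using \<eta>(3) by (simp add: power_mult_distrib mult_right_mono)
    finally have b: "(\<Sum>i<l. (real (card {v \<in> V. f v = i}))\<^sup>2) \<le> n\<^sup>2 / real l + (\<kappa> * n)\<^sup>2" .
    have "\<bar>real (card {v \<in> V. f v = i}) - n / real l\<bar> \<le> \<kappa> * n" if "i < l" for i
      using abs_diff_le_of_sum_squares[OF sm b that] \<kappa> n_def by simp
    moreover have "real (card ?M) \<le> \<kappa> * n\<^sup>2"
    proof -
      have "(\<Sum>i<l. (real (card {v \<in> V. f v = i}))\<^sup>2) \<ge> n\<^sup>2 / real l"
      proof -
        have "0 \<le> (\<Sum>i<l. (real (card {v \<in> V. f v = i}) - n / real l)\<^sup>2)" by (intro sum_nonneg) auto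
        then show ?thesis using sum_square_deviation[OF sm] l by simp
      qed
      then have D: "real (card ?D) \<le> (1 - 1 / real l) * n\<^sup>2" using sq by (simp add: algebra_simps)
      have "card ?M + card ?P = card (?M \<union> ?P)"
        using V by (intro card_Un_disjoint[symmetric] finite_adj_pairs) (auto simp: adj_pairs_def)
      also have "?M \<union> ?P = ?D \<union> ?S" by (auto simp: adj_pairs_def)
      also have "card (?D \<union> ?S) = card ?D + card ?S"
        using V by (intro card_Un_disjoint finite_adj_pairs) (auto simp: adj_pairs_def)
      finally have "card ?M + card ?P = card ?D + card ?S" .
      then have "real (card ?M) + real (card ?P) = real (card ?D) + real (card ?S)" by linarith
      \<comment> \<open>The missing pairs number \<open>D - P + S\<close>, where \<open>S\<close>
        counts adjacent monochromatic pairs, and Fueredi's inequality bounds \<open>S\<close> by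
        \<open>D - P\<close>.\<close>
      moreover have "M \<le> 2 * (D - P)" if "M + P = D + S" "P + S \<le> D" for M P D S :: real
        using that by argo
      ultimately have "real (card ?M) \<le> 2 * (real (card ?D) - real (card ?P))" using DP by blast
      also have "\<dots> \<le> 2 * ((1 - 1 / real l) * n\<^sup>2 - (1 - 1 / real l - \<eta>) * n\<^sup>2)"
        using D P by (intro mult_left_mono diff_mono) auto
      also have "\<dots> = 2 * \<eta> * n\<^sup>2" by (simp add: algebra_simps)
      also have "\<dots> \<le> \<kappa> * n\<^sup>2" using \<eta>(2) by (intro mult_right_mono) auto
      finally show ?thesis .
    qed
    ultimately show "\<exists>f. (\<forall>v\<in>V. f v < l) \<and>
        (\<forall>i<l. \<bar>real (card {v \<in> V. f v = i}) - real (card V) / real l\<bar> \<le> \<kappa> * real (card V)) \<and>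
        real (card (adj_pairs (\<lambda>u v. f u \<noteq> f v \<and> \<not> adj u v) V V)) \<le> \<kappa> * (real (card V))\<^sup>2"
      using f unfolding n_def by blast
  qed (use \<epsilon> in auto)
qed

section \<open>Rainbow sets and Turan numbers\<close>

text \<open>The edge set of a complete multipartite hypergraph. Parts are encoded by a colouring, so
  that moving a vertex is a function update and the sets are cliques of a graph.\<close>

definition rainbow :: "nat \<Rightarrow> 'a set \<Rightarrow> ('a \<Rightarrow> 'b) \<Rightarrow> 'a set set" where
  "rainbow k A g = {e \<in> ksubsets k A. inj_on g e}"

lemma finite_rainbow: "finite A \<Longrightarrow> finite (rainbow k A g)"
  unfolding rainbow_def by (simp add: finite_ksubsets)

lemma rainbow_eq_cliques: "rainbow k A g = cliques (\<lambda>u v. g u \<noteq> g v) k A"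
  unfolding rainbow_def cliques_def clique_def inj_on_def by blast

lemma rainbow_cong: "(\<And>a. a \<in> A \<Longrightarrow> g a = h a) \<Longrightarrow> rainbow k A g = rainbow k A h"
  by (auto simp: rainbow_def ksubsets_def inj_on_def subset_iff)

text \<open>A complete multipartite graph with colours in \<open>I\<close> has no clique on more
  than \<open>card I\<close> vertices, so Zykov's bound applies.\<close>

lemma rainbow_upper:
  assumes A: "finite A" and I: "finite I" "g ` A \<subseteq> I"
  shows "real (card (rainbow k A g)) \<le> real (card I choose k) * (real (card A) / real (card I)) ^ k"
proof -
  have "cliques (\<lambda>u v. g u \<noteq> g v) (Suc (card I)) A = {}"
  proof (rule ccontr)
    assume "cliques (\<lambda>u v. g u \<noteq> g v) (Suc (card I)) A \<noteq> {}"
    then obtain e where e: "e \<subseteq> A" "card e = Suc (card I)" "inj_on g e"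
      unfolding rainbow_eq_cliques[symmetric] by (auto simp: rainbow_def ksubsets_def)
    have "card (g ` e) \<le> card I" using e(1) I by (intro card_mono) auto
    then show False using e by (simp add: card_image)
  qed
  from zykov_clique_bound[where adj="\<lambda>u v. g u \<noteq> g v", OF A _ _ this] show ?thesis
    unfolding rainbow_eq_cliques by auto
qed

lemma card_rainbow_0: "finite A \<Longrightarrow> card (rainbow 0 A g) = 1"
proof -
  assume "finite A"
  then have "rainbow 0 A g = {{}}" by (auto simp: rainbow_def ksubsets_def dest: finite_subset)
  then show ?thesis by simp
qed

lemma card_rainbow_insert:
  assumes A: "finite A" and x: "x \<notin> A"
  shows "card (rainbow (Suc k) (insert x A) g)
    = card (rainbow (Suc k) A g) + card (rainbow k {a \<in> A. g a \<noteq> g x} g)"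
proof -
  let ?R = "rainbow k {a \<in> A. g a \<noteq> g x} g"
  have eq: "rainbow (Suc k) (insert x A) g = rainbow (Suc k) A g \<union> insert x ` ?R"
  proof (intro equalityI subsetI)
    fix e assume e: "e \<in> rainbow (Suc k) (insert x A) g"
    then have fe: "finite e" using A by (auto simp: rainbow_def ksubsets_def dest: finite_subset)
    show "e \<in> rainbow (Suc k) A g \<union> insert x ` ?R"
    proof (cases "x \<in> e")
      case True
      then have "e - {x} \<in> ?R" "e = insert x (e - {x})"
        using e fe by (auto simp: rainbow_def ksubsets_def inj_on_def)
      then show ?thesis by blast
    next
      case False
      then show ?thesis using e by (auto simp: rainbow_def ksubsets_def)
    qed
  next
    fix e assume "e \<in> rainbow (Suc k) A g \<union> insert x ` ?R"
    then show "e \<in> rainbow (Suc k) (insert x A) g"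
    proof
      assume "e \<in> rainbow (Suc k) A g" then show ?thesis by (auto simp: rainbow_def ksubsets_def)
    next
      assume "e \<in> insert x ` ?R"
      then obtain e' where e': "e = insert x e'" "e' \<in> ?R" by blast
      then have "finite e'" "x \<notin> e'" using A x by (auto simp: rainbow_def ksubsets_def dest: finite_subset)
      then show ?thesis using e' by (auto simp: rainbow_def ksubsets_def inj_on_def)
    qed
  qed
  have "inj_on (insert x) ?R"
    using x by (intro inj_onI) (auto simp: rainbow_def ksubsets_def insert_ident set_eq_iff)
  moreover have "rainbow (Suc k) A g \<inter> insert x ` ?R = {}"
    using x by (auto simp: rainbow_def ksubsets_def)
  ultimately show ?thesis
    unfolding eq using A by (subst card_Un_disjoint) (auto simp: finite_rainbow card_image)
qed

text \<open>A rainbow set uses at most one vertex of the new class \<open>W\<close>.\<close>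

lemma card_rainbow_Un_class:
  assumes A: "finite A" and W: "finite W" "\<And>w. w \<in> W \<Longrightarrow> g w = c" and c: "c \<notin> g ` A"
  shows "card (rainbow (Suc k) (A \<union> W) g) = card (rainbow (Suc k) A g) + card W * card (rainbow k A g)"
  using W
proof (induction W rule: finite_induct)
  case empty then show ?case by simp
next
  case (insert w W)
  have w: "w \<notin> A \<union> W" using insert c by auto
  have "{a \<in> A \<union> W. g a \<noteq> g w} = A" using insert c by auto
  then show ?case using card_rainbow_insert[of "A \<union> W" w k g] insert A w by simp
qed

text \<open>Colours are added one at a time; Pascal's rule mirrors the split into sets that miss the
  new class and sets that use it.\<close>

lemma card_rainbow_lower:
  assumes "finite I" "finite A" "g ` A \<subseteq> I" "\<And>i. i \<in> I \<Longrightarrow> q \<le> card {a \<in> A. g a = i}"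
  shows "(card I choose k) * q ^ k \<le> card (rainbow k A g)"
  using assms
proof (induction I arbitrary: A k rule: finite_induct)
  case empty
  then show ?case by (cases k) (auto simp: card_rainbow_0)
next
  case (insert i I)
  show ?case
  proof (cases k)
    case 0 then show ?thesis using insert by (simp add: card_rainbow_0)
  next
    case (Suc j)
    define B where "B = {a \<in> A. g a \<noteq> i}"
    define W where "W = {a \<in> A. g a = i}"
    have AB: "A = B \<union> W" "finite B" "finite W" using insert.prems by (auto simp: B_def W_def)
    have qW: "q \<le> card W" using insert.prems(3)[of i] by (simp add: W_def)
    have "q \<le> card {a \<in> B. g a = i'}" if "i' \<in> I" for i'
    proof -
      have "{a \<in> B. g a = i'} = {a \<in> A. g a = i'}" using that insert.hyps by (auto simp: B_def)
      then show ?thesis using insert.prems(3)[of i'] that by simp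
    qed
    moreover have "g ` B \<subseteq> I" using insert.prems by (auto simp: B_def)
    ultimately have IH: "(card I choose m) * q ^ m \<le> card (rainbow m B g)" for m
      using insert.IH[OF AB(2)] by blast
    have "card (rainbow (Suc j) A g) = card (rainbow (Suc j) B g) + card W * card (rainbow j B g)"
      unfolding AB(1) by (rule card_rainbow_Un_class[where c=i]) (use AB(2,3) in \<open>auto simp: B_def W_def\<close>)
    moreover have "(card I choose Suc j) * q ^ Suc j + q * ((card I choose j) * q ^ j)
        \<le> card (rainbow (Suc j) B g) + card W * card (rainbow j B g)"
      by (intro add_mono mult_mono IH qW) auto
    ultimately show ?thesis using Suc insert.hyps by (simp add: algebra_simps)
  qed
qed

section \<open>Balanced colourings maximise the number of rainbow sets\<close>

definition balanced :: "nat \<Rightarrow> 'a set \<Rightarrow> ('a \<Rightarrow> nat) \<Rightarrow> bool" where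
  "balanced l V g \<longleftrightarrow> (\<forall>v\<in>V. g v < l) \<and>
     (\<forall>i<l. \<forall>j<l. card {v \<in> V. g v = i} \<le> card {v \<in> V. g v = j} + 1)"

text \<open>Only sets through \<open>x\<close> change. Those containing a vertex of class
  \<open>j\<close> are lost, those containing another vertex of class \<open>i\<close> are gained,
  and the latter are more numerous as class \<open>i\<close> is larger by at least two. Strictness
  needs a rainbow \<open>k\<close>-set outside both classes, which \<open>ne\<close>
  supplies.\<close>

lemma card_rainbow_move:
  assumes V: "finite V" and g: "\<And>v. v \<in> V \<Longrightarrow> g v < l" and x: "x \<in> V" "g x = i"
    and big: "card {v \<in> V. g v = j} + 2 \<le> card {v \<in> V. g v = i}"
    and ne: "rainbow (Suc (Suc k)) V g \<noteq> {}"
  shows "card (rainbow (Suc (Suc k)) V g) < card (rainbow (Suc (Suc k)) V (g(x := j)))"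
proof -
  have ij: "i \<noteq> j" using big by auto
  define A where "A = V - {x}"
  have A: "finite A" "x \<notin> A" "V = insert x A" using V x by (auto simp: A_def)
  define B where "B = {a \<in> A. g a \<noteq> i \<and> g a \<noteq> j}"
  let ?h = "g(x := j)"
  let ?Ai = "{a \<in> A. g a = i}" and ?Aj = "{a \<in> A. g a = j}"
  have fin: "finite B" "finite ?Ai" "finite ?Aj" using A by (auto simp: B_def)
  have "{v \<in> V. g v = i} = insert x ?Ai" "{v \<in> V. g v = j} = ?Aj" using A x ij by auto
  then have big': "card ?Aj < card ?Ai" using big A by simp
  have "rainbow (Suc (Suc k)) A ?h = rainbow (Suc (Suc k)) A g"
    by (rule rainbow_cong) (use A in auto)
  moreover have "rainbow (Suc k) {a \<in> A. ?h a \<noteq> ?h x} ?h = rainbow (Suc k) (B \<union> ?Ai) g"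
  proof -
    have "{a \<in> A. ?h a \<noteq> ?h x} = B \<union> ?Ai" using A ij by (auto simp: B_def)
    moreover have "rainbow (Suc k) (B \<union> ?Ai) ?h = rainbow (Suc k) (B \<union> ?Ai) g"
      by (rule rainbow_cong) (use A in \<open>auto simp: B_def\<close>)
    ultimately show ?thesis by simp
  qed
  ultimately have h: "card (rainbow (Suc (Suc k)) V ?h)
      = card (rainbow (Suc (Suc k)) A g) + card (rainbow (Suc k) (B \<union> ?Ai) g)"
    unfolding A(3) using card_rainbow_insert[OF A(1,2), of "Suc k" ?h] by simp
  have "{a \<in> A. g a \<noteq> g x} = B \<union> ?Aj" using x ij by (auto simp: B_def)
  then have g': "card (rainbow (Suc (Suc k)) V g)
      = card (rainbow (Suc (Suc k)) A g) + card (rainbow (Suc k) (B \<union> ?Aj) g)"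
    unfolding A(3) using card_rainbow_insert[OF A(1,2), of "Suc k" g] by simp
  have i: "card (rainbow (Suc k) (B \<union> ?Ai) g) = card (rainbow (Suc k) B g) + card ?Ai * card (rainbow k B g)"
    by (rule card_rainbow_Un_class[where c=i]) (use fin in \<open>auto simp: B_def\<close>)
  have j: "card (rainbow (Suc k) (B \<union> ?Aj) g) = card (rainbow (Suc k) B g) + card ?Aj * card (rainbow k B g)"
    by (rule card_rainbow_Un_class[where c=j]) (use fin in \<open>auto simp: B_def\<close>)
  \<comment> \<open>A rainbow set of size \<open>k + 2\<close> has at most one vertex in each of the
    classes \<open>i\<close> and \<open>j\<close>, so at least \<open>k\<close> of its vertices lie
    outside both. The vertex \<open>x\<close> is not among these, having colour
    \<open>i\<close>.\<close>
  have "rainbow k B g \<noteq> {}"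
  proof -
    obtain R where R: "R \<subseteq> V" "card R = Suc (Suc k)" "inj_on g R"
      using ne by (auto simp: rainbow_def ksubsets_def)
    have fR: "finite R" using R V finite_subset by blast
    have "g ` R - {i,j} \<subseteq> g ` (R \<inter> B)" using x A R(1) by (auto simp: B_def)
    then have "card (g ` R - {i,j}) \<le> card (g ` (R \<inter> B))" using fR by (intro card_mono) auto
    also have "\<dots> \<le> card (R \<inter> B)" using fR by (intro card_image_le) auto
    finally have "card (g ` R - {i,j}) \<le> card (R \<inter> B)" .
    moreover have "card (g ` R) - card {i,j} \<le> card (g ` R - {i,j})" by (rule diff_card_le_card_Diff) simp
    ultimately have "k \<le> card (R \<inter> B)" using R ij by (simp add: card_image)
    then obtain S where "S \<subseteq> R \<inter> B" "card S = k" by (meson obtain_subset_with_card_n)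
    then have "S \<in> rainbow k B g" using R(3) by (auto simp: rainbow_def ksubsets_def intro: inj_on_subset)
    then show ?thesis by auto
  qed
  then have "card (rainbow k B g) > 0" using fin by (simp add: card_gt_0_iff finite_rainbow)
  then show ?thesis using h g' i j big' by simp
qed

text \<open>The counts are bounded, so a maximiser exists, and \<open>card_rainbow_move\<close>
  would improve an unbalanced one. The same reason makes every other maximiser balanced, which is
  the source of uniqueness later.\<close>

lemma exists_balanced_max_rainbow:
  assumes V: "finite V" and k: "Suc (Suc k) \<le> l" "Suc (Suc k) \<le> card V"
  shows "\<exists>g. balanced l V g \<and>
    (\<forall>h. (\<forall>v\<in>V. h v < l) \<longrightarrow> card (rainbow (Suc (Suc k)) V h) \<le> card (rainbow (Suc (Suc k)) V g) \<and>
      (card (rainbow (Suc (Suc k)) V h) = card (rainbow (Suc (Suc k)) V g) \<longrightarrow> balanced l V h))"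
proof -
  let ?c = "\<lambda>h. card (rainbow (Suc (Suc k)) V h)"
  let ?P = "\<lambda>h. \<forall>v\<in>V. h v < l"
  have bound: "?c h \<le> card (ksubsets (Suc (Suc k)) V)" for h :: "'a \<Rightarrow> nat"
    using V by (intro card_mono) (auto simp: finite_ksubsets rainbow_def)
  have P0: "?P (\<lambda>_. 0)" using k by auto
  have "\<exists>g. ?P g \<and> (\<forall>h. ?P h \<longrightarrow> ?c h \<le> ?c g)"
    using ex_has_greatest_nat[of ?P "\<lambda>_. 0" ?c "Suc (card (ksubsets (Suc (Suc k)) V))"] P0 bound
    by (simp add: le_imp_less_Suc)
  then obtain g where g: "?P g" "\<And>h. ?P h \<Longrightarrow> ?c h \<le> ?c g" by blast
  \<comment> \<open>A move improves strictly only if there are rainbow sets at all. The witness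
    colours some set of the right size injectively.\<close>
  have pos: "?c g > 0"
  proof -
    obtain R where R: "R \<subseteq> V" "card R = Suc (Suc k)" "finite R"
      using obtain_subset_with_card_n[OF k(2)] by blast
    then obtain f where f: "bij_betw f R {..<Suc (Suc k)}"
      using finite_same_card_bij[of R "{..<Suc (Suc k)}"] by auto
    define h where "h v = (if v \<in> R then f v else 0)" for v
    have "f v < l" if "v \<in> R" for v using bij_betwE[OF f] that k(1) by fastforce
    then have "?P h" using k by (auto simp: h_def)
    moreover have "inj_on h R" using f by (auto simp: h_def bij_betw_def inj_on_def)
    then have "R \<in> rainbow (Suc (Suc k)) V h" using R by (auto simp: rainbow_def ksubsets_def)
    then have "?c h > 0" using V by (auto simp: card_gt_0_iff finite_rainbow)
    ultimately show ?thesis using g(2)[of h] by simp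
  qed
  have bal: "balanced l V h" if h: "?P h" "?c h = ?c g" for h
    unfolding balanced_def
  proof (intro conjI allI impI)
    fix i j assume "i < l" "j < l"
    show "card {v \<in> V. h v = i} \<le> card {v \<in> V. h v = j} + 1"
    proof (rule ccontr)
      assume "\<not> ?thesis"
      then have big: "card {v \<in> V. h v = j} + 2 \<le> card {v \<in> V. h v = i}" by simp
      then have "{v \<in> V. h v = i} \<noteq> {}" by (intro notI) simp
      then obtain x where x: "x \<in> V" "h x = i" by blast
      have "rainbow (Suc (Suc k)) V h \<noteq> {}" using pos h(2) by (intro notI) simp
      then have "?c h < ?c (h(x := j))"
        using card_rainbow_move[OF V _ x big] h(1) by blast
      moreover have "?P (h(x := j))" using h(1) \<open>j < l\<close> by auto
      ultimately show False using g(2)[of "h(x := j)"] h(2) by simp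
    qed
  qed (use h in auto)
  show ?thesis using bal[OF g(1)] g(2) bal by blast
qed

text \<open>Counting vertices modulo \<open>l\<close> identifies how many classes have the larger
  size, so \<open>card V\<close> and \<open>l\<close> determine the multiset of class sizes.\<close>

lemma balanced_card_class:
  assumes V: "finite V" and b: "balanced l V g" and l: "0 < l"
  shows "i < l \<Longrightarrow> card {v \<in> V. g v = i} \<in> {card V div l, Suc (card V div l)}"
    and "card {i \<in> {..<l}. card {v \<in> V. g v = i} = Suc (card V div l)} = card V mod l"
proof -
  let ?a = "\<lambda>i. card {v \<in> V. g v = i}"
  define q where "q = Min (?a ` {..<l})"
  have "q \<in> ?a ` {..<l}" unfolding q_def using l by (intro Min_in) auto
  then obtain i0 where i0: "i0 < l" "?a i0 = q" by auto
  have q: "?a i = q \<or> ?a i = Suc q" if "i < l" for i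
  proof -
    have "q \<le> ?a i" unfolding q_def using that by (intro Min_le) auto
    moreover have "?a i \<le> ?a i0 + 1" using b that i0 by (auto simp: balanced_def)
    ultimately show ?thesis using i0 by auto
  qed
  let ?B = "{i \<in> {..<l}. ?a i = Suc q}"
  have "card V = (\<Sum>i<l. ?a i)" using sum_card_color_classes[OF V, of g l] b by (simp add: balanced_def)
  also have "\<dots> = (\<Sum>i<l. q + (if ?a i = Suc q then 1 else 0))"
    using q by (intro sum.cong) auto
  also have "\<dots> = l * q + card ?B" by (simp add: sum.distrib sum.If_cases Int_def)
  finally have n: "card V = l * q + card ?B" .
  have "?B \<subseteq> {..<l} - {i0}" using i0 by auto
  then have "card ?B \<le> card ({..<l} - {i0})" by (intro card_mono) auto
  then have "card ?B < l" using i0 l by simp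
  then have "card V div l = q" "card V mod l = card ?B" unfolding n by auto
  then show "i < l \<Longrightarrow> ?a i \<in> {card V div l, Suc (card V div l)}"
    and "card {i \<in> {..<l}. ?a i = Suc (card V div l)} = card V mod l" using q by auto
qed

text \<open>Large classes are matched with large ones and small with small. Colours are permuted on
  the way, so only equality of colours is preserved.\<close>

lemma balanced_bij:
  assumes V: "finite V" "balanced l V g" and V': "finite V'" "balanced l V' g'"
    and c: "card V = card V'" and l: "0 < l"
  shows "\<exists>b. bij_betw b V V' \<and> (\<forall>u\<in>V. \<forall>v\<in>V. g' (b u) = g' (b v) \<longleftrightarrow> g u = g v)"
proof -
  let ?q = "card V div l"
  let ?a = "\<lambda>i. card {v \<in> V. g v = i}" and ?a' = "\<lambda>i. card {v \<in> V'. g' v = i}"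
  let ?B = "{i \<in> {..<l}. ?a i = Suc ?q}" and ?B' = "{i \<in> {..<l}. ?a' i = Suc ?q}"
  have B: "card ?B = card ?B'"
    using balanced_card_class(2)[OF V l] balanced_card_class(2)[OF V' l] c by simp
  then have nB: "card ({..<l} - ?B) = card ({..<l} - ?B')"
    by (subst (1 2) card_Diff_subset) auto
  obtain p1 where p1: "bij_betw p1 ?B ?B'" using finite_same_card_bij[of ?B ?B'] B by auto
  obtain p2 where p2: "bij_betw p2 ({..<l} - ?B) ({..<l} - ?B')"
    using finite_same_card_bij[of "{..<l} - ?B" "{..<l} - ?B'"] nB by auto
  define p where "p i = (if i \<in> ?B then p1 i else p2 i)" for i
  have "bij_betw p (?B \<union> ({..<l} - ?B)) (?B' \<union> ({..<l} - ?B'))"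
    unfolding p_def using p1 p2 by (intro bij_betw_disjoint_Un) auto
  moreover have "?B \<union> ({..<l} - ?B) = {..<l}" "?B' \<union> ({..<l} - ?B') = {..<l}" by auto
  ultimately have p: "bij_betw p {..<l} {..<l}" by simp
  have pa: "?a i = ?a' (p i)" if i: "i < l" for i
  proof (cases "i \<in> ?B")
    case True
    then have "p i \<in> ?B'" using p1 by (auto simp: p_def bij_betw_def)
    then show ?thesis using True by auto
  next
    case False
    then have "p i \<in> {..<l} - ?B'" using p2 i by (auto simp: p_def bij_betw_def)
    then have "?a' (p i) \<noteq> Suc ?q" "p i < l" by auto
    moreover have "?a i = ?q" using False balanced_card_class(1)[OF V l i] i by auto
    ultimately show ?thesis using balanced_card_class(1)[OF V' l, of "p i"] c by auto
  qed
  have "\<exists>b. bij_betw b {v \<in> V. g v = i} {v \<in> V'. g' v = p i}" if "i < l" for i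
    using pa[OF that] V V' by (intro finite_same_card_bij) auto
  then obtain \<beta> where \<beta>: "\<And>i. i < l \<Longrightarrow> bij_betw (\<beta> i) {v \<in> V. g v = i} {v \<in> V'. g' v = p i}" by metis
  define b where "b v = \<beta> (g v) v" for v
  have gl: "g v < l" if "v \<in> V" for v using V that by (auto simp: balanced_def)
  have gl': "g' v < l" if "v \<in> V'" for v using V' that by (auto simp: balanced_def)
  have bV: "b v \<in> V'" "g' (b v) = p (g v)" if "v \<in> V" for v
    using bij_betwE[OF \<beta>[OF gl[OF that]]] that by (auto simp: b_def)
  have cls: "g' (b u) = g' (b v) \<longleftrightarrow> g u = g v" if "u \<in> V" "v \<in> V" for u v
    using bV(2)[OF that(1)] bV(2)[OF that(2)] p gl that by (auto simp: bij_betw_def inj_on_def)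
  have "inj_on b V"
  proof (rule inj_onI)
    fix u v assume uv: "u \<in> V" "v \<in> V" "b u = b v"
    then have g: "g u = g v" using cls[OF uv(1,2)] by simp
    then have "\<beta> (g u) u = \<beta> (g u) v" using uv(3) by (simp add: b_def)
    then show "u = v" using \<beta>[OF gl[OF uv(1)]] uv g by (auto simp: bij_betw_def inj_on_def)
  qed
  moreover have "b ` V = V'"
  proof (intro equalityI subsetI)
    fix w assume w: "w \<in> V'"
    then have "g' w \<in> p ` {..<l}" using p gl' by (auto simp: bij_betw_def)
    then obtain i where i: "i < l" "g' w = p i" by auto
    then have "w \<in> \<beta> i ` {v \<in> V. g v = i}" using \<beta>[OF i(1)] w by (auto simp: bij_betw_def)
    then show "w \<in> b ` V" by (auto simp: b_def)
  qed (use bV in auto)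
  ultimately show ?thesis using cls unfolding bij_betw_def by blast
qed

lemma rainbow_image:
  assumes b: "bij_betw b V V'" and cls: "\<And>u v. u \<in> V \<Longrightarrow> v \<in> V \<Longrightarrow> g' (b u) = g' (b v) \<longleftrightarrow> g u = g v"
  shows "(\<lambda>e. b ` e) ` rainbow k V g = rainbow k V' g'"
proof (intro equalityI subsetI)
  fix e assume "e \<in> (\<lambda>e. b ` e) ` rainbow k V g"
  then obtain d where d: "e = b ` d" "d \<subseteq> V" "card d = k" "inj_on g d" by (auto simp: rainbow_def ksubsets_def)
  have "inj_on b d" using b d by (meson bij_betw_def inj_on_subset)
  moreover have "inj_on g' (b ` d)" using cls d by (intro inj_onI) (auto dest: inj_onD)
  ultimately show "e \<in> rainbow k V' g'"
    using d b by (auto simp: rainbow_def ksubsets_def card_image bij_betw_def)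
next
  fix e assume "e \<in> rainbow k V' g'"
  then have e: "e \<subseteq> V'" "card e = k" "inj_on g' e" by (auto simp: rainbow_def ksubsets_def)
  then have "e \<subseteq> b ` V" using b by (simp add: bij_betw_def)
  then obtain d where d: "d \<subseteq> V" "e = b ` d" by (meson subset_image_iff)
  have i: "inj_on b d" using b d by (meson bij_betw_def inj_on_subset)
  have "inj_on g d"
  proof (rule inj_onI)
    fix x y assume "x \<in> d" "y \<in> d" "g x = g y"
    then have "b x = b y" using cls[of x y] d e(3) by (auto dest: inj_onD)
    then show "x = y" using i \<open>x \<in> d\<close> \<open>y \<in> d\<close> by (auto dest: inj_onD)
  qed
  then show "e \<in> (\<lambda>e. b ` e) ` rainbow k V g"
    using d e i by (auto simp: rainbow_def ksubsets_def card_image)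
qed

lemma card_rainbow_eq:
  assumes b: "bij_betw b V V'" and cls: "\<And>u v. u \<in> V \<Longrightarrow> v \<in> V \<Longrightarrow> g' (b u) = g' (b v) \<longleftrightarrow> g u = g v"
  shows "card (rainbow k V g) = card (rainbow k V' g')"
proof -
  have "inj_on (\<lambda>e. b ` e) (rainbow k V g)"
    by (rule inj_on_subset[OF inj_on_image_Pow[of b V]])
       (use b in \<open>auto simp: bij_betw_def rainbow_def ksubsets_def\<close>)
  then show ?thesis using rainbow_image[of b V V' g' g k, OF b cls] by (metis card_image)
qed

section \<open>Turan numbers and Turan degrees\<close>

definition turan_number :: "nat \<Rightarrow> nat \<Rightarrow> nat \<Rightarrow> nat" where
  "turan_number r l n = card (rainbow r {..<n} (\<lambda>v. v mod l))"

text \<open>The degree of the vertex \<open>n\<close> in the Turan hypergraph on \<open>{..<Suc n}\<close>.\<close>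
definition turan_degree :: "nat \<Rightarrow> nat \<Rightarrow> nat \<Rightarrow> nat" where
  "turan_degree r l n = card (rainbow (r - 1) {v \<in> {..<n}. v mod l \<noteq> n mod l} (\<lambda>v. v mod l))"

lemma verts_turan: "0 < l \<Longrightarrow> verts (turan r n l) = {..<n}"
  unfolding turan_def complete_multipartite_def by (simp add: turan_part_Union)

lemma edges_turan:
  assumes l: "0 < l"
  shows "edges (turan r n l) = rainbow r {..<n} (\<lambda>v. v mod l)"
proof -
  have "(\<forall>i<l. card (e \<inter> turan_part n l i) \<le> 1) \<longleftrightarrow> inj_on (\<lambda>v. v mod l) e" if e: "e \<subseteq> {..<n}" for e
  proof
    assume *: "\<forall>i<l. card (e \<inter> turan_part n l i) \<le> 1"
    show "inj_on (\<lambda>v. v mod l) e"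
    proof (rule inj_onI)
      fix x y assume xy: "x \<in> e" "y \<in> e" "x mod l = y mod l"
      have "card (e \<inter> turan_part n l (x mod l)) \<le> Suc 0" using * l by simp
      moreover have "finite (e \<inter> turan_part n l (x mod l))" using e finite_subset by blast
      ultimately have "\<forall>a\<in>e \<inter> turan_part n l (x mod l). \<forall>b\<in>e \<inter> turan_part n l (x mod l). a = b"
        by (simp only: card_le_Suc0_iff_eq)
      moreover have "x \<in> e \<inter> turan_part n l (x mod l)" "y \<in> e \<inter> turan_part n l (x mod l)"
        using xy e by (auto simp: turan_part_def)
      ultimately show "x = y" by blast
    qed
  next
    assume inj: "inj_on (\<lambda>v. v mod l) e"
    show "\<forall>i<l. card (e \<inter> turan_part n l i) \<le> 1"
    proof (intro allI impI)
      fix i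
      have "finite (e \<inter> turan_part n l i)" using e finite_subset by blast
      then show "card (e \<inter> turan_part n l i) \<le> 1"
        using inj by (simp add: card_le_Suc0_iff_eq) (auto simp: turan_part_def inj_on_def)
    qed
  qed
  then show ?thesis
    unfolding turan_def complete_multipartite_def rainbow_def ksubsets_def
    using l by (auto simp: turan_part_Union)
qed

lemma turan_number_Suc:
  assumes "r \<ge> 1"
  shows "turan_number r l (Suc n) = turan_number r l n + turan_degree r l n"
proof -
  have "{..<Suc n} = insert n {..<n}" by auto
  then show ?thesis
    using card_rainbow_insert[of "{..<n}" n "r - 1" "\<lambda>v. v mod l"] assms
    unfolding turan_number_def turan_degree_def by simp
qed

lemma mod_class_card:
  assumes "i < l"
  shows "n div l \<le> card {v \<in> {..<n}. v mod l = i}" "card {v \<in> {..<n}. v mod l = i} \<le> Suc (n div l)"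
proof -
  have eq: "{v \<in> {..<n}. v mod l = i} = turan_part n l i" by (auto simp: turan_part_def)
  have "int (card (turan_part n l i)) \<in> {\<lfloor>real n / real l\<rfloor>, \<lceil>real n / real l\<rceil>}"
    by (rule turan_part_card[OF assms])
  moreover have "\<lfloor>real n / real l\<rfloor> = int (n div l)" by (rule floor_divide_of_nat_eq)
  moreover have "\<lceil>real n / real l\<rceil> \<le> \<lfloor>real n / real l\<rfloor> + 1"
    using ceiling_diff_floor_le_1[of "real n / real l"] by linarith
  moreover have "\<lfloor>real n / real l\<rfloor> \<le> \<lceil>real n / real l\<rceil>" by (rule floor_le_ceiling)
  ultimately show "n div l \<le> card {v \<in> {..<n}. v mod l = i}" "card {v \<in> {..<n}. v mod l = i} \<le> Suc (n div l)"
    unfolding eq by auto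
qed

lemma balanced_mod: "0 < l \<Longrightarrow> balanced l {..<n} (\<lambda>v. v mod l)"
  unfolding balanced_def
proof (intro conjI allI impI)
  fix i j assume "i < l" "j < l"
  then show "card {v \<in> {..<n}. v mod l = i} \<le> card {v \<in> {..<n}. v mod l = j} + 1"
    using mod_class_card(1)[of j l n] mod_class_card(2)[of i l n] by simp
qed auto

lemma turan_degree_lower:
  assumes "0 < l"
  shows "(l - 1 choose (r - 1)) * (n div l) ^ (r - 1) \<le> turan_degree r l n"
proof -
  let ?A = "{v \<in> {..<n}. v mod l \<noteq> n mod l}" and ?I = "{..<l} - {n mod l}"
  have "n div l \<le> card {a \<in> ?A. a mod l = i}" if "i \<in> ?I" for i
  proof -
    have "{a \<in> ?A. a mod l = i} = {v \<in> {..<n}. v mod l = i}" using that by auto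
    then show ?thesis using mod_class_card(1)[of i l n] that by simp
  qed
  moreover have "(\<lambda>v. v mod l) ` ?A \<subseteq> ?I" using assms by auto
  moreover have "card ?I = l - 1" using assms by simp
  ultimately show ?thesis
    using card_rainbow_lower[of ?I ?A "\<lambda>v. v mod l" "n div l" "r - 1"] unfolding turan_degree_def by simp
qed

lemma turan_degree_upper:
  assumes l: "2 \<le> l"
  shows "real (turan_degree r l n) \<le> real (l - 1 choose (r - 1)) * (real (Suc n) / real l) ^ (r - 1)"
proof -
  let ?A = "{v \<in> {..<n}. v mod l \<noteq> n mod l}" and ?I = "{..<l} - {n mod l}"
  have I: "card ?I = l - 1" using l by simp
  have "real (turan_degree r l n) \<le> real (card ?I choose (r - 1)) * (real (card ?A) / real (card ?I)) ^ (r - 1)"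
    unfolding turan_degree_def by (rule rainbow_upper) (use l in auto)
  also have "\<dots> \<le> real (l - 1 choose (r - 1)) * (real (Suc n) / real l) ^ (r - 1)"
  proof -
    have "?A = {..<n} - {v \<in> {..<n}. v mod l = n mod l}" by auto
    then have "card ?A = card {..<n} - card {v \<in> {..<n}. v mod l = n mod l}"
      by (simp only:) (intro card_Diff_subset; auto)
    also have "\<dots> \<le> n - n div l" using mod_class_card(1)[of "n mod l" l n] l by (simp add: diff_le_mono2)
    finally have "card ?A \<le> n - n div l" .
    moreover have "n div l \<le> n" by (rule div_le_dividend)
    ultimately have "card ?A + n div l \<le> n" by linarith
    then have "l * card ?A + l * (n div l) \<le> l * n" by (metis distrib_left mult_le_mono2)
    moreover have "n \<le> l * (n div l) + (l - 1)"
    proof -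
      have "n = l * (n div l) + n mod l" by simp
      moreover have "n mod l < l" using l by simp
      ultimately show ?thesis by linarith
    qed
    \<comment> \<open>Equivalently \<open>l * card ?A \<le> (l - 1) * Suc n\<close>, which is where
      the \<open>Suc n\<close> of the bound comes from.\<close>
    ultimately have "l * card ?A + n \<le> l * n + (l - 1)" by linarith
    then have "real (l * card ?A + n) \<le> real (l * n + (l - 1))" by (simp only: of_nat_le_iff)
    then have "real l * real (card ?A) + real n \<le> real l * real n + (real l - 1)"
      using l by (simp add: of_nat_diff)
    then have "real (card ?A) / real (l - 1) \<le> real (Suc n) / real l"
      using l by (simp add: of_nat_diff field_simps)
    then show ?thesis unfolding I by (intro mult_left_mono power_mono) auto
  qed
  finally show ?thesis .
qed

lemma turan_number_lower:
  assumes "0 < l"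
  shows "(l choose r) * (n div l) ^ r \<le> turan_number r l n"
proof -
  have "(\<lambda>v. v mod l) ` {..<n} \<subseteq> {..<l}" using assms by auto
  then show ?thesis
    using card_rainbow_lower[of "{..<l}" "{..<n}" "\<lambda>v. v mod l" "n div l" r] mod_class_card(1)[of _ l n]
    unfolding turan_number_def by simp
qed

text \<open>Balanced colourings of sets of equal size have equally many rainbow sets, so the
  balanced maximiser can be compared with the residues modulo \<open>l\<close>.\<close>

lemma rainbow_le_turan_number:
  assumes V: "finite V" and r: "2 \<le> r" "r \<le> l" "r \<le> card V" and g: "\<forall>v\<in>V. g v < l"
  shows "card (rainbow r V g) \<le> turan_number r l (card V)"
    and "card (rainbow r V g) = turan_number r l (card V) \<Longrightarrow> balanced l V g"
proof -
  obtain k where k: "r = Suc (Suc k)" using r by (metis add_2_eq_Suc le_Suc_ex)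
  have l: "0 < l" using r by simp
  obtain h where h: "balanced l V h"
    "\<And>g. (\<forall>v\<in>V. g v < l) \<Longrightarrow> card (rainbow r V g) \<le> card (rainbow r V h) \<and>
      (card (rainbow r V g) = card (rainbow r V h) \<longrightarrow> balanced l V g)"
    using exists_balanced_max_rainbow[OF V, of k l] r k by auto
  obtain b where "bij_betw b V {..<card V}" "\<forall>u\<in>V. \<forall>v\<in>V. b u mod l = b v mod l \<longleftrightarrow> h u = h v"
    using balanced_bij[OF V h(1) _ balanced_mod[OF l] _ l] by (metis card_lessThan finite_lessThan)
  then have "card (rainbow r V h) = turan_number r l (card V)"
    unfolding turan_number_def by (intro card_rainbow_eq[where b=b]) auto
  then show "card (rainbow r V g) \<le> turan_number r l (card V)"
    and "card (rainbow r V g) = turan_number r l (card V) \<Longrightarrow> balanced l V g" using h(2)[OF g] by auto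
qed

section \<open>Copies of the expansion\<close>

text \<open>A copy is recorded by its vertex set alone, so disjoint copies become disjoint sets.
  That \<open>W\<close> lies in the host follows from its edges, see
  \<open>copy_subset_Union\<close>.\<close>

definition copy :: "nat \<Rightarrow> nat \<Rightarrow> 'a set set \<Rightarrow> 'a set \<Rightarrow> bool" where
  "copy r l E W \<longleftrightarrow> (\<exists>C. isomorphic (H_expansion r l) C \<and> edges C \<subseteq> E \<and> verts C = W)"

lemma verts_H_expansion:
  "verts (H_expansion r l) = Inl ` {..<l + 1} \<union> Inr ` (ksubsets 2 {..<l + 1} \<times> {..<r - 2})"
  unfolding H_expansion_def expansion_def complete_hypergraph_def ksubsets_def by simp

lemma edges_H_expansion:
  "edges (H_expansion r l) = (\<lambda>e. Inl ` e \<union> (\<lambda>j. Inr (e, j)) ` {..<r - 2}) ` ksubsets 2 {..<l + 1}"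
  unfolding H_expansion_def expansion_def complete_hypergraph_def ksubsets_def by simp

lemma finite_verts_H_expansion: "finite (verts (H_expansion r l))"
  unfolding verts_H_expansion by (simp add: finite_ksubsets)

lemma edges_H_expansion_subset: "e \<in> edges (H_expansion r l) \<Longrightarrow> e \<subseteq> verts (H_expansion r l)"
  unfolding verts_H_expansion edges_H_expansion ksubsets_def by auto

lemma verts_H_expansion_covered:
  assumes "1 \<le> l" "v \<in> verts (H_expansion r l)"
  shows "\<exists>e\<in>edges (H_expansion r l). v \<in> e"
  using assms(2) unfolding verts_H_expansion
proof
  assume "v \<in> Inl ` {..<l + 1}"
  then obtain i where i: "v = Inl i" "i < l + 1" by auto
  define j :: nat where "j = (if i = 0 then 1 else 0)"
  have "{i, j} \<in> ksubsets 2 {..<l + 1}" using i assms(1) by (auto simp: ksubsets_def j_def)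
  then show ?thesis unfolding edges_H_expansion using i by (intro bexI[OF _ imageI]) auto
qed (auto simp: edges_H_expansion)

lemma copy_mono: "copy r l E W \<Longrightarrow> E \<subseteq> E' \<Longrightarrow> copy r l E' W"
  unfolding copy_def by blast

lemma copyE:
  assumes "copy r l E W"
  obtains \<phi> where "bij_betw \<phi> (verts (H_expansion r l)) W"
    "\<And>e. e \<in> edges (H_expansion r l) \<Longrightarrow> \<phi> ` e \<in> E"
  using assms unfolding copy_def isomorphic_def by blast

lemma copyI:
  assumes "bij_betw \<phi> (verts (H_expansion r l)) W"
    "\<And>e. e \<in> edges (H_expansion r l) \<Longrightarrow> \<phi> ` e \<in> E"
  shows "copy r l E W"
  unfolding copy_def isomorphic_def
  by (rule exI[of _ "Hypergraph W ((\<lambda>e. \<phi> ` e) ` edges (H_expansion r l))"])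
     (use assms in \<open>auto intro!: exI[of _ \<phi>]\<close>)

lemma copy_finite: "copy r l E W \<Longrightarrow> finite W"
  by (metis copyE bij_betw_finite finite_verts_H_expansion)

lemma copy_card: "copy r l E W \<Longrightarrow> card W = card (verts (H_expansion r l))"
  by (metis copyE bij_betw_same_card)

lemma card_verts_H_expansion_pos: "0 < card (verts (H_expansion r l))"
  using finite_verts_H_expansion[of r l] by (auto simp: card_gt_0_iff verts_H_expansion)

lemma copy_nonempty: "copy r l E W \<Longrightarrow> W \<noteq> {}"
  using copy_card[of r l E W] card_verts_H_expansion_pos[of r l] by (intro notI) simp

lemma copy_restrict:
  assumes "copy r l E W"
  shows "copy r l {e \<in> E. e \<subseteq> W} W"
proof -
  obtain \<phi> where p: "bij_betw \<phi> (verts (H_expansion r l)) W"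
    "\<And>e. e \<in> edges (H_expansion r l) \<Longrightarrow> \<phi> ` e \<in> E" using copyE[OF assms] by blast
  show ?thesis
    by (rule copyI[OF p(1)]) (use p edges_H_expansion_subset in \<open>fastforce simp: bij_betw_def\<close>)
qed

lemma copy_subset_Union:
  assumes l: "1 \<le> l" and c: "copy r l E W"
  shows "W \<subseteq> \<Union>E"
proof
  fix w assume w: "w \<in> W"
  obtain \<phi> where p: "bij_betw \<phi> (verts (H_expansion r l)) W"
    "\<And>e. e \<in> edges (H_expansion r l) \<Longrightarrow> \<phi> ` e \<in> E" using copyE[OF c] by blast
  obtain v where v: "v \<in> verts (H_expansion r l)" "w = \<phi> v" using p(1) w by (auto simp: bij_betw_def)
  obtain e where "e \<in> edges (H_expansion r l)" "v \<in> e" using verts_H_expansion_covered[OF l v(1)] by blast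
  then show "w \<in> \<Union>E" using p(2) v(2) by blast
qed

text \<open>For \<open>l \<ge> 1\<close> the expansion has no isolated vertex, so a copy avoids
  \<open>S\<close> as soon as its edges do. This reduces deleting vertices to deleting
  edges.\<close>

lemma copy_avoid_iff:
  assumes l: "1 \<le> l"
  shows "copy r l {e \<in> E. e \<inter> S = {}} W \<longleftrightarrow> copy r l E W \<and> W \<inter> S = {}"
proof
  assume c: "copy r l {e \<in> E. e \<inter> S = {}} W"
  show "copy r l E W \<and> W \<inter> S = {}"
    using copy_mono[OF c] copy_subset_Union[OF l c] by blast
next
  assume "copy r l E W \<and> W \<inter> S = {}"
  then show "copy r l {e \<in> E. e \<inter> S = {}} W"
    using copy_restrict[of r l E W] by (auto intro: copy_mono)
qed

text \<open>\<open>K\<close> is the image of the original vertices of the complete graph. This part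
  of a copy is enough to exclude copies from a complete \<open>l\<close>-partite hypergraph.\<close>

lemma copy_core:
  assumes c: "copy r l E W"
  shows "\<exists>K\<subseteq>W. card K = l + 1 \<and> (\<forall>u\<in>K. \<forall>v\<in>K. u \<noteq> v \<longrightarrow> (\<exists>e\<in>E. u \<in> e \<and> v \<in> e))"
proof -
  obtain \<phi> where p: "bij_betw \<phi> (verts (H_expansion r l)) W"
    "\<And>e. e \<in> edges (H_expansion r l) \<Longrightarrow> \<phi> ` e \<in> E" using copyE[OF c] by blast
  let ?I = "Inl ` {..<l + 1} :: (nat + nat set \<times> nat) set"
  have I: "?I \<subseteq> verts (H_expansion r l)" unfolding verts_H_expansion by blast
  have "inj_on \<phi> ?I" using p(1) I by (meson bij_betw_def inj_on_subset)
  then have "card (\<phi> ` ?I) = l + 1" by (simp add: card_image)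
  moreover have "\<phi> ` ?I \<subseteq> W" using p(1) I by (auto simp: bij_betw_def)
  moreover have "\<exists>e\<in>E. u \<in> e \<and> v \<in> e" if uv: "u \<in> \<phi> ` ?I" "v \<in> \<phi> ` ?I" "u \<noteq> v" for u v
  proof -
    obtain i j where ij: "u = \<phi> (Inl i)" "v = \<phi> (Inl j)" "i < l + 1" "j < l + 1" using uv by auto
    have "i \<noteq> j" using ij(1,2) uv(3) by auto
    then have "{i, j} \<in> ksubsets 2 {..<l + 1}" using ij(3,4) by (simp add: ksubsets_def)
    then have "Inl ` {i,j} \<union> (\<lambda>k. Inr ({i,j}, k)) ` {..<r - 2} \<in> edges (H_expansion r l)"
      unfolding edges_H_expansion by blast
    from p(2)[OF this] have "\<phi> ` (Inl ` {i,j} \<union> (\<lambda>k. Inr ({i,j}, k)) ` {..<r - 2}) \<in> E" .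
    moreover have "u \<in> \<phi> ` (Inl ` {i,j} \<union> (\<lambda>k. Inr ({i,j}, k)) ` {..<r - 2})"
      "v \<in> \<phi> ` (Inl ` {i,j} \<union> (\<lambda>k. Inr ({i,j}, k)) ` {..<r - 2})"
      unfolding ij(1,2) by simp_all
    ultimately show ?thesis by (intro bexI conjI)
  qed
  ultimately show ?thesis by (intro exI[of _ "\<phi> ` ?I"]) auto
qed

text \<open>\<open>h p\<close> is the edge that expands the core pair \<open>p\<close>. Its
  \<open>r - 2\<close> further vertices lie outside \<open>K\<close> and are shared with no other
  \<open>h q\<close>, so a bijection onto the core and bijections onto the sets
  \<open>h p - p\<close> glue together.\<close>

lemma copy_of_core:
  assumes K: "finite K" "card K = l + 1" and r: "2 \<le> r"
    and h: "\<And>p. p \<in> ksubsets 2 K \<Longrightarrow> h p \<in> E \<and> card (h p) = r \<and> h p \<inter> K = p"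
    and dis: "\<And>p q. p \<in> ksubsets 2 K \<Longrightarrow> q \<in> ksubsets 2 K \<Longrightarrow> p \<noteq> q \<Longrightarrow> h p \<inter> h q \<subseteq> K"
  shows "copy r l E (K \<union> \<Union> (h ` ksubsets 2 K))"
proof -
  obtain k where k: "bij_betw k {..<l + 1} K"
    using finite_same_card_bij[of "{..<l + 1}" K] K by auto
  have ex: "\<exists>t. bij_betw t {..<r - 2} (h p - p)" if p: "p \<in> ksubsets 2 K" for p
  proof -
    have "finite (h p)" using h[OF p] r by (intro card_ge_0_finite) auto
    moreover have "p \<subseteq> h p" "card p = 2" using h[OF p] p by (auto simp: ksubsets_def)
    ultimately have "finite (h p - p)" "card (h p - p) = r - 2"
      using h[OF p] by (auto simp: card_Diff_subset finite_subset)
    then show ?thesis using finite_same_card_bij[of "{..<r - 2}" "h p - p"] by auto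
  qed
  then obtain t where t: "\<And>p. p \<in> ksubsets 2 K \<Longrightarrow> bij_betw (t p) {..<r - 2} (h p - p)" by metis
  define \<phi> where "\<phi> x = (case x of Inl i \<Rightarrow> k i | Inr y \<Rightarrow> t (k ` fst y) (snd y))" for x
  have \<phi>: "\<phi> (Inl i) = k i" "\<phi> (Inr (e, j)) = t (k ` e) j" for i e j by (auto simp: \<phi>_def)
  have ke: "k ` e \<in> ksubsets 2 K" if "e \<in> ksubsets 2 {..<l + 1}" for e
  proof -
    have "inj_on k e" using k that by (auto simp: bij_betw_def ksubsets_def intro: inj_on_subset)
    then show ?thesis using k that by (auto simp: bij_betw_def ksubsets_def card_image)
  qed
  have kp: "\<exists>e\<in>ksubsets 2 {..<l + 1}. p = k ` e" if p: "p \<in> ksubsets 2 K" for p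
  proof -
    have "p \<subseteq> k ` {..<l + 1}" using p k by (auto simp: bij_betw_def ksubsets_def)
    then obtain e where e: "e \<subseteq> {..<l + 1}" "p = k ` e" by (meson subset_image_iff)
    then have "inj_on k e" using k by (auto simp: bij_betw_def intro: inj_on_subset)
    then show ?thesis using e p by (auto simp: ksubsets_def card_image)
  qed
  have kinj: "e = e'" if "e \<in> ksubsets 2 {..<l + 1}" "e' \<in> ksubsets 2 {..<l + 1}" "k ` e = k ` e'" for e e'
    using that k inj_on_image_eq_iff[of k "{..<l + 1}" e e'] by (auto simp: bij_betw_def ksubsets_def)
  have tr: "t (k ` e) ` {..<r - 2} = h (k ` e) - k ` e" if "e \<in> ksubsets 2 {..<l + 1}" for e
    using t[OF ke[OF that]] by (auto simp: bij_betw_def)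
  have tm: "t (k ` e) j \<in> h (k ` e)" "t (k ` e) j \<notin> K"
    if "e \<in> ksubsets 2 {..<l + 1}" "j < r - 2" for e j
    using tr[OF that(1)] that(2) h[OF ke[OF that(1)]] by blast+
  have img: "\<phi> ` verts (H_expansion r l) = K \<union> \<Union> (h ` ksubsets 2 K)"
  proof (intro equalityI subsetI)
    fix x assume "x \<in> \<phi> ` verts (H_expansion r l)"
    then consider i where "i < l + 1" "x = k i"
      | e j where "e \<in> ksubsets 2 {..<l + 1}" "j < r - 2" "x = t (k ` e) j"
      unfolding verts_H_expansion by (auto simp: \<phi>)
    then show "x \<in> K \<union> \<Union> (h ` ksubsets 2 K)"
    proof cases
      case 1 then show ?thesis using k by (auto simp: bij_betw_def)
    next
      case 2 then show ?thesis using tm(1) ke by blast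
    qed
  next
    fix x assume "x \<in> K \<union> \<Union> (h ` ksubsets 2 K)"
    then consider "x \<in> K" | p where "p \<in> ksubsets 2 K" "x \<in> h p" "x \<notin> K" by blast
    then show "x \<in> \<phi> ` verts (H_expansion r l)"
    proof cases
      case 1
      then obtain i where "i < l + 1" "x = \<phi> (Inl i)" using k by (auto simp: \<phi> bij_betw_def)
      then show ?thesis unfolding verts_H_expansion by blast
    next
      case 2
      obtain e where e: "e \<in> ksubsets 2 {..<l + 1}" "p = k ` e" using kp[OF 2(1)] by blast
      have "x \<in> h p - p" using 2 by (auto simp: ksubsets_def)
      then have "x \<in> t (k ` e) ` {..<r - 2}" unfolding tr[OF e(1)] e(2) .
      then obtain j where "j < r - 2" "x = \<phi> (Inr (e, j))" by (auto simp: \<phi>)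
      then show ?thesis unfolding verts_H_expansion using e by blast
    qed
  qed
  have inj: "inj_on \<phi> (verts (H_expansion r l))"
  proof (rule inj_onI)
    fix x y assume xy: "x \<in> verts (H_expansion r l)" "y \<in> verts (H_expansion r l)" "\<phi> x = \<phi> y"
    have k': "k i \<in> K" if "i < l + 1" for i using k that by (auto simp: bij_betw_def)
    show "x = y"
    proof (cases x)
      case (Inl i)
      then have i: "i < l + 1" using xy(1) by (auto simp: verts_H_expansion)
      show ?thesis
      proof (cases y)
        case y: (Inl j)
        then have "j < l + 1" using xy(2) by (auto simp: verts_H_expansion)
        then show ?thesis using xy(3) Inl y k i by (auto simp: \<phi> bij_betw_def inj_on_def)
      next
        case y: (Inr z)
        then obtain e j where z: "z = (e, j)" "e \<in> ksubsets 2 {..<l + 1}" "j < r - 2"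
          using xy(2) by (auto simp: verts_H_expansion)
        then have "\<phi> y \<notin> K" using tm(2) y by (simp add: \<phi>)
        then show ?thesis using xy(3) Inl k'[OF i] by (simp add: \<phi>)
      qed
    next
      case (Inr z')
      then obtain e' j' where z': "z' = (e', j')" "e' \<in> ksubsets 2 {..<l + 1}" "j' < r - 2"
        using xy(1) by (auto simp: verts_H_expansion)
      show ?thesis
      proof (cases y)
        case y: (Inl j)
        then have "j < l + 1" using xy(2) by (auto simp: verts_H_expansion)
        moreover have "\<phi> x \<notin> K" using tm(2) z' Inr by (simp add: \<phi>)
        ultimately show ?thesis using xy(3) y k' by (simp add: \<phi>)
      next
        case y: (Inr z)
        then obtain e j where z: "z = (e, j)" "e \<in> ksubsets 2 {..<l + 1}" "j < r - 2"
          using xy(2) by (auto simp: verts_H_expansion)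
        have eq: "t (k ` e') j' = t (k ` e) j" using xy(3) Inr y z z' by (simp add: \<phi>)
        have "k ` e' = k ` e"
        proof (rule ccontr)
          assume "k ` e' \<noteq> k ` e"
          then have "h (k ` e') \<inter> h (k ` e) \<subseteq> K" using dis ke z z' by blast
          then show False using tm[OF z(2,3)] tm[OF z'(2,3)] eq by auto
        qed
        then have "e' = e" using kinj z z' by blast
        moreover have "inj_on (t (k ` e)) {..<r - 2}" using t[OF ke[OF z(2)]] by (simp add: bij_betw_def)
        ultimately have "j' = j" using eq z z' by (auto dest: inj_onD)
        then show ?thesis using \<open>e' = e\<close> Inr y z z' by simp
      qed
    qed
  qed
  show ?thesis
  proof (rule copyI[of \<phi>])
    show "bij_betw \<phi> (verts (H_expansion r l)) (K \<union> \<Union> (h ` ksubsets 2 K))"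
      using img inj by (simp add: bij_betw_def)
  next
    fix e assume "e \<in> edges (H_expansion r l)"
    then obtain d where d: "d \<in> ksubsets 2 {..<l + 1}" "e = Inl ` d \<union> (\<lambda>j. Inr (d, j)) ` {..<r - 2}"
      unfolding edges_H_expansion by blast
    have "\<phi> ` e = k ` d \<union> t (k ` d) ` {..<r - 2}" 
      unfolding d(2) by (simp add: image_Un image_image \<phi>)
    also have "\<dots> = h (k ` d)" using tr[OF d(1)] h[OF ke[OF d(1)]] by blast
    finally show "\<phi> ` e \<in> E" using h[OF ke[OF d(1)]] by simp
  qed
qed

section \<open>Robust pairs and greedy embedding\<close>

definition robust :: "nat \<Rightarrow> 'a set set \<Rightarrow> 'a \<Rightarrow> 'a \<Rightarrow> bool" where
  "robust M E u v \<longleftrightarrow> u \<noteq> v \<and>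
     (\<forall>S. finite S \<longrightarrow> card S \<le> M \<longrightarrow> u \<notin> S \<longrightarrow> v \<notin> S \<longrightarrow> (\<exists>e\<in>E. u \<in> e \<and> v \<in> e \<and> e \<inter> S = {}))"

lemma robustD:
  assumes "robust M E u v" "finite S" "card S \<le> M" "u \<notin> S" "v \<notin> S"
  shows "\<exists>e\<in>E. u \<in> e \<and> v \<in> e \<and> e \<inter> S = {}"
  using assms unfolding robust_def by simp

lemma robust_sym: "robust M E u v \<Longrightarrow> robust M E v u"
  unfolding robust_def by meson

lemma robust_irrefl: "\<not> robust M E u u"
  unfolding robust_def by simp

lemma robust_mono: "robust M E u v \<Longrightarrow> E \<subseteq> E' \<Longrightarrow> robust M E' u v"
  unfolding robust_def by blast

text \<open>A crude upper bound for the number of vertices of a copy.\<close>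
definition embed_slack :: "nat \<Rightarrow> nat \<Rightarrow> nat" where
  "embed_slack r l = l + 1 + r * 2 ^ (l + 1)"

text \<open>One core pair need not be robust provided an edge \<open>e0\<close> for it is given.
  This is needed when \<open>a\<close> and \<open>b\<close> lie in one class and only the single
  edge through them is available; it also forces the vertices of \<open>e0\<close> into the
  copy.\<close>

lemma embed_near_clique:
  assumes E: "\<And>e. e \<in> E \<Longrightarrow> card e = r" and r: "2 \<le> r"
    and K: "finite K" "card K = l + 1" and ab: "a \<in> K" "b \<in> K" "a \<noteq> b"
    and e0: "e0 \<in> E" "e0 \<inter> K = {a, b}" "e0 \<inter> S = {}"
    and S: "finite S" "K \<inter> S = {}" "card S + embed_slack r l \<le> M"
    and rob: "\<And>u v. u \<in> K \<Longrightarrow> v \<in> K \<Longrightarrow> u \<noteq> v \<Longrightarrow> {u, v} \<noteq> {a, b} \<Longrightarrow> robust M E u v"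
  shows "\<exists>W. copy r l E W \<and> K \<union> e0 \<subseteq> W \<and> W \<inter> S = {}"
proof -
  let ?p0 = "{a, b}"
  have finK: "finite (ksubsets 2 K)" using K finite_ksubsets by blast
  have cardP: "card (ksubsets 2 K) \<le> 2 ^ (l + 1)"
    using card_mono[of "Pow K" "ksubsets 2 K"] K by (simp add: card_Pow ksubsets_def subset_iff)
  have p0: "?p0 \<in> ksubsets 2 K" using ab by (auto simp: ksubsets_def)
  \<comment> \<open>\<open>h\<close> assigns to every treated pair its edge. The pair
    \<open>?p0\<close> is in the domain throughout, so later edges respect \<open>e0\<close> from
    the start.\<close>
  have "Q \<subseteq> ksubsets 2 K \<Longrightarrow> \<exists>h. h ?p0 = e0 \<and>
      (\<forall>p\<in>insert ?p0 Q. h p \<in> E \<and> h p \<inter> K = p \<and> h p \<inter> S = {}) \<and>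
      (\<forall>p\<in>insert ?p0 Q. \<forall>q\<in>insert ?p0 Q. p \<noteq> q \<longrightarrow> h p \<inter> h q \<subseteq> K)" if "finite Q" for Q
    using that
  proof (induction Q rule: finite_induct)
    case empty
    show ?case using e0 by (intro exI[of _ "\<lambda>_. e0"]) auto
  next
    case (insert p Q)
    then have "Q \<subseteq> ksubsets 2 K" by simp
    from insert.IH[OF this] obtain h where hh: "h ?p0 = e0 \<and>
      (\<forall>p\<in>insert ?p0 Q. h p \<in> E \<and> h p \<inter> K = p \<and> h p \<inter> S = {}) \<and>
      (\<forall>p\<in>insert ?p0 Q. \<forall>q\<in>insert ?p0 Q. p \<noteq> q \<longrightarrow> h p \<inter> h q \<subseteq> K)" ..
    have h: "h ?p0 = e0"
      "\<And>p. p \<in> insert ?p0 Q \<Longrightarrow> h p \<in> E \<and> h p \<inter> K = p \<and> h p \<inter> S = {}"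
      "\<And>p q. p \<in> insert ?p0 Q \<Longrightarrow> q \<in> insert ?p0 Q \<Longrightarrow> p \<noteq> q \<Longrightarrow> h p \<inter> h q \<subseteq> K"
      by (rule conjunct1[OF hh], erule bspec[OF conjunct1[OF conjunct2[OF hh]]])
         (rule conjunct2[OF conjunct2[OF hh], THEN bspec, THEN bspec, THEN mp])
    show ?case
    proof (cases "p = ?p0")
      case True
      then have "insert ?p0 (insert p Q) = insert ?p0 Q" by auto
      then show ?thesis using h by (intro exI[of _ h]) simp
    next
      case False
      have "p \<in> ksubsets 2 K" using insert.prems by simp
      then obtain u v where uv: "p = {u, v}" "u \<noteq> v" "u \<in> K" "v \<in> K"
        by (auto simp: ksubsets_def card_2_iff)
      let ?U = "\<Union> (h ` insert ?p0 Q)"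
      \<comment> \<open>Everything the next edge must miss: \<open>S\<close>, the rest of the core
        and all vertices of the chosen edges. The pair \<open>p\<close> may be exempted because
        edges are allowed to meet inside the core.\<close>
      define S' where "S' = S \<union> (K - p) \<union> (?U - p)"
      have fin: "finite (h q)" "card (h q) = r" if "q \<in> insert ?p0 Q" for q
        using h(2)[OF that] E r by (auto intro: card_ge_0_finite)
      have fQ: "finite (insert ?p0 Q)" using insert.hyps by simp
      have cQ: "card (insert ?p0 Q) \<le> 2 ^ (l + 1)"
        using card_mono[OF finK, of "insert ?p0 Q"] insert.prems p0 cardP by auto
      have fU: "finite ?U" using fin fQ by blast
      have "card ?U \<le> (\<Sum>q\<in>insert ?p0 Q. card (h q))" by (rule card_UN_le[OF fQ])
      also have "\<dots> = (\<Sum>q\<in>insert ?p0 Q. r)" by (rule sum.cong) (use fin in auto)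
      also have "\<dots> \<le> r * 2 ^ (l + 1)" using cQ by simp
      finally have cU: "card ?U \<le> r * 2 ^ (l + 1)" .
      have "card S' \<le> card S + card (K - p) + card (?U - p)"
        unfolding S'_def by (meson add_le_mono1 card_Un_le le_trans)
      also have "\<dots> \<le> card S + card K + card ?U"
        using fU K(1) by (intro add_mono card_mono order_refl) auto
      also have "\<dots> \<le> M" using cU S(3) K(2) unfolding embed_slack_def by simp
      finally have "card S' \<le> M" .
      moreover have "finite S'" using S(1) fU K(1) unfolding S'_def by blast
      moreover have "u \<notin> S'" "v \<notin> S'" using uv S(2) by (auto simp: S'_def)
      moreover have "robust M E u v" using rob[OF uv(3,4,2)] False uv(1) by simp
      ultimately obtain e where e: "e \<in> E" "u \<in> e" "v \<in> e" "e \<inter> S' = {}"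
        using robustD[of M E u v S'] by blast
      have eK: "e \<inter> K = p" using e uv by (auto simp: S'_def)
      have eU: "e \<inter> h q \<subseteq> K" if "q \<in> insert ?p0 Q" for q
      proof -
        have "e \<inter> h q \<subseteq> p" using e(4) that unfolding S'_def by blast
        then show ?thesis using uv by blast
      qed
      define h' where "h' = h(p := e)"
      have h'Q: "h' q = h q" if "q \<in> insert ?p0 Q" for q
        using that False insert.hyps by (auto simp: h'_def)
      have h'p: "h' p = e" by (simp add: h'_def)
      show ?thesis
      proof (intro exI[of _ h'] conjI ballI impI)
        show "h' ?p0 = e0" using h'Q h(1) by simp
      next
        fix q assume "q \<in> insert ?p0 (insert p Q)"
        then have "q = p \<or> q \<in> insert ?p0 Q" by blast
        then have "h' q \<in> E \<and> h' q \<inter> K = q \<and> h' q \<inter> S = {}"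
        proof
          assume "q = p" then show ?thesis using h'p e eK by (auto simp: S'_def)
        next
          assume "q \<in> insert ?p0 Q" then show ?thesis using h(2) h'Q by simp
        qed
        then show "h' q \<in> E" "h' q \<inter> K = q" "h' q \<inter> S = {}" by auto
      next
        fix q q' assume qq: "q \<in> insert ?p0 (insert p Q)" "q' \<in> insert ?p0 (insert p Q)" "q \<noteq> q'"
        then consider "q = p" "q' \<in> insert ?p0 Q" | "q \<in> insert ?p0 Q" "q' = p"
          | "q \<in> insert ?p0 Q" "q' \<in> insert ?p0 Q" by blast
        then show "h' q \<inter> h' q' \<subseteq> K"
        proof cases
          case 1 then show ?thesis using h'p h'Q eU by simp
        next
          case 2 then show ?thesis using h'p h'Q eU[of q] by (simp add: Int_commute)
        next
          case 3 then show ?thesis using h'Q h(3) qq(3) by simp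
        qed
      qed
    qed
  qed
  from this[OF finK order_refl] obtain h where h: "h ?p0 = e0"
      "\<And>p. p \<in> ksubsets 2 K \<Longrightarrow> h p \<in> E \<and> h p \<inter> K = p \<and> h p \<inter> S = {}"
      "\<And>p q. p \<in> ksubsets 2 K \<Longrightarrow> q \<in> ksubsets 2 K \<Longrightarrow> p \<noteq> q \<Longrightarrow> h p \<inter> h q \<subseteq> K"
    using p0 by (auto simp: insert_absorb)
  have "copy r l E (K \<union> \<Union> (h ` ksubsets 2 K))"
    using h E by (intro copy_of_core[OF K r]) auto
  moreover have "K \<union> e0 \<subseteq> K \<union> \<Union> (h ` ksubsets 2 K)" using h(1) p0 by blast
  moreover have "(K \<union> \<Union> (h ` ksubsets 2 K)) \<inter> S = {}" using h(2) S(2) by blast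
  ultimately show ?thesis by blast
qed

text \<open>Robustness of any one pair, used against the rest of \<open>K\<close>, supplies the
  starting edge for \<open>embed_near_clique\<close>.\<close>

lemma embed_clique:
  assumes E: "\<And>e. e \<in> E \<Longrightarrow> card e = r" and r: "2 \<le> r"
    and K: "finite K" "card K = l + 1" and l: "1 \<le> l"
    and S: "finite S" "K \<inter> S = {}" "card S + embed_slack r l \<le> M"
    and rob: "\<And>u v. u \<in> K \<Longrightarrow> v \<in> K \<Longrightarrow> u \<noteq> v \<Longrightarrow> robust M E u v"
  shows "\<exists>W. copy r l E W \<and> K \<subseteq> W \<and> W \<inter> S = {}"
proof -
  have "2 \<le> card K" using K l by simp
  then obtain T where "T \<subseteq> K" "card T = 2" by (meson obtain_subset_with_card_n)
  then obtain a b where ab: "a \<in> K" "b \<in> K" "a \<noteq> b" by (auto simp: card_2_iff)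
  let ?S = "S \<union> (K - {a, b})"
  have "card (K - {a, b}) \<le> card K" using K by (intro card_mono) auto
  then have "card ?S \<le> card S + card K" using card_Un_le[of S "K - {a, b}"] by linarith
  then have "card ?S \<le> M" using S K unfolding embed_slack_def by simp
  moreover have "finite ?S" "a \<notin> ?S" "b \<notin> ?S" using S K ab by auto
  moreover have "robust M E a b" by (rule rob[OF ab])
  ultimately have "\<exists>e\<in>E. a \<in> e \<and> b \<in> e \<and> e \<inter> ?S = {}" by (intro robustD[of M E a b ?S])
  then obtain e0 where "e0 \<in> E" "a \<in> e0" "b \<in> e0" "e0 \<inter> ?S = {}" by blast
  then have "e0 \<in> E" "e0 \<inter> K = {a, b}" "e0 \<inter> S = {}" using ab by auto
  from embed_near_clique[OF E r K ab this S rob] show ?thesis by blast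
qed

section \<open>Vertex-disjoint copies as packings\<close>

definition packing :: "nat \<Rightarrow> nat \<Rightarrow> 'a set set \<Rightarrow> 'a set set \<Rightarrow> bool" where
  "packing r l E P \<longleftrightarrow> finite P \<and> (\<forall>W\<in>P. copy r l E W) \<and> disjoint P"

lemma packing_card_Union:
  assumes "packing r l E P"
  shows "finite (\<Union>P)" "card (\<Union>P) = card P * card (verts (H_expansion r l))"
proof -
  have c: "finite W" "card W = card (verts (H_expansion r l))" if "W \<in> P" for W
    using assms that copy_finite copy_card unfolding packing_def by blast+
  then show "finite (\<Union>P)" using assms unfolding packing_def by blast
  have "card (\<Union>P) = sum card P"
    using c assms by (intro card_Union_disjoint) (auto simp: packing_def disjoint_def pairwise_def disjnt_def)
  then show "card (\<Union>P) = card P * card (verts (H_expansion r l))" using c by simp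
qed

lemma packing_insert:
  assumes P: "packing r l E P" and W: "copy r l E W" "W \<inter> \<Union>P = {}"
  shows "packing r l E (insert W P)" "card (insert W P) = Suc (card P)"
proof -
  have "W \<notin> P" using W copy_nonempty by blast
  then show "card (insert W P) = Suc (card P)" using P by (simp add: packing_def)
  show "packing r l E (insert W P)" using P W unfolding packing_def disjoint_def by auto
qed

lemma packing_subset: "packing r l E P \<Longrightarrow> Q \<subseteq> P \<Longrightarrow> packing r l E Q"
  unfolding packing_def disjoint_def by (meson finite_subset subsetD)

text \<open>Copies are nonempty, so disjoint copies with different indices have different vertex
  sets and the cardinality of the set of vertex sets counts them.\<close>

lemma contains_disjoint_copies_iff:
  assumes G: "is_rgraph r G" and l: "1 \<le> l"
  shows "contains_disjoint_copies G k (H_expansion r l) \<longleftrightarrow> (\<exists>P. packing r l (edges G) P \<and> card P = k)"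
proof
  assume "contains_disjoint_copies G k (H_expansion r l)"
  then obtain C :: "nat \<Rightarrow> 'a hypergraph" where C: "\<And>i. i < k \<Longrightarrow> subhypergraph (C i) G \<and> isomorphic (H_expansion r l) (C i)"
    "\<And>i j. i < k \<Longrightarrow> j < k \<Longrightarrow> i \<noteq> j \<Longrightarrow> verts (C i) \<inter> verts (C j) = {}"
    unfolding contains_disjoint_copies_def by blast
  have c: "copy r l (edges G) (verts (C i))" if "i < k" for i
    using C(1)[OF that] unfolding copy_def subhypergraph_def by blast
  have inj: "inj_on (\<lambda>i. verts (C i)) {..<k}"
  proof (rule inj_onI, rule ccontr)
    fix i j assume "i \<in> {..<k}" "j \<in> {..<k}" "verts (C i) = verts (C j)" "i \<noteq> j"
    then show False using C(2)[of i j] copy_nonempty[OF c] by auto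
  qed
  have "packing r l (edges G) ((\<lambda>i. verts (C i)) ` {..<k})"
    using c C(2) unfolding packing_def disjoint_def by auto
  moreover have "card ((\<lambda>i. verts (C i)) ` {..<k}) = k" using inj by (simp add: card_image)
  ultimately show "\<exists>P. packing r l (edges G) P \<and> card P = k" by blast
next
  assume "\<exists>P. packing r l (edges G) P \<and> card P = k"
  then obtain P where P: "packing r l (edges G) P" "card P = k" by blast
  then obtain w where w: "bij_betw w {..<k} P"
    using finite_same_card_bij[of "{..<k}" P] by (auto simp: packing_def)
  have "\<exists>C. isomorphic (H_expansion r l) C \<and> edges C \<subseteq> edges G \<and> verts C = w i" if "i < k" for i
    using P w that unfolding packing_def copy_def bij_betw_def by blast
  then obtain C where C: "\<And>i. i < k \<Longrightarrow> isomorphic (H_expansion r l) (C i) \<and> edges (C i) \<subseteq> edges G \<and> verts (C i) = w i"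
    by metis
  have "verts (C i) \<subseteq> verts G" if "i < k" for i
  proof -
    have "w i \<in> P" using w that by (auto simp: bij_betw_def)
    then have "copy r l (edges G) (w i)" using P by (simp add: packing_def)
    then have "w i \<subseteq> \<Union> (edges G)" by (rule copy_subset_Union[OF l])
    then show ?thesis using C[OF that] G unfolding is_rgraph_def by blast
  qed
  moreover have "verts (C i) \<inter> verts (C j) = {}" if "i < k" "j < k" "i \<noteq> j" for i j
  proof -
    have "w i \<in> P" "w j \<in> P" "w i \<noteq> w j" using w that by (auto simp: bij_betw_def inj_on_def)
    then show ?thesis using P C that by (auto simp: packing_def disjoint_def)
  qed
  ultimately show "contains_disjoint_copies G k (H_expansion r l)"
    unfolding contains_disjoint_copies_def subhypergraph_def using C by blast
qed

section \<open>Nearly extremal hypergraphs\<close>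

text \<open>\<open>f\<close> is the approximate partition with no class much too small.
  \<open>T\<close> collects the typical vertices, robust to almost all vertices of other classes; a
  few atypical vertices remain, with no information about them.\<close>

definition structured :: "nat \<Rightarrow> real \<Rightarrow> nat \<Rightarrow> 'a set \<Rightarrow> 'a set set \<Rightarrow> ('a \<Rightarrow> nat) \<Rightarrow> 'a set \<Rightarrow> bool" where
  "structured l \<kappa> M V E f T \<longleftrightarrow> (\<forall>v\<in>V. f v < l) \<and>
     (\<forall>i<l. (1 / real l - \<kappa>) * real (card V) \<le> real (card {v \<in> V. f v = i})) \<and>
     T \<subseteq> V \<and> real (card (V - T)) \<le> \<kappa> * real (card V) \<and>
     (\<forall>a\<in>T. real (card {u \<in> V. f u \<noteq> f a \<and> \<not> robust M E a u}) \<le> \<kappa> * real (card V))"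

text \<open>Extra edges only create robust pairs. Structure found after deleting a packing can thus
  be used in the full hypergraph.\<close>

lemma structured_mono:
  assumes V: "finite V" and s: "structured l \<kappa> M V E f T" and E: "E \<subseteq> E'"
  shows "structured l \<kappa> M V E' f T"
proof -
  have "card {u \<in> V. f u \<noteq> f a \<and> \<not> robust M E' a u} \<le> card {u \<in> V. f u \<noteq> f a \<and> \<not> robust M E a u}" for a
    using V robust_mono[OF _ E] by (intro card_mono) auto
  then show ?thesis using s unfolding structured_def by (meson of_nat_le_iff order_trans)
qed

section \<open>Counting edges through non-robust pairs\<close>

text \<open>A set \<open>S\<close> refuting robustness meets every edge through the pair, so each
  such edge has a third vertex among at most \<open>M\<close>. The factor \<open>card V\<close> on
  the left keeps the truncating exponent \<open>r - 3\<close> out of the statement.\<close>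

lemma card_nonrobust_pair:
  assumes V: "finite V" and E: "E \<subseteq> ksubsets r V" and r: "2 \<le> r"
    and uv: "u \<noteq> v" "\<not> robust M E u v"
  shows "card {e \<in> E. u \<in> e \<and> v \<in> e} * card V \<le> M * card V ^ (r - 2)"
proof -
  obtain S where S: "finite S" "card S \<le> M" "u \<notin> S" "v \<notin> S" "\<And>e. e \<in> E \<Longrightarrow> u \<in> e \<Longrightarrow> v \<in> e \<Longrightarrow> e \<inter> S \<noteq> {}"
    using uv unfolding robust_def by blast
  have sub: "{e \<in> E. u \<in> e \<and> v \<in> e} \<subseteq> (\<Union>x\<in>S. {e \<in> ksubsets r V. {u, v, x} \<subseteq> e})"
    using S(5) E by blast
  show ?thesis
  proof (cases "r = 2")
    \<comment> \<open>For \<open>r = 2\<close> an edge through the pair has no third vertex, so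
      there is no such edge; truncated \<open>r - 3\<close> would lose a factor here.\<close>
    case True
    have "{e \<in> ksubsets r V. {u, v, x} \<subseteq> e} = {}" if "x \<in> S" for x
    proof (rule ccontr)
      assume "{e \<in> ksubsets r V. {u, v, x} \<subseteq> e} \<noteq> {}"
      then obtain e where e: "e \<subseteq> V" "card e = 2" "{u, v, x} \<subseteq> e" using True by (auto simp: ksubsets_def)
      then have "card {u, v, x} \<le> 2" using V by (metis card_mono finite_subset)
      moreover have "x \<noteq> u" "x \<noteq> v" using that S by auto
      ultimately show False using uv(1) by simp
    qed
    then have "{e \<in> E. u \<in> e \<and> v \<in> e} = {}" using sub by blast
    then have "card {e \<in> E. u \<in> e \<and> v \<in> e} = 0" by (simp only: card.empty)
    then show ?thesis by (simp only: mult_0)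
  next
    case False
    have "card {e \<in> E. u \<in> e \<and> v \<in> e} \<le> card (\<Union>x\<in>S. {e \<in> ksubsets r V. {u, v, x} \<subseteq> e})"
      using sub S(1) V by (intro card_mono) (auto simp: finite_ksubsets)
    also have "\<dots> \<le> (\<Sum>x\<in>S. card {e \<in> ksubsets r V. {u, v, x} \<subseteq> e})" by (rule card_UN_le[OF S(1)])
    also have "\<dots> \<le> (\<Sum>x\<in>S. card V ^ (r - 3))"
    proof (rule sum_mono)
      fix x assume "x \<in> S"
      then have "x \<noteq> u" "x \<noteq> v" using S by auto
      then have "card {u, v, x} = 3" using uv(1) by simp
      then show "card {e \<in> ksubsets r V. {u, v, x} \<subseteq> e} \<le> card V ^ (r - 3)"
        using card_ksubsets_supset[OF V, of "{u, v, x}" r] False r by auto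
    qed
    also have "\<dots> \<le> M * card V ^ (r - 3)" using S(2) by simp
    finally have "card {e \<in> E. u \<in> e \<and> v \<in> e} * card V \<le> M * card V ^ (r - 3) * card V" by (rule mult_le_mono1)
    also have "\<dots> = M * card V ^ (r - 2)"
    proof -
      have "r - 2 = Suc (r - 3)" using False r by simp
      then show ?thesis by simp
    qed
    finally show ?thesis .
  qed
qed

lemma card_nonrobust_vertex:
  assumes V: "finite V" and E: "E \<subseteq> ksubsets r V" and r: "2 \<le> r"
  shows "card {e \<in> E. v \<in> e \<and> (\<exists>u\<in>e. u \<noteq> v \<and> \<not> robust M E v u)} * card V \<le> M * card V ^ (r - 1)"
proof -
  let ?U = "{u \<in> V. u \<noteq> v \<and> \<not> robust M E v u}"
  have sub: "{e \<in> E. v \<in> e \<and> (\<exists>u\<in>e. u \<noteq> v \<and> \<not> robust M E v u)} \<subseteq> (\<Union>u\<in>?U. {e \<in> E. v \<in> e \<and> u \<in> e})"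
    using E by (auto simp: ksubsets_def)
  have fE: "finite E" using E V finite_ksubsets finite_subset by blast
  have "card {e \<in> E. v \<in> e \<and> (\<exists>u\<in>e. u \<noteq> v \<and> \<not> robust M E v u)} \<le> card (\<Union>u\<in>?U. {e \<in> E. v \<in> e \<and> u \<in> e})"
    using sub V fE by (intro card_mono) auto
  also have "\<dots> \<le> (\<Sum>u\<in>?U. card {e \<in> E. v \<in> e \<and> u \<in> e})" using V by (intro card_UN_le) simp
  finally have "card {e \<in> E. v \<in> e \<and> (\<exists>u\<in>e. u \<noteq> v \<and> \<not> robust M E v u)} * card V
      \<le> (\<Sum>u\<in>?U. card {e \<in> E. v \<in> e \<and> u \<in> e}) * card V" by (rule mult_le_mono1)
  also have "\<dots> = (\<Sum>u\<in>?U. card {e \<in> E. v \<in> e \<and> u \<in> e} * card V)" by (rule sum_distrib_right)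
  also have "\<dots> \<le> (\<Sum>u\<in>?U. M * card V ^ (r - 2))"
    using card_nonrobust_pair[OF V E r, of v _ M] by (intro sum_mono) auto
  also have "\<dots> = card ?U * (M * card V ^ (r - 2))" by simp
  also have "\<dots> \<le> card V * (M * card V ^ (r - 2))" using V by (intro mult_le_mono1 card_mono) auto
  also have "\<dots> = M * card V ^ (r - 1)"
  proof -
    have "r - 1 = Suc (r - 2)" using r by simp
    then show ?thesis by simp
  qed
  finally show ?thesis .
qed

lemma card_nonrobust_edges:
  assumes V: "finite V" and E: "E \<subseteq> ksubsets r V" and r: "2 \<le> r"
  shows "card (E - cliques (robust M E) r V) * card V \<le> M * card V ^ r"
proof -
  let ?B = "\<lambda>v. {e \<in> E. v \<in> e \<and> (\<exists>u\<in>e. u \<noteq> v \<and> \<not> robust M E v u)}"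
  have fE: "finite E" using E V finite_ksubsets finite_subset by blast
  have sub: "E - cliques (robust M E) r V \<subseteq> (\<Union>v\<in>V. ?B v)"
  proof
    fix e assume e: "e \<in> E - cliques (robust M E) r V"
    then have "e \<in> E" "e \<subseteq> V" "\<not> clique (robust M E) e"
      using E by (auto simp: cliques_def ksubsets_def)
    then obtain v u where "v \<in> e" "u \<in> e" "v \<noteq> u" "\<not> robust M E v u" by (auto simp: clique_def)
    then have "v \<in> V" "e \<in> ?B v" using \<open>e \<in> E\<close> \<open>e \<subseteq> V\<close> by auto
    then show "e \<in> (\<Union>v\<in>V. ?B v)" by blast
  qed
  have "card (E - cliques (robust M E) r V) \<le> card (\<Union>v\<in>V. ?B v)"
    using sub V fE by (intro card_mono) auto
  also have "\<dots> \<le> (\<Sum>v\<in>V. card (?B v))" using V by (rule card_UN_le)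
  finally have "card (E - cliques (robust M E) r V) * card V \<le> (\<Sum>v\<in>V. card (?B v)) * card V" by (rule mult_le_mono1)
  also have "\<dots> = (\<Sum>v\<in>V. card (?B v) * card V)" by (rule sum_distrib_right)
  also have "\<dots> \<le> (\<Sum>v\<in>V. M * card V ^ (r - 1))"
    by (intro sum_mono card_nonrobust_vertex[OF V E r])
  also have "\<dots> = M * card V ^ r"
  proof -
    have "r = Suc (r - 1)" using r by simp
    then have "card V ^ r = card V * card V ^ (r - 1)" by (metis power_Suc)
    then show ?thesis by simp
  qed
  finally show ?thesis .
qed

lemma copy_free_robust_clique_free:
  assumes V: "finite V" and E: "E \<subseteq> ksubsets r V" and r: "2 \<le> r" "r \<le> l"
    and free: "\<And>W. \<not> copy r l E W" and M: "embed_slack r l \<le> M"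
  shows "cliques (robust M E) (Suc l) V = {}"
proof (rule ccontr)
  assume "cliques (robust M E) (Suc l) V \<noteq> {}"
  then obtain K where K: "K \<subseteq> V" "card K = l + 1" "clique (robust M E) K"
    by (auto simp: cliques_def ksubsets_def)
  have fK: "finite K" using K V finite_subset by blast
  have "\<exists>W. copy r l E W \<and> K \<subseteq> W \<and> W \<inter> {} = {}"
    by (rule embed_clique[OF _ r(1) fK K(2)]) (use E r M K(3) in \<open>auto simp: ksubsets_def clique_def\<close>)
  then show False using free by blast
qed

text \<open>With \<open>M \<le> \<delta> * n\<close> the edges containing a non-robust pair are a
  small multiple of \<open>n ^ r\<close>, so the graph of robust pairs has almost the Turan number
  of \<open>r\<close>-cliques. Stability then bounds the missing pairs, and Markov's inequality
  turns this into few atypical vertices.\<close>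

lemma copy_free_structured:
  assumes r: "2 \<le> r" "r \<le> l" and \<kappa>: "(0::real) < \<kappa>"
  shows "\<exists>\<delta>>0. \<forall>(V :: 'a set) E M. finite V \<longrightarrow> E \<subseteq> ksubsets r V \<longrightarrow> (\<forall>W. \<not> copy r l E W) \<longrightarrow>
     embed_slack r l \<le> M \<longrightarrow> real M \<le> \<delta> * real (card V) \<longrightarrow>
     (real (l choose r) / real l ^ r - \<delta>) * real (card V) ^ r \<le> real (card E) \<longrightarrow>
     (\<exists>f T. structured l \<kappa> M V E f T)"
proof -
  \<comment> \<open>The square is for Markov: at most \<open>\<kappa>^2 * n^2\<close> missing pairs
    leave at most \<open>\<kappa> * n\<close> vertices that miss more than
    \<open>\<kappa> * n\<close> others.\<close>
  define \<eta> where "\<eta> = min \<kappa> (\<kappa>\<^sup>2)"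
  have \<eta>: "0 < \<eta>" "\<eta> \<le> \<kappa>" "\<eta> \<le> \<kappa>\<^sup>2" using \<kappa> by (auto simp: \<eta>_def)
  have l: "2 \<le> l" using r by simp
  obtain \<epsilon> where \<epsilon>: "\<epsilon> > 0" and st: "\<forall>(V :: 'a set) adj. finite V \<longrightarrow> (\<forall>x y. adj x y \<longrightarrow> adj y x) \<longrightarrow>
     (\<forall>x. \<not> adj x x) \<longrightarrow> cliques adj (Suc l) V = {} \<longrightarrow>
     (real (l choose r) / real l ^ r - \<epsilon>) * real (card V) ^ r \<le> real (card (cliques adj r V)) \<longrightarrow>
     (\<exists>f. (\<forall>v\<in>V. f v < l) \<and>
        (\<forall>i<l. \<bar>real (card {v \<in> V. f v = i}) - real (card V) / real l\<bar> \<le> \<eta> * real (card V)) \<and>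
        real (card (adj_pairs (\<lambda>u v. f u \<noteq> f v \<and> \<not> adj u v) V V)) \<le> \<eta> * (real (card V))\<^sup>2)"
    using clique_stability[OF l r \<eta>(1), where 'a='a] by (elim exE conjE) (rule that)
  show ?thesis
  \<comment> \<open>One half of \<open>\<epsilon>\<close> is the deficit allowed in
    \<open>card E\<close>, the other covers the edges with a non-robust pair.\<close>
  proof (intro exI[of _ "\<epsilon> / 2"] conjI allI impI)
    fix V :: "'a set" and E M
    assume V: "finite V" and E: "E \<subseteq> ksubsets r V" and free: "\<forall>W. \<not> copy r l E W"
      and M: "embed_slack r l \<le> M" "real M \<le> \<epsilon> / 2 * real (card V)"
      and many: "(real (l choose r) / real l ^ r - \<epsilon> / 2) * real (card V) ^ r \<le> real (card E)"
    define n where "n = real (card V)"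
    let ?adj = "robust M E"
    have "0 < M" using M(1) by (simp add: embed_slack_def)
    then have n: "0 < n" using M(2) \<epsilon> by (cases "n = 0") (auto simp: n_def)
    have fE: "finite E" using E V finite_ksubsets finite_subset by blast
    have "real (card (E - cliques ?adj r V)) * n \<le> real M * n ^ r"
      using card_nonrobust_edges[OF V E r(1), of M] unfolding n_def
      by (metis of_nat_le_iff of_nat_mult of_nat_power)
    also have "\<dots> \<le> (\<epsilon> / 2 * n) * n ^ r" using M(2) n unfolding n_def by (intro mult_right_mono) auto
    finally have "real (card (E - cliques ?adj r V)) * n \<le> (\<epsilon> / 2 * n ^ r) * n" by (simp add: mult_ac)
    then have bad: "real (card (E - cliques ?adj r V)) \<le> \<epsilon> / 2 * n ^ r" using n by (simp only: mult_le_cancel_right_pos)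
    have "card E \<le> card ((E - cliques ?adj r V) \<union> cliques ?adj r V)"
      using fE V by (intro card_mono) (auto simp: finite_cliques)
    also have "\<dots> \<le> card (E - cliques ?adj r V) + card (cliques ?adj r V)" by (rule card_Un_le)
    finally have "real (card E) \<le> real (card (E - cliques ?adj r V)) + real (card (cliques ?adj r V))"
      by (metis of_nat_add of_nat_le_iff)
    then have "(real (l choose r) / real l ^ r - \<epsilon> / 2) * n ^ r - \<epsilon> / 2 * n ^ r \<le> real (card (cliques ?adj r V))"
      using bad many unfolding n_def by argo
    then have cl: "(real (l choose r) / real l ^ r - \<epsilon>) * n ^ r \<le> real (card (cliques ?adj r V))"
      by (simp add: algebra_simps)
    have cf: "cliques ?adj (Suc l) V = {}"
      by (rule copy_free_robust_clique_free[OF V E r free[rule_format] M(1)])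
    have sym: "\<forall>x y. ?adj x y \<longrightarrow> ?adj y x" by (intro allI impI) (rule robust_sym)
    have irr: "\<forall>x. \<not> ?adj x x" by (intro allI robust_irrefl)
    from st[THEN spec, THEN spec, THEN mp, THEN mp, THEN mp, THEN mp, THEN mp, OF V sym irr cf cl[unfolded n_def]]
    obtain f where f: "\<forall>v\<in>V. f v < l"
        "\<And>i. i < l \<Longrightarrow> \<bar>real (card {v \<in> V. f v = i}) - n / real l\<bar> \<le> \<eta> * n"
        "real (card (adj_pairs (\<lambda>u v. f u \<noteq> f v \<and> \<not> ?adj u v) V V)) \<le> \<eta> * n\<^sup>2"
      unfolding n_def by auto
    let ?miss = "\<lambda>a. {u \<in> V. f u \<noteq> f a \<and> \<not> ?adj a u}"
    define T where "T = {a \<in> V. real (card (?miss a)) \<le> \<kappa> * n}"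
    have size: "(1 / real l - \<kappa>) * n \<le> real (card {v \<in> V. f v = i})" if "i < l" for i
    proof -
      have "\<eta> * n \<le> \<kappa> * n" using \<eta> n by (intro mult_right_mono) auto
      moreover have "n / real l - \<eta> * n \<le> real (card {v \<in> V. f v = i})" using f(2)[OF that] by linarith
      moreover have "(1 / real l - \<kappa>) * n = n / real l - \<kappa> * n" by (simp add: algebra_simps)
      ultimately show ?thesis by linarith
    qed
    have "real (card (V - T)) * (\<kappa> * n) = (\<Sum>a\<in>V - T. \<kappa> * n)" by simp
    also have "\<dots> \<le> (\<Sum>a\<in>V - T. real (card (?miss a)))"
      by (intro sum_mono) (auto simp: T_def)
    also have "\<dots> \<le> (\<Sum>a\<in>V. real (card (?miss a)))"
      using V by (intro sum_mono2) auto
    also have "\<dots> = real (\<Sum>a\<in>V. card {u \<in> V. f a \<noteq> f u \<and> \<not> ?adj a u})"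
      by (simp add: eq_commute)
    also have "\<dots> = real (card (adj_pairs (\<lambda>u v. f u \<noteq> f v \<and> \<not> ?adj u v) V V))"
      using V by (simp only: card_adj_pairs)
    also have "\<dots> \<le> \<kappa>\<^sup>2 * n\<^sup>2" using f(3) \<eta>(3) by (meson mult_right_mono order_trans zero_le_power2)
    finally have "real (card (V - T)) * (\<kappa> * n) \<le> (\<kappa> * n) * (\<kappa> * n)" by (simp add: power2_eq_square mult_ac)
    then have "real (card (V - T)) \<le> \<kappa> * n" using \<kappa> n by (simp only: mult_le_cancel_right_pos mult_pos_pos)
    then show "\<exists>f T. structured l \<kappa> M V E f T"
      using f(1) size unfolding structured_def n_def[symmetric]
      by (intro exI[of _ f] exI[of _ T]) (auto simp: T_def)
  qed (use \<epsilon> in auto)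
qed

section \<open>Copies through a vertex or an edge of a structured hypergraph\<close>

text \<open>Greedy choice, one class after another. The next vertex must avoid the atypical vertices
  and the non-neighbours of at most \<open>l\<close> chosen vertices, each set of size at most
  \<open>\<kappa> * n\<close>; this gives the factor \<open>l + 1\<close>. Choosing inside
  \<open>T\<close> keeps the later steps possible.\<close>

lemma pick_transversal:
  assumes V: "finite V" and s: "structured l \<kappa> M V E f T" and \<kappa>: "0 \<le> \<kappa>"
    and I: "I \<subseteq> {..<l}"
    and B: "\<And>i. i \<in> I \<Longrightarrow> B i \<subseteq> {v \<in> V. f v = i}"
    and big: "\<And>i. i \<in> I \<Longrightarrow> real (l + 1) * \<kappa> * real (card V) < real (card (B i))"
  shows "\<exists>u. (\<forall>i\<in>I. u i \<in> B i \<inter> T) \<and> (\<forall>i\<in>I. \<forall>j\<in>I. i \<noteq> j \<longrightarrow> robust M E (u i) (u j))"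
proof -
  have "finite I" using I finite_subset by blast
  then show ?thesis using I B big
  proof (induction I rule: finite_induct)
    case empty then show ?case by auto
  next
    case (insert i I)
    have "\<exists>u. (\<forall>i\<in>I. u i \<in> B i \<inter> T) \<and> (\<forall>i\<in>I. \<forall>j\<in>I. i \<noteq> j \<longrightarrow> robust M E (u i) (u j))"
      by (rule insert.IH) (use insert.prems in auto)
    then obtain u where u: "\<And>i. i \<in> I \<Longrightarrow> u i \<in> B i \<inter> T"
      "\<And>i j. i \<in> I \<Longrightarrow> j \<in> I \<Longrightarrow> i \<noteq> j \<Longrightarrow> robust M E (u i) (u j)" by blast
    let ?miss = "\<lambda>a. {w \<in> V. f w \<noteq> f a \<and> \<not> robust M E a w}"
    let ?X = "(V - T) \<union> (\<Union>j\<in>I. ?miss (u j))"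
    have "card (I) \<le> card {..<l}" using insert.prems(1) by (intro card_mono) auto
    then have cI: "card I \<le> l" by simp
    have "real (card ?X) \<le> real (card (V - T) + (\<Sum>j\<in>I. card (?miss (u j))))"
      using card_Un_le[of "V - T" "\<Union>j\<in>I. ?miss (u j)"] card_UN_le[OF insert.hyps(1), of "\<lambda>j. ?miss (u j)"]
      by (intro of_nat_mono) linarith
    also have "\<dots> = real (card (V - T)) + (\<Sum>j\<in>I. real (card (?miss (u j))))" by simp
    also have "\<dots> \<le> \<kappa> * real (card V) + (\<Sum>j\<in>I. \<kappa> * real (card V))"
      using s u(1) unfolding structured_def by (intro add_mono sum_mono) auto
    also have "\<dots> = \<kappa> * real (card V) + real (card I) * (\<kappa> * real (card V))" by simp
    also have "\<dots> \<le> \<kappa> * real (card V) + real l * (\<kappa> * real (card V))"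
      using cI \<kappa> by (intro add_left_mono mult_right_mono) auto
    also have "\<dots> = real (l + 1) * \<kappa> * real (card V)" by (simp add: algebra_simps)
    also have "\<dots> < real (card (B i))" using insert.prems(3) by simp
    finally have "card ?X < card (B i)" by simp
    moreover have "finite ?X" using V insert.hyps by auto
    ultimately have "\<not> B i \<subseteq> ?X" using card_mono[of ?X "B i"] by linarith
    then obtain w where w: "w \<in> B i" "w \<notin> ?X" by blast
    have wi: "w \<in> V" "f w = i" using insert.prems(2)[of i] w by auto
    have wT: "w \<in> T" using w wi by auto
    have wr: "robust M E (u j) w" if "j \<in> I" for j
    proof -
      have "f (u j) = j" using insert.prems(2)[of j] u(1)[OF that] that by auto
      then have "f w \<noteq> f (u j)" using wi that insert.hyps by auto
      then show ?thesis using w wi that by auto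
    qed
    have eq: "(u(i := w)) j = u j" if "j \<in> I" for j using that insert.hyps by auto
    show ?case
      using u w wT wr robust_sym[OF wr] eq by (intro exI[of _ "u(i := w)"]) auto
  qed
qed

text \<open>An edge through two vertices \<open>a\<close>, \<open>b\<close> that are both robust to almost everything outside
  class \<open>j\<close> serves as the edge of the pair \<open>{a, b}\<close> in a copy with one core vertex in each other class.\<close>
lemma same_class_edge_copy:
  assumes V: "finite V" and E: "E \<subseteq> ksubsets r V" and r: "2 \<le> r" "r \<le> l"
    and s: "structured l \<kappa> M V E f T" and \<kappa>: "0 \<le> \<kappa>"
    and e: "e \<in> E" "a \<in> e" "b \<in> e" "a \<noteq> b" "e \<inter> S = {}" and j: "j < l"
    and miss: "real (card {u \<in> V. f u \<noteq> j \<and> \<not> robust M E a u}) \<le> \<mu> * real (card V)"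
      "real (card {u \<in> V. f u \<noteq> j \<and> \<not> robust M E b u}) \<le> \<mu> * real (card V)"
    and S: "finite S" "card S + embed_slack r l \<le> M" and M: "real M \<le> \<kappa> * real (card V)"
    and small: "2 * \<mu> + real (l + 3) * \<kappa> < 1 / real l" and n: "0 < card V"
  shows "\<exists>W. copy r l E W \<and> e \<subseteq> W \<and> W \<inter> S = {}"
proof -
  let ?n = "real (card V)"
  have n0: "?n > 0" using n by simp
  have ce: "card e = r" "finite e" "e \<subseteq> V" using E e(1) finite_subset[OF _ V] by (auto simp: ksubsets_def)
  define B where "B i = {u \<in> V. f u = i \<and> robust M E a u \<and> robust M E b u \<and> u \<notin> S \<and> u \<notin> e}" for i
  define I where "I = {..<l} - {j}"
  have big: "real (l + 1) * \<kappa> * ?n < real (card (B i))" if i: "i \<in> I" for i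
  proof -
    let ?Ma = "{u \<in> V. f u \<noteq> j \<and> \<not> robust M E a u}" and ?Mb = "{u \<in> V. f u \<noteq> j \<and> \<not> robust M E b u}"
    have "{v \<in> V. f v = i} \<subseteq> B i \<union> ?Ma \<union> ?Mb \<union> S \<union> e"
      using i by (auto simp: B_def I_def)
    then have "card {v \<in> V. f v = i} \<le> card (B i \<union> ?Ma \<union> ?Mb \<union> S \<union> e)"
      using V S(1) ce by (intro card_mono) (auto simp: B_def)
    also have "\<dots> \<le> card (B i) + card ?Ma + card ?Mb + card S + card e"
      by (meson add_le_mono card_Un_le le_refl le_trans)
    finally have "real (card {v \<in> V. f v = i})
        \<le> real (card (B i)) + real (card ?Ma) + real (card ?Mb) + real (card S + card e)"
      by (simp only: of_nat_add[symmetric] of_nat_le_iff add.assoc)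
    moreover have "real (card S + card e) \<le> \<kappa> * ?n"
    proof -
      have "r * 1 \<le> r * 2 ^ (l + 1)" by (intro mult_le_mono2) simp
      then have "card S + card e \<le> M" using S(2) ce(1) unfolding embed_slack_def by linarith
      then have "real (card S + card e) \<le> real M" by (simp only: of_nat_le_iff)
      then show ?thesis using M by linarith
    qed
    moreover have "(1 / real l - \<kappa>) * ?n \<le> real (card {v \<in> V. f v = i})"
      using s i by (auto simp: structured_def I_def)
    \<comment> \<open>A class loses \<open>2 * \<mu>\<close> to the vertices not robust to
      \<open>a\<close> or \<open>b\<close> and \<open>\<kappa>\<close> to \<open>S\<close> and
      \<open>e\<close>. With \<open>\<kappa>\<close> for its own deviation and
      \<open>(l + 1) * \<kappa>\<close> for \<open>pick_transversal\<close>, this adds up to the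
      assumption \<open>small\<close>.\<close>
    ultimately have "(1 / real l - \<kappa>) * ?n - \<mu> * ?n - \<mu> * ?n - \<kappa> * ?n \<le> real (card (B i))"
      using miss by linarith
    moreover have "(2 * \<mu> + real (l + 3) * \<kappa>) * ?n < 1 / real l * ?n"
      using small n0 by (rule mult_strict_right_mono)
    ultimately show ?thesis by (simp add: algebra_simps)
  qed
  have "\<exists>u. (\<forall>i\<in>I. u i \<in> B i \<inter> T) \<and> (\<forall>i\<in>I. \<forall>j\<in>I. i \<noteq> j \<longrightarrow> robust M E (u i) (u j))"
    by (rule pick_transversal[OF V s \<kappa> _ _ big]) (auto simp: B_def I_def)
  then obtain u where u: "\<And>i. i \<in> I \<Longrightarrow> u i \<in> B i"
    "\<And>i j. i \<in> I \<Longrightarrow> j \<in> I \<Longrightarrow> i \<noteq> j \<Longrightarrow> robust M E (u i) (u j)" by blast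
  define K where "K = insert a (insert b (u ` I))"
  have uI: "f w = i \<and> w \<noteq> a \<and> w \<noteq> b \<and> w \<notin> S \<and> w \<notin> e \<and> robust M E a w \<and> robust M E b w"
    if "i \<in> I" "w = u i" for i w
    using u(1)[OF that(1)] that robust_irrefl[of M E a] robust_irrefl[of M E b] by (auto simp: B_def)
  have inj: "inj_on u I" using u(2) robust_irrefl by (metis inj_onI)
  have "a \<notin> insert b (u ` I)" "b \<notin> u ` I" using uI e(4) by auto
  then have "card K = Suc (Suc (card I))" unfolding K_def using inj by (simp add: I_def card_image)
  then have cK: "card K = l + 1" "finite K" using j by (auto simp: I_def K_def)
  have eK: "e \<inter> K = {a, b}" using e uI by (auto simp: K_def)
  have KS: "K \<inter> S = {}" using e uI by (auto simp: K_def)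
  have rob: "robust M E x y" if xy: "x \<in> K" "y \<in> K" "x \<noteq> y" "{x, y} \<noteq> {a, b}" for x y
  proof -
    consider "x \<in> {a, b}" "y \<in> u ` I" | "x \<in> u ` I" "y \<in> {a, b}" | "x \<in> u ` I" "y \<in> u ` I"
      using xy unfolding K_def by blast
    then show ?thesis
    proof cases
      case 1 then show ?thesis using uI by blast
    next
      case 2 then have "robust M E y x" using uI by blast
      then show ?thesis by (rule robust_sym)
    next
      case 3 then show ?thesis using u(2) xy(3) by blast
    qed
  qed
  have "\<exists>W. copy r l E W \<and> K \<union> e \<subseteq> W \<and> W \<inter> S = {}"
    by (rule embed_near_clique[OF _ r(1) cK(2,1) _ _ e(4,1) eK e(5) S(1) KS S(2) rob])
       (use E in \<open>auto simp: K_def ksubsets_def\<close>)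
  then show ?thesis by blast
qed

text \<open>A vertex of large degree either is robust to many vertices in every class, and then it is the core
  vertex of a copy, or it lies on many edges that meet a class twice, and then it can be an
  expansion vertex of a copy.\<close>
lemma degree_bound_of_no_copy:
  assumes V: "finite V" and E: "E \<subseteq> ksubsets r V" and r: "2 \<le> r" "r \<le> l"
    and s: "structured l \<kappa> M V E f T" and \<kappa>: "0 \<le> \<kappa>" "real (l + 6) * \<kappa> < 1 / real l"
    and S: "finite S" "card S + embed_slack r l \<le> M" and M: "real M \<le> \<kappa> * real (card V)"
    and v: "v \<in> V" "v \<notin> S" and no: "\<And>W. copy r l E W \<Longrightarrow> v \<in> W \<Longrightarrow> W \<inter> S \<noteq> {}"
  shows "\<exists>i<l. real (card {e \<in> E. v \<in> e})
    \<le> real (l - 1 choose (r - 1)) * (real (card {u \<in> V. f u \<noteq> i \<and> robust M E v u}) / real (l - 1)) ^ (r - 1)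
      + real (l + 5) * \<kappa> * real (card V) ^ (r - 1)"
proof -
  let ?n = "real (card V)"
  have nn: "0 < card V" using v V by (auto simp: card_gt_0_iff)
  then have n0: "?n > 0" by simp
  have l: "2 \<le> l" using r by simp
  have fE: "finite E" using E V finite_ksubsets finite_subset by blast
  have rE: "card e = r" "e \<subseteq> V" "finite e" if "e \<in> E" for e
    using that E finite_subset[OF _ V] by (auto simp: ksubsets_def)
  define A where "A i = {u \<in> V. f u = i \<and> robust M E v u \<and> u \<notin> S}" for i
  \<comment> \<open>Otherwise a transversal can be picked inside the sets \<open>A i\<close>;
    together with \<open>v\<close> it is a clique of robust pairs and gives a copy through
    \<open>v\<close> that avoids \<open>S\<close>.\<close>
  have "\<exists>i<l. real (card (A i)) \<le> real (l + 1) * \<kappa> * ?n"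
  proof (rule ccontr)
    assume "\<not> ?thesis"
    then have big: "real (l + 1) * \<kappa> * ?n < real (card (A i))" if "i \<in> {..<l}" for i using that by force
    have "\<exists>u. (\<forall>i\<in>{..<l}. u i \<in> A i \<inter> T) \<and> (\<forall>i\<in>{..<l}. \<forall>j\<in>{..<l}. i \<noteq> j \<longrightarrow> robust M E (u i) (u j))"
      by (rule pick_transversal[OF V s \<kappa>(1) order_refl _ big]) (auto simp: A_def)
    then obtain u where u: "\<And>i. i \<in> {..<l} \<Longrightarrow> u i \<in> A i"
      "\<And>i j. i \<in> {..<l} \<Longrightarrow> j \<in> {..<l} \<Longrightarrow> i \<noteq> j \<Longrightarrow> robust M E (u i) (u j)" by blast
    have uA: "robust M E v w \<and> w \<notin> S \<and> w \<noteq> v" if "i \<in> {..<l}" "w = u i" for i w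
      using u(1)[OF that(1)] that robust_irrefl[of M E v] by (auto simp: A_def)
    have inj: "inj_on u {..<l}" using u(2) robust_irrefl by (metis inj_onI)
    let ?K = "insert v (u ` {..<l})"
    have "v \<notin> u ` {..<l}" using uA by blast
    then have cK: "finite ?K" "card ?K = l + 1" using inj by (auto simp: card_image)
    have KS: "?K \<inter> S = {}" using uA v by auto
    have rob: "robust M E x y" if xy: "x \<in> ?K" "y \<in> ?K" "x \<noteq> y" for x y
    proof -
      consider "x = v" "y \<in> u ` {..<l}" | "x \<in> u ` {..<l}" "y = v" | "x \<in> u ` {..<l}" "y \<in> u ` {..<l}"
        using xy by blast
      then show ?thesis
      proof cases
        case 1 then show ?thesis using uA by blast
      next
        case 2 then have "robust M E y x" using uA by blast
        then show ?thesis by (rule robust_sym)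
      next
        case 3 then show ?thesis using u(2) xy(3) by blast
      qed
    qed
    have "\<exists>W. copy r l E W \<and> ?K \<subseteq> W \<and> W \<inter> S = {}"
    proof (rule embed_clique[OF rE(1) r(1) cK _ S(1) KS S(2)])
      show "1 \<le> l" using l by simp
    qed (use rob in blast)+
    then obtain W where "copy r l E W" "v \<in> W" "W \<inter> S = {}" by blast
    then show False using no by blast
  qed
  then obtain i where i: "i < l" "real (card (A i)) \<le> real (l + 1) * \<kappa> * ?n" by blast
  \<comment> \<open>Besides the few edges in \<open>Z1\<close>, with a vertex not robust to
    \<open>v\<close>, and in \<open>Z2\<close>, meeting an exceptional set, every edge at
    \<open>v\<close> minus \<open>v\<close> is a rainbow set in the \<open>l - 1\<close> classes of
    \<open>N\<close>. If it had two vertices in one class, these would be typical and the edge would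
    lie in a copy through \<open>v\<close>.\<close>
  define N where "N = {u \<in> V. f u \<noteq> i \<and> robust M E v u}"
  define X where "X = (A i \<union> (S \<inter> V) \<union> (V - T)) - {v}"
  define Z1 where "Z1 = {e \<in> E. v \<in> e \<and> (\<exists>u\<in>e. u \<noteq> v \<and> \<not> robust M E v u)}"
  define Z2 where "Z2 = {e \<in> ksubsets r V. v \<in> e \<and> e \<inter> X \<noteq> {}}"
  define Z3 where "Z3 = insert v ` rainbow (r - 1) N f"
  have fin: "finite Z1" "finite Z2" "finite Z3" "finite X" "finite N"
    using fE V S(1) by (auto simp: Z1_def Z2_def Z3_def X_def N_def A_def finite_ksubsets finite_rainbow)
  have cover: "{e \<in> E. v \<in> e} \<subseteq> Z1 \<union> Z2 \<union> Z3"
  proof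
    fix e assume "e \<in> {e \<in> E. v \<in> e}"
    then have e: "e \<in> E" "v \<in> e" by auto
    show "e \<in> Z1 \<union> Z2 \<union> Z3"
    proof (cases "e \<in> Z1 \<union> Z2")
      case False
      have u: "u \<in> V \<and> robust M E v u \<and> u \<notin> S \<and> u \<in> T \<and> f u \<noteq> i" if "u \<in> e" "u \<noteq> v" for u
      proof -
        have "u \<in> V" using rE(2)[OF e(1)] that by blast
        moreover have "robust M E v u" using False e that by (auto simp: Z1_def)
        moreover have "u \<notin> X" using False e that E by (auto simp: Z2_def)
        ultimately show ?thesis using that by (auto simp: X_def A_def)
      qed
      have eS: "e \<inter> S = {}" using u v by auto
      have inj: "inj_on f (e - {v})"
      proof (rule ccontr)
        assume "\<not> inj_on f (e - {v})"
        then obtain a b where ab: "a \<in> e" "a \<noteq> v" "b \<in> e" "b \<noteq> v" "a \<noteq> b" "f a = f b"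
          by (auto simp: inj_on_def)
        have "a \<in> T" "b \<in> T" "f a < l" using u ab s by (auto simp: structured_def)
        moreover have "2 * \<kappa> + real (l + 3) * \<kappa> < 1 / real l"
          using \<kappa> by (simp add: algebra_simps)
        ultimately have "\<exists>W. copy r l E W \<and> e \<subseteq> W \<and> W \<inter> S = {}"
          using s ab(6)
          by (intro same_class_edge_copy[OF V E r s \<kappa>(1) e(1) ab(1,3,5) eS _ _ _ S M _ nn, of "f a" \<kappa>])
             (auto simp: structured_def)
        then show False using no e(2) by blast
      qed
      have "e - {v} \<subseteq> N" using u by (auto simp: N_def)
      moreover have "card (e - {v}) = r - 1" using rE[OF e(1)] e(2) by simp
      ultimately have "e - {v} \<in> rainbow (r - 1) N f" using inj by (auto simp: rainbow_def ksubsets_def)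
      moreover have "e = insert v (e - {v})" using e(2) by auto
      ultimately show ?thesis unfolding Z3_def by blast
    qed auto
  qed
  have "card {e \<in> E. v \<in> e} \<le> card (Z1 \<union> Z2 \<union> Z3)" using cover fin by (intro card_mono) auto
  also have "\<dots> \<le> card Z1 + card Z2 + card Z3" by (meson add_le_mono1 card_Un_le le_trans)
  finally have tot: "real (card {e \<in> E. v \<in> e}) \<le> real (card Z1) + real (card Z2) + real (card Z3)"
    by (simp only: of_nat_add[symmetric] of_nat_le_iff)
  have z1: "real (card Z1) \<le> \<kappa> * ?n ^ (r - 1)"
  proof -
    have "real (card Z1 * card V) \<le> real (M * card V ^ (r - 1))"
      unfolding Z1_def using card_nonrobust_vertex[OF V E r(1)] by (simp only: of_nat_le_iff)
    then have "real (card Z1) * ?n \<le> real M * ?n ^ (r - 1)" by simp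
    also have "\<dots> \<le> (\<kappa> * ?n) * ?n ^ (r - 1)" using M by (intro mult_right_mono) auto
    finally have "real (card Z1) * ?n \<le> (\<kappa> * ?n ^ (r - 1)) * ?n" by (simp add: mult_ac)
    then show ?thesis using n0 by (simp only: mult_le_cancel_right_pos)
  qed
  have z2: "real (card Z2) \<le> real (l + 3) * \<kappa> * ?n ^ (r - 1)"
  proof -
    have "card X \<le> card (A i \<union> (S \<inter> V) \<union> (V - T))"
      using V by (intro card_mono) (auto simp: X_def A_def)
    also have "\<dots> \<le> card (A i) + card (S \<inter> V) + card (V - T)" by (meson add_le_mono1 card_Un_le le_trans)
    also have "\<dots> \<le> card (A i) + card S + card (V - T)"
      using S(1) by (intro add_mono order_refl card_mono) auto
    finally have "real (card X) \<le> real (card (A i)) + real (card S) + real (card (V - T))"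
      by (simp only: of_nat_add[symmetric] of_nat_le_iff)
    moreover have "real (card S) \<le> \<kappa> * ?n"
    proof -
      have "real (card S) \<le> real M" using S(2) by simp
      then show ?thesis using M by linarith
    qed
    moreover have "real (card (V - T)) \<le> \<kappa> * ?n" using s by (auto simp: structured_def)
    ultimately have X: "real (card X) \<le> real (l + 3) * \<kappa> * ?n" using i(2) by (simp add: algebra_simps)
    have "card Z2 \<le> card X * card V ^ (r - 2)"
      unfolding Z2_def using fin by (intro card_ksubsets_mem_Int[OF V _ r(1)]) (auto simp: X_def)
    then have "real (card Z2) \<le> real (card X * card V ^ (r - 2))" by (simp only: of_nat_le_iff)
    also have "\<dots> = real (card X) * ?n ^ (r - 2)" by simp
    also have "\<dots> \<le> (real (l + 3) * \<kappa> * ?n) * ?n ^ (r - 2)" using X by (intro mult_right_mono) auto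
    also have "\<dots> = real (l + 3) * \<kappa> * ?n ^ Suc (r - 2)" by simp
    also have "Suc (r - 2) = r - 1" using r by simp
    finally show ?thesis .
  qed
  have z3: "real (card Z3) \<le> real (l - 1 choose (r - 1)) * (real (card N) / real (l - 1)) ^ (r - 1)"
  proof -
    have "card Z3 \<le> card (rainbow (r - 1) N f)" unfolding Z3_def using fin by (intro card_image_le finite_rainbow)
    then have "real (card Z3) \<le> real (card (rainbow (r - 1) N f))" by simp
    also have "\<dots> \<le> real (card ({..<l} - {i}) choose (r - 1)) * (real (card N) / real (card ({..<l} - {i}))) ^ (r - 1)"
      by (rule rainbow_upper) (use fin s in \<open>auto simp: N_def structured_def\<close>)
    also have "card ({..<l} - {i}) = l - 1" using i(1) by simp
    finally show ?thesis .
  qed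
  have "\<kappa> * ?n ^ (r - 1) + real (l + 3) * \<kappa> * ?n ^ (r - 1) \<le> real (l + 5) * \<kappa> * ?n ^ (r - 1)"
    using \<kappa>(1) by (simp add: algebra_simps)
  then show ?thesis using tot z1 z2 z3 i(1) unfolding N_def[symmetric] by (intro exI[of _ i]) (auto simp: N_def)
qed

text \<open>Every vertex is recoloured by a class in which it has few robust neighbours. Its degree
  then forces it to be robust to almost everything outside that class, which makes even the vertices
  outside \<open>T\<close> usable. An edge with two vertices of the same new colour would lie in a
  copy.\<close>

lemma edges_rainbow_of_min_degree:
  assumes V: "finite V" "0 < card V" and E: "E \<subseteq> ksubsets r V" and r: "2 \<le> r" "r \<le> l"
    and s: "structured l \<kappa> M V E f T" and \<kappa>: "0 \<le> \<kappa>"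
    and \<nu>: "0 < \<nu>" "\<nu> \<le> 1 / real l" "2 * (\<kappa> + real (l - 1) * \<nu>) + real (l + 6) * \<kappa> < 1 / real l"
    and gap: "real (l + 6) * \<kappa> < real (l - 1 choose (r - 1)) * ((1 / real l) ^ (r - 1) - (1 / real l - \<nu>) ^ (r - 1))"
    and M: "embed_slack r l \<le> M" "real M \<le> \<kappa> * real (card V)"
    and free: "\<And>W. \<not> copy r l E W"
    and deg: "\<And>v. v \<in> V \<Longrightarrow> (real (l - 1 choose (r - 1)) * (1 / real l) ^ (r - 1) - \<kappa>) * real (card V) ^ (r - 1)
        \<le> real (card {e \<in> E. v \<in> e})"
  shows "\<exists>g. (\<forall>v\<in>V. g v < l) \<and> E \<subseteq> rainbow r V g"
proof -
  let ?n = "real (card V)"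
  let ?C = "real (l - 1 choose (r - 1))"
  have n0: "?n > 0" using V by simp
  have l: "2 \<le> l" using r by simp
  have \<kappa>6: "real (l + 6) * \<kappa> < 1 / real l"
  proof -
    have "0 \<le> 2 * (\<kappa> + real (l - 1) * \<nu>)" using \<kappa> \<nu>(1) by simp
    then show ?thesis using \<nu>(3) by linarith
  qed
  have ex: "\<exists>i<l. real (card {u \<in> V. f u \<noteq> i \<and> \<not> robust M E v u}) \<le> (\<kappa> + real (l - 1) * \<nu>) * ?n" if v: "v \<in> V" for v
  proof -
    obtain i where i: "i < l" "real (card {e \<in> E. v \<in> e})
      \<le> ?C * (real (card {u \<in> V. f u \<noteq> i \<and> robust M E v u}) / real (l - 1)) ^ (r - 1)
        + real (l + 5) * \<kappa> * ?n ^ (r - 1)"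
      using degree_bound_of_no_copy[OF V(1) E r s \<kappa> \<kappa>6 finite.emptyI _ M(2) v] M(1) free by auto
    define N where "N = {u \<in> V. f u \<noteq> i \<and> robust M E v u}"
    \<comment> \<open>\<open>z * ?n\<close> is the average number of robust neighbours per class
      other than \<open>i\<close>. By \<open>gap\<close>, the minimum degree is incompatible with
      \<open>z \<le> 1 / l - \<nu>\<close>.\<close>
    define z where "z = real (card N) / real (l - 1) / ?n"
    have z: "real (card N) / real (l - 1) = z * ?n" "real (card N) = real (l - 1) * z * ?n" "z \<ge> 0"
      using n0 l by (auto simp: z_def)
    have "(?C * (1 / real l) ^ (r - 1) - \<kappa>) * ?n ^ (r - 1) \<le> ?C * (z * ?n) ^ (r - 1) + real (l + 5) * \<kappa> * ?n ^ (r - 1)"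
      using order_trans[OF deg[OF v] i(2)] unfolding N_def[symmetric] z(1) .
    also have "\<dots> = (?C * z ^ (r - 1) + real (l + 5) * \<kappa>) * ?n ^ (r - 1)" by (simp add: power_mult_distrib algebra_simps)
    finally have "?C * (1 / real l) ^ (r - 1) - \<kappa> \<le> ?C * z ^ (r - 1) + real (l + 5) * \<kappa>"
      using n0 by (simp only: mult_le_cancel_right_pos zero_less_power)
    then have "?C * (1 / real l) ^ (r - 1) \<le> ?C * z ^ (r - 1) + real (l + 6) * \<kappa>" by (simp add: algebra_simps)
    then have "?C * (1 / real l - \<nu>) ^ (r - 1) < ?C * z ^ (r - 1)"
      using gap unfolding right_diff_distrib by linarith
    then have "(1 / real l - \<nu>) ^ (r - 1) < z ^ (r - 1)"
      by (rule mult_left_less_imp_less) simp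
    then have zl: "1 / real l - \<nu> < z" using z(3) by (rule power_less_imp_less_base)
    let ?Mi = "{u \<in> V. f u \<noteq> i \<and> \<not> robust M E v u}"
    have "V = {u \<in> V. f u = i} \<union> (N \<union> ?Mi)" by (auto simp: N_def)
    then have "card V = card ({u \<in> V. f u = i} \<union> (N \<union> ?Mi))" by simp
    also have "\<dots> = card {u \<in> V. f u = i} + card (N \<union> ?Mi)"
      using V by (intro card_Un_disjoint) (auto simp: N_def)
    also have "card (N \<union> ?Mi) = card N + card ?Mi"
      using V by (intro card_Un_disjoint) (auto simp: N_def)
    finally have "?n = real (card {u \<in> V. f u = i}) + (real (card N) + real (card ?Mi))"
      by (simp only: of_nat_add)
    moreover have "(1 / real l - \<kappa>) * ?n \<le> real (card {u \<in> V. f u = i})" using s i(1) by (auto simp: structured_def)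
    moreover have "real (l - 1) * (1 / real l - \<nu>) * ?n \<le> real (card N)"
      unfolding z(2) using zl by (intro mult_right_mono mult_left_mono) auto
    ultimately have "real (card ?Mi) \<le> ?n - (1 / real l - \<kappa>) * ?n - real (l - 1) * (1 / real l - \<nu>) * ?n" by argo
    also have "\<dots> = (\<kappa> + real (l - 1) * \<nu>) * ?n"
      using l by (simp add: field_simps of_nat_diff)
    finally show ?thesis using i(1) by blast
  qed
  then have "\<forall>v\<in>V. \<exists>i. i < l \<and> real (card {u \<in> V. f u \<noteq> i \<and> \<not> robust M E v u}) \<le> (\<kappa> + real (l - 1) * \<nu>) * ?n"
    by blast
  from bchoice[OF this] obtain g where g: "\<And>v. v \<in> V \<Longrightarrow> g v < l"
    "\<And>v. v \<in> V \<Longrightarrow> real (card {u \<in> V. f u \<noteq> g v \<and> \<not> robust M E v u}) \<le> (\<kappa> + real (l - 1) * \<nu>) * ?n"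
    by blast
  \<comment> \<open>The sizes of the classes still refer to \<open>f\<close>; only the class left
    out for \<open>a\<close> and \<open>b\<close> is given by \<open>g\<close>. This is why
    \<open>same_class_edge_copy\<close> speaks of a class \<open>j\<close> and not of
    \<open>f a\<close>.\<close>
  have "inj_on g e" if e: "e \<in> E" for e
  proof (rule inj_onI, rule ccontr)
    fix a b assume ab: "a \<in> e" "b \<in> e" "g a = g b" "a \<noteq> b"
    have abV: "a \<in> V" "b \<in> V" using ab e E by (auto simp: ksubsets_def)
    have "2 * (\<kappa> + real (l - 1) * \<nu>) + real (l + 3) * \<kappa> < 1 / real l"
      using \<nu>(3) \<kappa> by (simp add: algebra_simps)
    then have "\<exists>W. copy r l E W \<and> e \<subseteq> W \<and> W \<inter> {} = {}"
      using g(2)[OF abV(1)] g(2)[OF abV(2)] g(1)[OF abV(1)] ab M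
      by (intro same_class_edge_copy[OF V(1) E r s \<kappa> e ab(1,2,4) _ _ _ _ _ _ M(2) _ V(2), of "{}" "g a" "\<kappa> + real (l - 1) * \<nu>"]) auto
    then show False using free by blast
  qed
  then show ?thesis using g(1) E by (intro exI[of _ g]) (auto simp: rainbow_def)
qed

section \<open>The exact result for one copy\<close>

lemma power_diff_close:
  assumes a: "(0::real) < a" and \<epsilon>: "0 < \<epsilon>"
  shows "\<exists>x0>0. x0 \<le> a \<and> (\<forall>x. 0 \<le> x \<longrightarrow> x \<le> x0 \<longrightarrow> a ^ k - \<epsilon> \<le> (a - x) ^ k)"
proof -
  have "isCont (\<lambda>x. (a - x) ^ k) 0" by (intro continuous_intros)
  then obtain d where d: "d > 0" "\<And>x. x \<noteq> 0 \<Longrightarrow> \<bar>x\<bar> < d \<Longrightarrow> \<bar>(a - x) ^ k - a ^ k\<bar> < \<epsilon>"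
    unfolding isCont_def LIM_eq using \<epsilon> by auto
  show ?thesis
  proof (intro exI[of _ "min a (d / 2)"] conjI allI impI)
    fix x assume "0 \<le> x" "x \<le> min a (d / 2)"
    then have "\<bar>x\<bar> < d" using d(1) by auto
    then show "a ^ k - \<epsilon> \<le> (a - x) ^ k" using d(2)[of x] \<epsilon> by (cases "x = 0") auto
  qed (use a d in auto)
qed

lemma div_power_lower:
  assumes l: "0 < l" and \<epsilon>: "(0::real) < \<epsilon>"
  shows "\<exists>c>0. \<exists>n0. \<forall>n m. n0 \<le> n \<longrightarrow> (1 - c) * real n \<le> real m \<longrightarrow>
    ((1 / real l) ^ k - \<epsilon>) * real n ^ k \<le> real (m div l) ^ k"
proof -
  obtain x0 where x0: "x0 > 0" "x0 \<le> 1 / real l"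
    "\<And>x. 0 \<le> x \<Longrightarrow> x \<le> x0 \<Longrightarrow> (1 / real l) ^ k - \<epsilon> \<le> (1 / real l - x) ^ k"
    using power_diff_close[of "1 / real l" \<epsilon> k] l \<epsilon> by auto
  define c where "c = real l * x0 / 2"
  define n0 where "n0 = Suc (nat \<lceil>2 / x0\<rceil>)"
  show ?thesis
  proof (intro exI[of _ c] exI[of _ n0] conjI allI impI)
    fix n m assume n: "n0 \<le> n" and m: "(1 - c) * real n \<le> real m"
    have n1: "real n > 0" using n by (simp add: n0_def)
    have "2 / x0 \<le> real n" using n unfolding n0_def by linarith
    then have "2 \<le> real n * x0" using x0(1) by (simp add: divide_le_eq)
    then have "1 / real n \<le> x0 / 2" using n1 by (simp add: divide_le_eq mult.commute)
    \<comment> \<open>\<open>c / l\<close> accounts for \<open>m\<close> being smaller than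
      \<open>n\<close>, \<open>1 / n\<close> for rounding in \<open>m div l\<close>; by the choice
      of \<open>c\<close> and \<open>n0\<close> each is at most \<open>x0 / 2\<close>.\<close>
    moreover define x where "x = c / real l + 1 / real n"
    ultimately have x: "0 \<le> x" "x \<le> x0" using l x0(1) n1 by (auto simp: c_def)
    have "((1 / real l) ^ k - \<epsilon>) * real n ^ k \<le> (1 / real l - x) ^ k * real n ^ k"
      using x0(3)[OF x] by (intro mult_right_mono) auto
    also have "\<dots> = ((1 / real l - x) * real n) ^ k" by (simp add: power_mult_distrib)
    also have "\<dots> \<le> real (m div l) ^ k"
    proof (intro power_mono)
      show "0 \<le> (1 / real l - x) * real n" using x x0(2) n1 by simp
      have "real m / real l - 1 \<le> real (m div l)"
        using floor_divide_of_nat_eq[of m l, where 'a = real] by linarith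
      moreover have "(1 - c) * real n / real l \<le> real m / real l" using m by (intro divide_right_mono) auto
      moreover have "(1 / real l - x) * real n = (1 - c) * real n / real l - 1"
        using n1 l by (simp add: x_def field_simps)
      ultimately show "(1 / real l - x) * real n \<le> real (m div l)" by linarith
    qed
    finally show "((1 / real l) ^ k - \<epsilon>) * real n ^ k \<le> real (m div l) ^ k" .
  qed (use l x0 in \<open>auto simp: c_def\<close>)
qed

lemma choose_div_power_lower:
  assumes l: "0 < l" and \<epsilon>: "(0::real) < \<epsilon>"
  shows "\<exists>c>0. \<exists>n0. \<forall>n m. n0 \<le> n \<longrightarrow> (1 - c) * real n \<le> real m \<longrightarrow>
    (real C * (1 / real l) ^ k - \<epsilon>) * real n ^ k \<le> real (C * (m div l) ^ k)"
proof -
  define \<eta> where "\<eta> = \<epsilon> / (real C + 1)"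
  have \<eta>: "\<eta> > 0" "real C * \<eta> \<le> \<epsilon>" using \<epsilon> by (auto simp: \<eta>_def field_simps)
  obtain c n0 where c: "c > 0" "\<And>n m. n0 \<le> n \<Longrightarrow> (1 - c) * real n \<le> real m \<Longrightarrow>
    ((1 / real l) ^ k - \<eta>) * real n ^ k \<le> real (m div l) ^ k"
    using div_power_lower[OF l \<eta>(1)] by blast
  show ?thesis
  proof (intro exI[of _ c] exI[of _ n0] conjI allI impI)
    fix n m assume "n0 \<le> n" "(1 - c) * real n \<le> real m"
    from c(2)[OF this] have *: "real C * (((1 / real l) ^ k - \<eta>) * real n ^ k) \<le> real C * real (m div l) ^ k"
      by (intro mult_left_mono) auto
    have "(real C * (1 / real l) ^ k - \<epsilon>) * real n ^ k \<le> (real C * ((1 / real l) ^ k - \<eta>)) * real n ^ k"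
      using \<eta>(2) by (intro mult_right_mono) (auto simp: right_diff_distrib)
    with * show "(real C * (1 / real l) ^ k - \<epsilon>) * real n ^ k \<le> real (C * (m div l) ^ k)"
      by (simp add: mult.assoc)
  qed (use c in auto)
qed

lemma turan_degree_asymptotic:
  assumes l: "0 < l" and \<epsilon>: "(0::real) < \<epsilon>"
  shows "\<exists>c>0. \<exists>n0. \<forall>n m. n0 \<le> n \<longrightarrow> (1 - c) * real n \<le> real m \<longrightarrow>
    (real (l - 1 choose (r - 1)) * (1 / real l) ^ (r - 1) - \<epsilon>) * real n ^ (r - 1) \<le> real (turan_degree r l m)"
proof -
  obtain c n0 where c: "c > 0" "\<And>n m. n0 \<le> n \<Longrightarrow> (1 - c) * real n \<le> real m \<Longrightarrow>
    (real (l - 1 choose (r - 1)) * (1 / real l) ^ (r - 1) - \<epsilon>) * real n ^ (r - 1)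
      \<le> real ((l - 1 choose (r - 1)) * (m div l) ^ (r - 1))"
    using choose_div_power_lower[OF l \<epsilon>] by blast
  have "real ((l - 1 choose (r - 1)) * (m div l) ^ (r - 1)) \<le> real (turan_degree r l m)" for m
    using turan_degree_lower[OF l] by (simp only: of_nat_le_iff)
  then show ?thesis using c by (meson order_trans)
qed

lemma turan_number_asymptotic:
  assumes l: "0 < l" and \<epsilon>: "(0::real) < \<epsilon>"
  shows "\<exists>c>0. \<exists>n0. \<forall>n m. n0 \<le> n \<longrightarrow> (1 - c) * real n \<le> real m \<longrightarrow>
    (real (l choose r) / real l ^ r - \<epsilon>) * real n ^ r \<le> real (turan_number r l m)"
proof -
  obtain c n0 where c: "c > 0" "\<And>n m. n0 \<le> n \<Longrightarrow> (1 - c) * real n \<le> real m \<Longrightarrow>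
    (real (l choose r) * (1 / real l) ^ r - \<epsilon>) * real n ^ r \<le> real ((l choose r) * (m div l) ^ r)"
    using choose_div_power_lower[OF l \<epsilon>] by blast
  have le: "real ((l choose r) * (m div l) ^ r) \<le> real (turan_number r l m)" for m
    using turan_number_lower[OF l] by (simp only: of_nat_le_iff)
  have "real (l choose r) * (1 / real l) ^ r = real (l choose r) / real l ^ r" by (simp add: power_one_over)
  from order_trans[OF c(2) le, unfolded this] c(1) show ?thesis by blast
qed

text \<open>\<open>\<nu>\<close> is fixed first, small enough to leave room below
  \<open>1 / l\<close>. It creates a positive gap between two powers, and \<open>\<kappa>\<close> is
  then taken small against that gap and against the remaining room.\<close>

lemma exact_constants:
  assumes r: "2 \<le> r" "r \<le> l"
  shows "\<exists>\<kappa> \<nu> :: real. 0 < \<kappa> \<and> 0 < \<nu> \<and> \<nu> \<le> 1 / real l \<and>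
    2 * (\<kappa> + real (l - 1) * \<nu>) + real (l + 6) * \<kappa> < 1 / real l \<and>
    real (l + 6) * \<kappa> < real (l - 1 choose (r - 1)) * ((1 / real l) ^ (r - 1) - (1 / real l - \<nu>) ^ (r - 1))"
proof -
  have l: "2 \<le> l" using r by simp
  then have rl: "2 \<le> real l" by simp
  define \<nu> where "\<nu> = 1 / (8 * real l * real l)"
  have \<nu>: "0 < \<nu>" "\<nu> < 1 / real l" "2 * (real (l - 1) * \<nu>) < 1 / (4 * real l)"
    using rl l by (auto simp: \<nu>_def field_simps of_nat_diff)
  define G where "G = real (l - 1 choose (r - 1)) * ((1 / real l) ^ (r - 1) - (1 / real l - \<nu>) ^ (r - 1))"
  have "(1 / real l - \<nu>) ^ (r - 1) < (1 / real l) ^ (r - 1)"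
    using \<nu> r by (intro power_strict_mono) auto
  moreover have "0 < (l - 1 choose (r - 1))" using r by (simp add: zero_less_binomial)
  ultimately have G: "G > 0" unfolding G_def by simp
  define \<kappa> where "\<kappa> = min (G / (2 * real (l + 6))) (1 / (2 * real l * real (l + 8)))"
  have \<kappa>0: "0 < \<kappa>" using G rl by (auto simp: \<kappa>_def)
  have "\<kappa> \<le> G / (2 * real (l + 6))" by (simp add: \<kappa>_def)
  then have k1: "real (l + 6) * \<kappa> \<le> G / 2" by (simp add: field_simps)
  have "\<kappa> \<le> 1 / (2 * real l * real (l + 8))" by (simp add: \<kappa>_def)
  then have "real (l + 8) * \<kappa> \<le> real (l + 8) * (1 / (2 * real l * real (l + 8)))" by (intro mult_left_mono) auto
  then have k2: "real (l + 8) * \<kappa> \<le> 1 / (2 * real l)" by simp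
  have "2 * (\<kappa> + real (l - 1) * \<nu>) + real (l + 6) * \<kappa> = real (l + 8) * \<kappa> + 2 * (real (l - 1) * \<nu>)"
    by (simp add: algebra_simps)
  also have "\<dots> < 1 / (2 * real l) + 1 / (4 * real l)" using k2 \<nu>(3) by linarith
  also have "\<dots> < 1 / real l" using rl by (simp add: field_simps)
  finally show ?thesis using \<kappa>0 \<nu> k1 G unfolding G_def[symmetric]
    by (intro exI[of _ \<kappa>] exI[of _ \<nu>]) (auto simp: G_def)
qed

lemma obtain_slack:
  assumes "(0::real) < d"
  shows "\<exists>n0. \<forall>n\<ge>n0. \<exists>M. k \<le> M \<and> real M \<le> d * real n"
proof (rule exI[of _ "nat \<lceil>real k / d\<rceil>"], intro allI impI)
  fix n assume n: "nat \<lceil>real k / d\<rceil> \<le> n"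
  then have "real k / d \<le> real n" by linarith
  then have "real k \<le> d * real n" using assms by (simp add: divide_le_eq mult.commute)
  then show "\<exists>M. k \<le> M \<and> real M \<le> d * real n" by blast
qed

lemma turan_min_degree:
  assumes r: "2 \<le> r" "r \<le> l"
  shows "\<exists>n0. \<forall>(V :: 'a set) E. finite V \<longrightarrow> n0 \<le> card V \<longrightarrow> E \<subseteq> ksubsets r V \<longrightarrow> (\<forall>W. \<not> copy r l E W) \<longrightarrow>
     turan_number r l (card V) \<le> card E \<longrightarrow> (\<forall>v\<in>V. turan_degree r l (card V - 1) \<le> card {e \<in> E. v \<in> e}) \<longrightarrow>
     (\<exists>g. (\<forall>v\<in>V. g v < l) \<and> E \<subseteq> rainbow r V g)"
proof -
  have l: "0 < l" using r by simp
  obtain \<kappa> \<nu> :: real where k: "0 < \<kappa>" "0 < \<nu>" "\<nu> \<le> 1 / real l"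
    "2 * (\<kappa> + real (l - 1) * \<nu>) + real (l + 6) * \<kappa> < 1 / real l"
    "real (l + 6) * \<kappa> < real (l - 1 choose (r - 1)) * ((1 / real l) ^ (r - 1) - (1 / real l - \<nu>) ^ (r - 1))"
    using exact_constants[OF r] by blast
  obtain \<delta> where d: "\<delta> > 0" and st: "\<forall>(V :: 'a set) E M. finite V \<longrightarrow> E \<subseteq> ksubsets r V \<longrightarrow> (\<forall>W. \<not> copy r l E W) \<longrightarrow>
     embed_slack r l \<le> M \<longrightarrow> real M \<le> \<delta> * real (card V) \<longrightarrow>
     (real (l choose r) / real l ^ r - \<delta>) * real (card V) ^ r \<le> real (card E) \<longrightarrow>
     (\<exists>f T. structured l \<kappa> M V E f T)"
    using copy_free_structured[OF r k(1), where 'a='a] by (elim exE conjE) (rule that)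
  obtain c1 n1 where n1: "c1 > 0" "\<And>n m. n1 \<le> n \<Longrightarrow> (1 - c1) * real n \<le> real m \<Longrightarrow>
    (real (l choose r) / real l ^ r - \<delta>) * real n ^ r \<le> real (turan_number r l m)"
    using turan_number_asymptotic[OF l d, of r] by blast
  obtain c2 n2 where n2: "c2 > 0" "\<And>n m. n2 \<le> n \<Longrightarrow> (1 - c2) * real n \<le> real m \<Longrightarrow>
    (real (l - 1 choose (r - 1)) * (1 / real l) ^ (r - 1) - \<kappa>) * real n ^ (r - 1) \<le> real (turan_degree r l m)"
    using turan_degree_asymptotic[OF l k(1), of r] by blast
  obtain n3 where n3: "\<And>n. n3 \<le> n \<Longrightarrow> \<exists>M. embed_slack r l \<le> M \<and> real M \<le> min \<delta> \<kappa> * real n"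
    using obtain_slack[of "min \<delta> \<kappa>" "embed_slack r l"] d k(1) by auto
  define n0 where "n0 = n1 + n2 + n3 + Suc (nat \<lceil>1 / c2\<rceil>)"
  show ?thesis
  proof (intro exI[of _ n0] allI impI)
    fix V :: "'a set" and E
    assume V: "finite V" "n0 \<le> card V" and E: "E \<subseteq> ksubsets r V" and free: "\<forall>W. \<not> copy r l E W"
      and many: "turan_number r l (card V) \<le> card E"
      and deg: "\<forall>v\<in>V. turan_degree r l (card V - 1) \<le> card {e \<in> E. v \<in> e}"
    let ?n = "card V"
    have n: "n1 \<le> ?n" "n2 \<le> ?n" "n3 \<le> ?n" "0 < ?n" "1 / c2 \<le> real ?n"
      using V(2) unfolding n0_def by linarith+
    obtain M where M: "embed_slack r l \<le> M" "real M \<le> min \<delta> \<kappa> * real ?n" using n3[OF n(3)] by blast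
    have M1: "real M \<le> \<delta> * real ?n" "real M \<le> \<kappa> * real ?n"
      using M(2) mult_right_mono[of "min \<delta> \<kappa>" \<delta> "real ?n"] mult_right_mono[of "min \<delta> \<kappa>" \<kappa> "real ?n"] by auto
    have "(1 - c1) * real ?n \<le> real ?n" using n1(1) by (simp add: algebra_simps)
    then have "(real (l choose r) / real l ^ r - \<delta>) * real ?n ^ r \<le> real (turan_number r l ?n)" by (rule n1(2)[OF n(1)])
    also have "\<dots> \<le> real (card E)" using many by simp
    finally have "(real (l choose r) / real l ^ r - \<delta>) * real ?n ^ r \<le> real (card E)" .
    with st V(1) E free M(1) M1(1) obtain f T where s: "structured l \<kappa> M V E f T" by blast
    \<comment> \<open>A vertex of the Turan hypergraph on \<open>n\<close> vertices has its degree
      indexed by \<open>n - 1\<close>; the tolerance \<open>c2\<close> absorbs this shift by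
      one.\<close>
    have "1 \<le> c2 * real ?n" using n(5) n2(1) by (simp add: divide_le_eq mult.commute)
    then have "(1 - c2) * real ?n \<le> real (?n - 1)" using n(4) by (simp add: algebra_simps of_nat_diff)
    from n2(2)[OF n(2) this] have dg: "(real (l - 1 choose (r - 1)) * (1 / real l) ^ (r - 1) - \<kappa>) * real ?n ^ (r - 1)
        \<le> real (card {e \<in> E. v \<in> e})" if "v \<in> V" for v
      using deg that by (meson of_nat_le_iff order_trans)
    show "\<exists>g. (\<forall>v\<in>V. g v < l) \<and> E \<subseteq> rainbow r V g"
      by (rule edges_rainbow_of_min_degree[OF V(1) n(4) E r s less_imp_le[OF k(1)] k(2-5) M(1) M1(2) free[rule_format] dg])
  qed
qed

lemma delete_vertex:
  assumes V: "finite V" "v \<in> V" and E: "E \<subseteq> ksubsets r V" and free: "\<forall>W. \<not> copy r l E W"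
  shows "{e \<in> E. v \<notin> e} \<subseteq> ksubsets r (V - {v})" "\<forall>W. \<not> copy r l {e \<in> E. v \<notin> e} W"
    and "card {e \<in> E. v \<notin> e} + card {e \<in> E. v \<in> e} = card E"
proof -
  show "{e \<in> E. v \<notin> e} \<subseteq> ksubsets r (V - {v})" using E by (auto simp: ksubsets_def)
  show "\<forall>W. \<not> copy r l {e \<in> E. v \<notin> e} W" using free copy_mono by blast
  have "finite E" using E V finite_ksubsets finite_subset by blast
  then have "card ({e \<in> E. v \<notin> e} \<union> {e \<in> E. v \<in> e}) = card {e \<in> E. v \<notin> e} + card {e \<in> E. v \<in> e}"
    by (intro card_Un_disjoint) auto
  moreover have "{e \<in> E. v \<notin> e} \<union> {e \<in> E. v \<in> e} = E" by auto
  ultimately show "card {e \<in> E. v \<notin> e} + card {e \<in> E. v \<in> e} = card E" by simp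
qed

text \<open>While there is a vertex of degree less than in the Turan hypergraph, deleting it increases the excess
  over the Turan number. This cannot last, as the excess on \<open>n0\<close> vertices is at most \<open>2 ^ n0\<close>.\<close>
theorem turan_exact:
  assumes r: "2 \<le> r" "r \<le> l"
  shows "\<exists>n0. \<forall>(V :: 'a set) E. finite V \<longrightarrow> n0 \<le> card V \<longrightarrow> E \<subseteq> ksubsets r V \<longrightarrow> (\<forall>W. \<not> copy r l E W) \<longrightarrow>
     card E \<le> turan_number r l (card V) \<and>
     (card E = turan_number r l (card V) \<longrightarrow> (\<exists>g. balanced l V g \<and> E = rainbow r V g))"
proof -
  obtain m0 where m0: "\<forall>(V :: 'a set) E. finite V \<longrightarrow> m0 \<le> card V \<longrightarrow> E \<subseteq> ksubsets r V \<longrightarrow> (\<forall>W. \<not> copy r l E W) \<longrightarrow>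
     turan_number r l (card V) \<le> card E \<longrightarrow> (\<forall>v\<in>V. turan_degree r l (card V - 1) \<le> card {e \<in> E. v \<in> e}) \<longrightarrow>
     (\<exists>g. (\<forall>v\<in>V. g v < l) \<and> E \<subseteq> rainbow r V g)"
    using turan_min_degree[OF r, where 'a='a] by (elim exE)
  define n0 where "n0 = m0 + r"
  have rainbow: "\<exists>g. (\<forall>v\<in>V. g v < l) \<and> E \<subseteq> rainbow r V g"
    if "finite V" "n0 \<le> card V" "E \<subseteq> ksubsets r V" "\<forall>W. \<not> copy r l E W"
     "turan_number r l (card V) \<le> card E" "\<forall>v\<in>V. turan_degree r l (card V - 1) \<le> card {e \<in> E. v \<in> e}"
    for V :: "'a set" and E
    using m0 that unfolding n0_def by (meson add_leD1)
  have drop: "turan_number r l n + Suc k \<le> card {e \<in> E. v \<notin> e}"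
    if "finite V" "card V = Suc n" "E \<subseteq> ksubsets r V" "\<forall>W. \<not> copy r l E W" "v \<in> V"
      "turan_number r l (Suc n) + k \<le> card E" "\<not> turan_degree r l n \<le> card {e \<in> E. v \<in> e}"
    for V :: "'a set" and E v n k
    using delete_vertex(3)[OF that(1,5,3,4)] that(6,7) turan_number_Suc[of r l n] r by linarith
  \<comment> \<open>Writing the excess as \<open>Suc k\<close> keeps it positive. This rules out the
    minimum degree case, in which \<open>card E\<close> is at most the Turan number, so a vertex of
    small degree can be deleted at every step.\<close>
  have excess: "Suc k + (n - n0) \<le> 2 ^ n0"
    if "n0 \<le> n" "finite V" "card V = n" "E \<subseteq> ksubsets r V" "\<forall>W. \<not> copy r l E W"
      "turan_number r l n + Suc k \<le> card E" for V :: "'a set" and E n k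
    using that
  proof (induction n arbitrary: V E k rule: dec_induct)
    case base
    have "card E \<le> card (Pow V)" using base by (intro card_mono) (auto simp: ksubsets_def)
    then show ?case using base by (simp add: card_Pow)
  next
    case (step n)
    show ?case
    proof (cases "\<forall>v\<in>V. turan_degree r l n \<le> card {e \<in> E. v \<in> e}")
      case True
      then obtain g where g: "\<forall>v\<in>V. g v < l" "E \<subseteq> rainbow r V g"
        using rainbow[of V E] step by auto
      have "card E \<le> card (rainbow r V g)" using g step by (intro card_mono finite_rainbow) auto
      also have "\<dots> \<le> turan_number r l (card V)"
        using step g(1) r n0_def by (intro rainbow_le_turan_number) auto
      finally show ?thesis using step by simp
    next
      case False
      then obtain v where v: "v \<in> V" "\<not> turan_degree r l n \<le> card {e \<in> E. v \<in> e}" by blast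
      have "Suc (Suc k) + (n - n0) \<le> 2 ^ n0"
      proof (rule step.IH)
        show "finite (V - {v})" "card (V - {v}) = n" using step v by auto
        show "{e \<in> E. v \<notin> e} \<subseteq> ksubsets r (V - {v})" "\<forall>W. \<not> copy r l {e \<in> E. v \<notin> e} W"
          by (rule delete_vertex[OF step.prems(1) v(1) step.prems(3,4)])+
        show "turan_number r l n + Suc (Suc k) \<le> card {e \<in> E. v \<notin> e}"
          by (rule drop[OF step.prems(1-4) v(1) step.prems(5) v(2)])
      qed
      then show ?thesis using step by simp
    qed
  qed
  show ?thesis
  \<comment> \<open>The descent gains one per vertex and ends on \<open>n0\<close> vertices with an
    excess above \<open>2 ^ n0\<close>. The final \<open>+ 1\<close> is for the equality case, where
    the descent starts after one deletion.\<close>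
  proof (intro exI[of _ "n0 + 2 ^ n0 + 1"] allI impI)
    fix V :: "'a set" and E
    assume V: "finite V" "n0 + 2 ^ n0 + 1 \<le> card V" and E: "E \<subseteq> ksubsets r V" and free: "\<forall>W. \<not> copy r l E W"
    have le: "card E \<le> turan_number r l (card V)"
    proof (rule ccontr)
      assume "\<not> ?thesis"
      then have "Suc 0 + (card V - n0) \<le> 2 ^ n0"
        using V by (intro excess[OF _ V(1) refl E free]) auto
      then show False using V(2) by linarith
    qed
    moreover have "\<exists>g. balanced l V g \<and> E = rainbow r V g" if eq: "card E = turan_number r l (card V)"
    proof -
      obtain n where n: "card V = Suc n" using V(2) by (cases "card V") auto
      \<comment> \<open>With equality, deleting a vertex of small degree would produce a copy-free
        hypergraph with positive excess on \<open>n\<close> vertices, which the same descent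
        excludes.\<close>
      have deg: "\<forall>v\<in>V. turan_degree r l n \<le> card {e \<in> E. v \<in> e}"
      proof (rule ccontr)
        assume "\<not> ?thesis"
        then obtain v where v: "v \<in> V" "\<not> turan_degree r l n \<le> card {e \<in> E. v \<in> e}" by blast
        have "turan_number r l n + Suc 0 \<le> card {e \<in> E. v \<notin> e}"
          by (rule drop[OF V(1) n E free v(1) _ v(2)]) (use eq n in simp)
        moreover have "finite (V - {v})" "card (V - {v}) = n" using V v n by auto
        ultimately have "Suc 0 + (n - n0) \<le> 2 ^ n0"
          using V(2) n delete_vertex[OF V(1) v(1) E free] by (intro excess[of n "V - {v}"]) auto
        then show False using V(2) n by linarith
      qed
      have "\<exists>g. (\<forall>v\<in>V. g v < l) \<and> E \<subseteq> rainbow r V g"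
        by (rule rainbow[OF V(1) _ E free]) (use V eq deg n in auto)
      then obtain g where g: "\<forall>v\<in>V. g v < l" "E \<subseteq> rainbow r V g" by blast
      have rV: "r \<le> card V" using V(2) n0_def by simp
      have fr: "finite (rainbow r V g)" using V by (simp add: finite_rainbow)
      have c: "card (rainbow r V g) = turan_number r l (card V)"
        using card_mono[OF fr g(2)] eq rainbow_le_turan_number(1)[OF V(1) r rV g(1)] by simp
      then have "E = rainbow r V g" using card_subset_eq[OF fr g(2)] eq by simp
      then show ?thesis using rainbow_le_turan_number(2)[OF V(1) r rV g(1) c] by blast
    qed
    ultimately show "card E \<le> turan_number r l (card V) \<and>
      (card E = turan_number r l (card V) \<longrightarrow> (\<exists>g. balanced l V g \<and> E = rainbow r V g))" by blast
  qed
qed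

section \<open>Disjoint copies\<close>

lemma exists_maximal_packing:
  assumes "\<not> (\<exists>P. packing r l E P \<and> card P = Suc k)"
  shows "\<exists>P. packing r l E P \<and> card P \<le> k \<and> (\<forall>W. copy r l E W \<longrightarrow> W \<inter> \<Union>P \<noteq> {})"
proof -
  have le: "card P \<le> k" if P: "packing r l E P" for P
  proof (rule ccontr)
    assume "\<not> card P \<le> k"
    then obtain Q where "Q \<subseteq> P" "card Q = Suc k" by (meson not_less_eq_eq obtain_subset_with_card_n)
    then show False using assms packing_subset[OF P] by blast
  qed
  have "packing r l E {}" by (simp add: packing_def disjoint_def)
  then have "\<exists>P. packing r l E P \<and> (\<forall>Q. packing r l E Q \<longrightarrow> card Q \<le> card P)"
    using ex_has_greatest_nat[of "packing r l E" "{}" card "Suc k"] le by (simp add: le_imp_less_Suc)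
  then obtain P where P: "packing r l E P" "\<And>Q. packing r l E Q \<Longrightarrow> card Q \<le> card P" by blast
  have "W \<inter> \<Union>P \<noteq> {}" if "copy r l E W" for W
  proof
    assume "W \<inter> \<Union>P = {}"
    from packing_insert[OF P(1) that this] P(2)[of "insert W P"] show False by simp
  qed
  then show ?thesis using P(1) le[OF P(1)] by blast
qed

text \<open>Each vertex of \<open>L\<close> in turn receives a copy that avoids all earlier copies
  and also the untreated rest of \<open>L\<close>, so that this rest stays free. The last assumption
  keeps the set to be avoided below \<open>M - q\<close> until the end.\<close>

lemma extend_packing:
  assumes "finite L"
    and "\<And>v S. v \<in> L \<Longrightarrow> finite S \<Longrightarrow> card S + q \<le> M \<Longrightarrow> v \<notin> S \<Longrightarrow> \<exists>W. copy r l E W \<and> v \<in> W \<and> W \<inter> S = {}"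
    and "packing r l E P" "\<Union>P \<inter> L = {}"
    and "card (verts (H_expansion r l)) * (card P + card L) + card L + q \<le> M"
  shows "\<exists>P'. packing r l E P' \<and> card P' = card P + card L"
  using assms
proof (induction L arbitrary: P rule: finite_induct)
  case empty
  then show ?case by auto
next
  case (insert v L)
  let ?m = "card (verts (H_expansion r l))"
  let ?S = "\<Union>P \<union> L"
  have U: "finite (\<Union>P)" "card (\<Union>P) = card P * ?m" using packing_card_Union[OF insert.prems(2)] by auto
  have "card ?S \<le> card P * ?m + card L" using card_Un_le[of "\<Union>P" L] U by simp
  then have "card ?S + q \<le> M" using insert.prems(4) insert.hyps by (simp add: algebra_simps)
  moreover have "v \<notin> ?S" "finite ?S" using insert U by auto
  ultimately obtain W where W: "copy r l E W" "v \<in> W" "W \<inter> ?S = {}" using insert.prems(1)[of v ?S] by blast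
  then have P': "packing r l E (insert W P)" "card (insert W P) = Suc (card P)"
    using packing_insert[OF insert.prems(2) W(1)] by auto
  have "\<exists>P'. packing r l E P' \<and> card P' = card (insert W P) + card L"
  proof (rule insert.IH[OF insert.prems(1) P'(1)])
    show "\<Union> (insert W P) \<inter> L = {}" using W insert.prems(3) by auto
    show "?m * (card (insert W P) + card L) + card L + q \<le> M"
      using insert.prems(4) insert.hyps P'(2) by simp
  qed auto
  then show ?case using P'(2) insert.hyps by simp
qed

text \<open>If there were no such copy, \<open>degree_bound_of_no_copy\<close> would bound the
  degree by the robust neighbours outside a single class. Every class has at least
  \<open>(1 / l - \<kappa>) * n\<close> vertices, which pushes that bound below
  \<open>D * n ^ (r - 1)\<close>.\<close>

lemma high_degree_copy:
  assumes V: "finite V" and E: "E \<subseteq> ksubsets r V" and r: "2 \<le> r" "r \<le> l"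
    and s: "structured l \<kappa> M V E f T" and \<kappa>: "0 \<le> \<kappa>" "real (l + 6) * \<kappa> < 1 / real l"
    and M: "real M \<le> \<kappa> * real (card V)"
    and D: "real (l - 1 choose (r - 1)) * (1 / real l + \<kappa>) ^ (r - 1) + real (l + 5) * \<kappa> \<le> D"
    and v: "v \<in> V" "D * real (card V) ^ (r - 1) < real (card {e \<in> E. v \<in> e})"
    and S: "finite S" "card S + embed_slack r l \<le> M" "v \<notin> S"
  shows "\<exists>W. copy r l E W \<and> v \<in> W \<and> W \<inter> S = {}"
proof (rule ccontr)
  assume "\<not> ?thesis"
  then have no: "\<And>W. copy r l E W \<Longrightarrow> v \<in> W \<Longrightarrow> W \<inter> S \<noteq> {}" by blast
  let ?n = "real (card V)" and ?C = "real (l - 1 choose (r - 1))"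
  have l: "2 \<le> l" using r by simp
  obtain i where i: "i < l" "real (card {e \<in> E. v \<in> e})
    \<le> ?C * (real (card {u \<in> V. f u \<noteq> i \<and> robust M E v u}) / real (l - 1)) ^ (r - 1) + real (l + 5) * \<kappa> * ?n ^ (r - 1)"
    using degree_bound_of_no_copy[OF V E r s \<kappa> S(1,2) M v(1) S(3) no] by blast
  let ?N = "{u \<in> V. f u \<noteq> i \<and> robust M E v u}"
  have "card ?N + card {u \<in> V. f u = i} = card (?N \<union> {u \<in> V. f u = i})"
    using V by (intro card_Un_disjoint[symmetric]) auto
  also have "\<dots> \<le> card V" using V by (intro card_mono) auto
  finally have "real (card ?N) + real (card {u \<in> V. f u = i}) \<le> ?n" by (simp only: of_nat_add[symmetric] of_nat_le_iff)
  moreover have "(1 / real l - \<kappa>) * ?n \<le> real (card {u \<in> V. f u = i})" using s i(1) by (auto simp: structured_def)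
  ultimately have "real (card ?N) \<le> (1 - 1 / real l + \<kappa>) * ?n" by (simp add: algebra_simps)
  also have "\<dots> \<le> (real (l - 1) * (1 / real l + \<kappa>)) * ?n"
  proof (rule mult_right_mono)
    have "1 - 1 / real l = real (l - 1) * (1 / real l)" using l by (simp add: field_simps of_nat_diff)
    moreover have "1 * \<kappa> \<le> real (l - 1) * \<kappa>" using l \<kappa>(1) by (intro mult_right_mono) auto
    ultimately show "1 - 1 / real l + \<kappa> \<le> real (l - 1) * (1 / real l + \<kappa>)" by (simp add: algebra_simps)
  qed simp
  finally have "real (card ?N) / real (l - 1) \<le> (1 / real l + \<kappa>) * ?n"
    using l by (simp add: divide_le_eq mult_ac)
  then have "?C * (real (card ?N) / real (l - 1)) ^ (r - 1) \<le> ?C * ((1 / real l + \<kappa>) * ?n) ^ (r - 1)"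
    by (intro mult_left_mono power_mono) auto
  then have "real (card {e \<in> E. v \<in> e}) \<le> ?C * ((1 / real l + \<kappa>) * ?n) ^ (r - 1) + real (l + 5) * \<kappa> * ?n ^ (r - 1)"
    using i(2) by linarith
  also have "\<dots> = (?C * (1 / real l + \<kappa>) ^ (r - 1) + real (l + 5) * \<kappa>) * ?n ^ (r - 1)"
    unfolding power_mult_distrib by (simp only: distrib_right mult.assoc)
  also have "\<dots> \<le> D * ?n ^ (r - 1)" using D by (intro mult_right_mono) auto
  finally show False using v(2) by simp
qed

lemma degree_constant:
  assumes r: "2 \<le> r" "r \<le> l" and \<eta>: "(0::real) < \<eta>"
  shows "\<exists>\<kappa>>0. real (l + 6) * \<kappa> < 1 / real l \<and>
    real C * (1 / real l + \<kappa>) ^ k + real (l + 5) * \<kappa> \<le> real C * (1 / real l) ^ k + \<eta>"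
proof -
  have l: "0 < real l" using r by simp
  let ?g = "\<lambda>x. real C * (1 / real l + x) ^ k + real (l + 5) * x"
  have "isCont ?g 0" by (intro continuous_intros)
  then obtain d where d: "d > 0" "\<And>x. x \<noteq> 0 \<Longrightarrow> \<bar>x\<bar> < d \<Longrightarrow> \<bar>?g x - ?g 0\<bar> < \<eta>"
    unfolding isCont_def LIM_eq using \<eta> by auto
  define \<kappa> where "\<kappa> = min (d / 2) (1 / (2 * real l * real (l + 6)))"
  have k: "0 < \<kappa>" "\<kappa> < d" using d(1) l by (auto simp: \<kappa>_def)
  have "\<kappa> \<le> 1 / (2 * real l * real (l + 6))" by (simp add: \<kappa>_def)
  then have "real (l + 6) * \<kappa> \<le> real (l + 6) * (1 / (2 * real l * real (l + 6)))" by (intro mult_left_mono) auto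
  also have "\<dots> = 1 / (2 * real l)" by simp
  also have "\<dots> < 1 / real l" using l by (simp add: field_simps)
  finally have "real (l + 6) * \<kappa> < 1 / real l" .
  moreover have "?g \<kappa> \<le> ?g 0 + \<eta>" using d(2)[of \<kappa>] k by auto
  ultimately show ?thesis using k(1) by (intro exI[of _ \<kappa>]) simp
qed

section \<open>Growth of binomial coefficients and of Turan numbers\<close>

lemma diff_power_le_fact_choose: "(N - k) ^ k \<le> fact k * (N choose k)"
proof (induction k arbitrary: N)
  case (Suc k)
  show ?case
  proof (cases N)
    case (Suc N')
    have "(Suc N' - Suc k) ^ Suc k = (N' - k) * (N' - k) ^ k" by simp
    also have "\<dots> \<le> Suc N' * (fact k * (N' choose k))" using Suc.IH by (intro mult_mono) auto
    also have "\<dots> = fact k * (Suc k * (Suc N' choose Suc k))" unfolding Suc_times_binomial by (simp add: mult_ac)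
    also have "\<dots> = fact (Suc k) * (Suc N' choose Suc k)" by (simp only: fact_Suc of_nat_id mult_ac)
    finally show ?thesis using Suc by simp
  qed simp
qed simp

lemma choose_asymptotic:
  assumes \<epsilon>: "(0::real) < \<epsilon>"
  shows "\<exists>c>0. \<exists>n0. \<forall>n m. n0 \<le> n \<longrightarrow> (1 - c) * real n \<le> real m \<longrightarrow>
    (1 / fact k - \<epsilon>) * real n ^ k \<le> real (m choose k)"
proof -
  obtain c n0 where c: "c > 0" "\<And>n m. n0 \<le> n \<Longrightarrow> (1 - c) * real n \<le> real m \<Longrightarrow>
    (1 - \<epsilon>) * real n ^ k \<le> real m ^ k"
    using div_power_lower[of 1 \<epsilon> k] \<epsilon> by auto
  show ?thesis
  \<comment> \<open>The other half of \<open>c\<close> absorbs the shift from \<open>m\<close> to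
    \<open>m - k\<close>.\<close>
  proof (intro exI[of _ "c / 2"] conjI)
    show "\<exists>n0. \<forall>n m. n0 \<le> n \<longrightarrow> (1 - c / 2) * real n \<le> real m \<longrightarrow> (1 / fact k - \<epsilon>) * real n ^ k \<le> real (m choose k)"
    proof (rule exI[of _ "n0 + nat \<lceil>2 * real k / c\<rceil>"], intro allI impI)
      fix n m assume n: "n0 + nat \<lceil>2 * real k / c\<rceil> \<le> n" and m: "(1 - c / 2) * real n \<le> real m"
      have "2 * real k / c \<le> real n" using n by linarith
      then have "real k \<le> c / 2 * real n" using c(1) by (simp add: divide_le_eq mult.commute)
      then have "(1 - c) * real n \<le> real m - real k" using m by (simp add: algebra_simps)
      then have "(1 - c) * real n \<le> real (m - k)" by linarith
      then have "(1 - \<epsilon>) * real n ^ k \<le> real (m - k) ^ k" using c(2) n by simp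
      also have "\<dots> \<le> fact k * real (m choose k)"
        using diff_power_le_fact_choose[of m k] by (metis of_nat_fact of_nat_le_iff of_nat_mult of_nat_power)
      finally have "(1 - \<epsilon>) / fact k * real n ^ k \<le> real (m choose k)" by (simp add: field_simps)
      moreover have "(1 / fact k - \<epsilon>) * real n ^ k \<le> (1 - \<epsilon>) / fact k * real n ^ k"
      proof (rule mult_right_mono)
        have "\<epsilon> / fact k \<le> \<epsilon> / 1" using \<epsilon> by (intro divide_left_mono) auto
        then show "1 / fact k - \<epsilon> \<le> (1 - \<epsilon>) / fact k" by (simp add: diff_divide_distrib)
      qed simp
      ultimately show "(1 / fact k - \<epsilon>) * real n ^ k \<le> real (m choose k)" by linarith
    qed
  qed (use c in auto)
qed

text \<open>This is the strict gap between the degree of a joined vertex and the Turan degree. It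
  reduces to \<open>(l - 1) ^ (r - 1) < l ^ (r - 1)\<close>, which holds because
  \<open>r - 1\<close> is positive.\<close>

lemma turan_degree_gap:
  assumes "2 \<le> r" "r \<le> l"
  shows "real (l - 1 choose (r - 1)) * (1 / real l) ^ (r - 1) < 1 / fact (r - 1)"
proof -
  have "real ((l - 1 choose (r - 1)) * fact (r - 1)) \<le> real ((l - 1) ^ (r - 1))"
    using binomial_fact_pow[of "l - 1" "r - 1"] by (simp only: of_nat_le_iff)
  also have "\<dots> < real l ^ (r - 1)"
    unfolding of_nat_power using assms by (intro power_strict_mono) auto
  finally have "real (l - 1 choose (r - 1)) * fact (r - 1) < real l ^ (r - 1)" by simp
  then show ?thesis using assms by (simp add: power_one_over field_simps)
qed

lemma turan_number_add_lower:
  assumes "1 \<le> r" "\<And>j. a \<le> j \<Longrightarrow> x \<le> real (turan_degree r l j)"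
  shows "real (turan_number r l a) + real k * x \<le> real (turan_number r l (a + k))"
proof (induction k)
  case (Suc k)
  have "turan_number r l (a + Suc k) = turan_number r l (a + k) + turan_degree r l (a + k)"
    using turan_number_Suc[OF assms(1)] by simp
  then show ?case using Suc assms(2)[of "a + k"] by (simp add: algebra_simps)
qed simp

lemma turan_number_add_upper:
  assumes "1 \<le> r" "\<And>j. j < a + k \<Longrightarrow> real (turan_degree r l j) \<le> x"
  shows "real (turan_number r l (a + k)) \<le> real (turan_number r l a) + real k * x"
  using assms(2)
proof (induction k)
  case (Suc k)
  have "turan_number r l (a + Suc k) = turan_number r l (a + k) + turan_degree r l (a + k)"
    using turan_number_Suc[OF assms(1)] by simp
  then show ?case using Suc.IH Suc.prems by (fastforce simp: algebra_simps)
qed simp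

lemma choose_add_lower:
  assumes "1 \<le> r"
  shows "(a choose r) + k * (a choose (r - 1)) \<le> (a + k) choose r"
proof (induction k)
  case (Suc k)
  obtain q where q: "r = Suc q" using assms by (cases r) auto
  have "(a choose q) \<le> ((a + k) choose q)" by (rule binomial_right_mono) simp
  then show ?case using Suc unfolding q by simp
qed simp

text \<open>With \<open>card L = t\<close> and \<open>r \<ge> 1\<close> these are the edges of the
  complete part of the join together with all mixed edges.\<close>

definition meeting :: "nat \<Rightarrow> 'a set \<Rightarrow> 'a set \<Rightarrow> 'a set set" where
  "meeting r V L = {e \<in> ksubsets r V. e \<inter> L \<noteq> {}}"

lemma card_meeting:
  assumes "finite V" "L \<subseteq> V"
  shows "card (meeting r V L) + (card V - card L choose r) = (card V choose r)"
proof -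
  have "ksubsets r V = meeting r V L \<union> ksubsets r (V - L)" by (auto simp: meeting_def ksubsets_def)
  moreover have "card (meeting r V L \<union> ksubsets r (V - L)) = card (meeting r V L) + card (ksubsets r (V - L))"
  proof (cases "r = 0")
    case True
    then have "meeting r V L = {}" using assms by (auto simp: meeting_def ksubsets_def dest: finite_subset)
    then show ?thesis by simp
  next
    case False
    show ?thesis
      using assms by (intro card_Un_disjoint) (auto simp: meeting_def ksubsets_def finite_ksubsets)
  qed
  moreover have "card (ksubsets r V) = (card V choose r)" using assms by (simp only: card_ksubsets)
  moreover have "card (ksubsets r (V - L)) = (card V - card L choose r)"
    using assms by (simp add: card_ksubsets card_Diff_subset finite_subset[OF assms(2,1)])
  ultimately show ?thesis by simp
qed

section \<open>At least as many edges as the join forces the join\<close>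

text \<open>The last hypothesis says that \<open>E\<close> has at least as many edges as the join,
  with the subtraction of \<open>n - t choose r\<close> moved to the other side. In this form one
  statement yields both maximality and uniqueness.\<close>

lemma main_structure:
  assumes r: "2 \<le> r" "r \<le> l"
  shows "\<exists>N0 c. c > 0 \<and> (\<forall>n t (V :: 'a set) E. N0 \<le> n \<longrightarrow> real t \<le> c * real n \<longrightarrow> finite V \<longrightarrow> card V = n \<longrightarrow>
     E \<subseteq> ksubsets r V \<longrightarrow> \<not> (\<exists>P. packing r l E P \<and> card P = Suc t) \<longrightarrow>
     (n choose r) + turan_number r l (n - t) \<le> card E + (n - t choose r) \<longrightarrow>
     (\<exists>L g. L \<subseteq> V \<and> card L = t \<and> balanced l (V - L) g \<and> E = meeting r V L \<union> rainbow r (V - L) g))"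
proof -
  have l: "0 < l" "1 \<le> l" "2 \<le> l" "1 \<le> r" using r by auto
  define m where "m = card (verts (H_expansion r l))"
  have m: "1 \<le> m" using card_verts_H_expansion_pos[of r l] by (simp add: m_def)
  define D' where "D' = real (l - 1 choose (r - 1)) * (1 / real l) ^ (r - 1)"
  define \<gamma> where "\<gamma> = 1 / fact (r - 1) - D'"
  have \<gamma>: "\<gamma> > 0" using turan_degree_gap[OF r] by (simp add: \<gamma>_def D'_def)
  \<comment> \<open>A removed vertex loses at most \<open>2 * \<eta> * n ^ (r - 1)\<close> more
    edges than the Turan number does. A copy has \<open>m\<close> vertices, so it costs at most a
    quarter of the gap \<open>\<gamma>\<close>.\<close>
  define \<eta> where "\<eta> = \<gamma> / (8 * real m)"
  have \<eta>: "\<eta> > 0" "2 * \<eta> * real m = \<gamma> / 4" using \<gamma> m by (auto simp: \<eta>_def)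
  obtain \<kappa> where \<kappa>: "\<kappa> > 0" "real (l + 6) * \<kappa> < 1 / real l"
    "real (l - 1 choose (r - 1)) * (1 / real l + \<kappa>) ^ (r - 1) + real (l + 5) * \<kappa> \<le> D' + \<eta>"
    using degree_constant[OF r \<eta>(1)] unfolding D'_def by blast
  obtain \<delta> where \<delta>: "\<delta> > 0" and st: "\<forall>(V :: 'a set) E M. finite V \<longrightarrow> E \<subseteq> ksubsets r V \<longrightarrow> (\<forall>W. \<not> copy r l E W) \<longrightarrow>
     embed_slack r l \<le> M \<longrightarrow> real M \<le> \<delta> * real (card V) \<longrightarrow>
     (real (l choose r) / real l ^ r - \<delta>) * real (card V) ^ r \<le> real (card E) \<longrightarrow>
     (\<exists>f T. structured l \<kappa> M V E f T)"
    using copy_free_structured[OF r \<kappa>(1), where 'a='a] by (elim exE conjE) (rule that)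
  define \<sigma> where "\<sigma> = min \<delta> \<kappa>"
  have \<sigma>: "\<sigma> > 0" "\<sigma> \<le> \<delta>" "\<sigma> \<le> \<kappa>" using \<delta> \<kappa> by (auto simp: \<sigma>_def)
  obtain cA nA where A: "cA > 0" "\<And>n m. nA \<le> n \<Longrightarrow> (1 - cA) * real n \<le> real m \<Longrightarrow>
    (real (l choose r) / real l ^ r - \<delta> / 2) * real n ^ r \<le> real (turan_number r l m)"
    using turan_number_asymptotic[OF l(1), of "\<delta> / 2" r] \<delta> by auto
  obtain cB nB where B: "cB > 0" "\<And>n m. nB \<le> n \<Longrightarrow> (1 - cB) * real n \<le> real m \<Longrightarrow>
    (D' - \<eta>) * real n ^ (r - 1) \<le> real (turan_degree r l m)"
    using turan_degree_asymptotic[OF l(1) \<eta>(1), of r] unfolding D'_def by blast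
  obtain cC nC where C: "cC > 0" "\<And>n m. nC \<le> n \<Longrightarrow> (1 - cC) * real n \<le> real m \<Longrightarrow>
    (1 / fact (r - 1) - \<gamma> / 4) * real n ^ (r - 1) \<le> real (m choose (r - 1))"
    using choose_asymptotic[of "\<gamma> / 4" "r - 1"] \<gamma> by auto
  obtain nD where D: "\<And>n. nD \<le> n \<Longrightarrow> \<exists>M. embed_slack r l + (m + 1) \<le> M \<and> real M \<le> \<sigma> / 2 * real n"
    using obtain_slack[of "\<sigma> / 2" "embed_slack r l + (m + 1)"] \<sigma>(1) by auto
  obtain n1 where ex: "\<forall>(V :: 'a set) E. finite V \<longrightarrow> n1 \<le> card V \<longrightarrow> E \<subseteq> ksubsets r V \<longrightarrow> (\<forall>W. \<not> copy r l E W) \<longrightarrow>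
     card E \<le> turan_number r l (card V) \<and>
     (card E = turan_number r l (card V) \<longrightarrow> (\<exists>g. balanced l V g \<and> E = rainbow r V g))"
    using turan_exact[OF r, where 'a='a] by (elim exE)
  \<comment> \<open>In this order: Turan number at \<open>n - t\<close>; degree of a joined vertex;
    Turan degree after up to \<open>(m + 1) * t\<close> deletions; edges lost with a maximal
    packing; \<open>M\<close> small against \<open>n\<close>; at least half of the vertices left for
    the exact result.\<close>
  define c where "c = Min {cA, cC, cB / real (m + 1), \<delta> / (2 * real m), \<sigma> / (2 * real (m + 1)), 1 / (2 * real (m + 1))}"
  have c0: "c > 0" using A(1) B(1) C(1) \<delta> \<sigma> m by (simp add: c_def)
  have cs: "c \<le> cA" "c \<le> cC" "c \<le> cB / real (m + 1)" "c \<le> \<delta> / (2 * real m)"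
    "c \<le> \<sigma> / (2 * real (m + 1))" "c \<le> 1 / (2 * real (m + 1))"
    unfolding c_def by (intro Min_le; simp)+
  define N0 where "N0 = nA + nB + nC + nD + 2 * n1 + 1"
  show ?thesis
  proof (rule exI[of _ N0], rule exI[of _ c], intro conjI allI impI)
    fix n t and V :: "'a set" and E
    assume n: "N0 \<le> n" and t: "real t \<le> c * real n" and V: "finite V" "card V = n" and E: "E \<subseteq> ksubsets r V"
      and np: "\<not> (\<exists>P. packing r l E P \<and> card P = Suc t)"
      and many: "(n choose r) + turan_number r l (n - t) \<le> card E + (n - t choose r)"
    have ns: "nA \<le> n" "nB \<le> n" "nC \<le> n" "nD \<le> n" "2 * n1 \<le> n" "0 < n" using n by (auto simp: N0_def)
    have n0: "real n > 0" using ns by simp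
    have tx: "real t \<le> x * real n" if "c \<le> x" for x
      using t mult_right_mono[OF that, of "real n"] by simp
    have mp: "real (m + 1) > 0" "real m > 0" using m by auto
    have tA: "real t \<le> cA * real n" and tC: "real t \<le> cC * real n" using tx cs by auto
    have tB: "real (m + 1) * real t \<le> cB * real n" using tx[OF cs(3)] mp by (simp add: field_simps)
    have t\<delta>: "real m * real t \<le> \<delta> / 2 * real n" using tx[OF cs(4)] mp by (simp add: field_simps)
    have t\<sigma>: "real (m + 1) * real t \<le> \<sigma> / 2 * real n" using tx[OF cs(5)] mp by (simp add: field_simps)
    have t1: "2 * ((m + 1) * t) \<le> n"
    proof -
      have "real (2 * ((m + 1) * t)) \<le> real n" using tx[OF cs(6)] mp by (simp add: field_simps)
      then show ?thesis by (simp only: of_nat_le_iff)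
    qed
    have tn: "t \<le> n" using t1 by simp
    \<comment> \<open>Room for \<open>t + 1\<close> copies of \<open>m\<close> vertices, for
      \<open>t + 1\<close> vertices that still await a copy, and for the slack of the
      embedding.\<close>
    define M where "M = (m + 1) * (t + 1) + embed_slack r l"
    have Mn: "real M \<le> \<sigma> * real n"
    proof -
      have "real (embed_slack r l + (m + 1)) \<le> \<sigma> / 2 * real n"
        using D[OF ns(4)] by (meson of_nat_le_iff order_trans)
      moreover have "real M = real (m + 1) * real t + real (embed_slack r l + (m + 1))"
        by (simp add: M_def algebra_simps)
      ultimately show ?thesis using t\<sigma> by simp
    qed
    have M\<delta>: "real M \<le> \<delta> * real (card V)" and M\<kappa>: "real M \<le> \<kappa> * real (card V)"
      using Mn mult_right_mono[OF \<sigma>(2), of "real n"] mult_right_mono[OF \<sigma>(3), of "real n"] V by auto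
    have fE: "finite E" using E V finite_ksubsets finite_subset by blast
    have EV: "\<Union>E \<subseteq> V" using E by (auto simp: ksubsets_def)
    have "(n - t choose r) \<le> (n choose r)" using choose_add_lower[OF l(4), of "n - t" t] tn by simp
    then have E\<tau>: "turan_number r l (n - t) \<le> card E" using many by linarith
    obtain P0 where P0: "packing r l E P0" "card P0 \<le> t" "\<And>W. copy r l E W \<Longrightarrow> W \<inter> \<Union>P0 \<noteq> {}"
      using exists_maximal_packing[OF np] by blast
    \<comment> \<open>Copy-free by maximality. The deleted edges meet at most \<open>m * t\<close>
      vertices, so they number at most \<open>\<delta> / 2 * n ^ r\<close> and stability still
      applies.\<close>
    define E0 where "E0 = {e \<in> E. e \<inter> \<Union>P0 = {}}"
    have E0: "E0 \<subseteq> ksubsets r V" "E0 \<subseteq> E" "\<forall>W. \<not> copy r l E0 W"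
      using E P0(3) unfolding E0_def by (auto simp: copy_avoid_iff[OF l(2)])
    have "real (card E) \<le> real (card E0) + \<delta> / 2 * real n ^ r"
    proof -
      let ?B = "{e \<in> ksubsets r V. e \<inter> \<Union>P0 \<noteq> {}}"
      have "card E \<le> card (E0 \<union> ?B)"
        using E fE V by (intro card_mono) (auto simp: E0_def finite_ksubsets)
      also have "\<dots> \<le> card E0 + card ?B" by (rule card_Un_le)
      also have "card ?B \<le> card (\<Union>P0) * card V ^ (r - 1)"
        using packing_card_Union[OF P0(1)] V l by (intro card_ksubsets_Int) auto
      also have "\<dots> \<le> (t * m) * n ^ (r - 1)"
        using packing_card_Union[OF P0(1)] P0(2) V m_def by (intro mult_mono) auto
      finally have "real (card E) \<le> real (card E0 + (t * m) * n ^ (r - 1))" by (simp only: of_nat_le_iff)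
      also have "\<dots> = real (card E0) + (real m * real t) * real n ^ (r - 1)" by simp
      also have "\<dots> \<le> real (card E0) + (\<delta> / 2 * real n) * real n ^ (r - 1)"
        using t\<delta> by (intro add_left_mono mult_right_mono) auto
      also have "(\<delta> / 2 * real n) * real n ^ (r - 1) = \<delta> / 2 * real n ^ r"
        using l(4) by (cases r) auto
      finally show ?thesis .
    qed
    moreover have "(real (l choose r) / real l ^ r - \<delta> / 2) * real n ^ r \<le> real (card E)"
    proof -
      have "(1 - cA) * real n \<le> real (n - t)" using tA tn by (simp add: algebra_simps of_nat_diff)
      from A(2)[OF ns(1) this] show ?thesis using E\<tau> by linarith
    qed
    ultimately have "(real (l choose r) / real l ^ r - \<delta>) * real (card V) ^ r \<le> real (card E0)"
      unfolding V(2) by (simp add: algebra_simps)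
    moreover have sM: "embed_slack r l \<le> M" by (simp add: M_def)
    ultimately obtain f T where "structured l \<kappa> M V E0 f T"
      using st V(1) E0(1,3) M\<delta> by blast
    then have s: "structured l \<kappa> M V E f T" using structured_mono[OF V(1)] E0(2) by blast
    define D where "D = D' + \<eta>"
    define L where "L = {v \<in> V. D * real (card V) ^ (r - 1) < real (card {e \<in> E. v \<in> e})}"
    have L: "L \<subseteq> V" "finite L" using V by (auto simp: L_def)
    have high: "\<exists>W. copy r l E W \<and> v \<in> W \<and> W \<inter> S = {}"
      if "v \<in> L" "finite S" "card S + embed_slack r l \<le> M" "v \<notin> S" for v S
      using that(1) unfolding L_def D_def
      by (intro high_degree_copy[OF V(1) E r s less_imp_le[OF \<kappa>(1)] \<kappa>(2) M\<kappa> \<kappa>(3) _ _ that(2-4)]) auto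
    \<comment> \<open>Any \<open>t + 1\<close> vertices of \<open>L\<close> could be given disjoint
      copies, starting from the empty packing.\<close>
    have Lt: "card L \<le> t"
    proof (rule ccontr)
      assume "\<not> ?thesis"
      then obtain L' where L': "L' \<subseteq> L" "card L' = Suc t" "finite L'"
        by (meson not_less_eq_eq obtain_subset_with_card_n)
      have "\<exists>P'. packing r l E P' \<and> card P' = card ({} :: 'a set set) + card L'"
        by (rule extend_packing[OF L'(3), where M = M and q = "embed_slack r l"])
           (use high L' in \<open>auto simp: packing_def disjoint_def M_def m_def[symmetric]\<close>)
      then show False using np L'(2) by simp
    qed
    define t' where "t' = t - card L"
    define n' where "n' = n - card L"
    have n': "n' = (n - t) + t'" "card L + t' = t" "n' \<le> n" using Lt tn by (auto simp: n'_def t'_def)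
    define E' where "E' = {e \<in> E. e \<inter> L = {}}"
    have E': "E' \<subseteq> ksubsets r (V - L)" using E by (auto simp: E'_def ksubsets_def)
    have copyE': "copy r l E' W \<longleftrightarrow> copy r l E W \<and> W \<inter> L = {}" for W
      unfolding E'_def by (rule copy_avoid_iff[OF l(2)])
    \<comment> \<open>Too many copies off \<open>L\<close> could be completed to
      \<open>t + 1\<close> by one further copy through each vertex of \<open>L\<close>.\<close>
    have np': "\<not> (\<exists>P. packing r l E' P \<and> card P = Suc t')"
    proof
      assume "\<exists>P. packing r l E' P \<and> card P = Suc t'"
      then obtain P where P: "packing r l E' P" "card P = Suc t'" by blast
      have "packing r l E P" "\<Union>P \<inter> L = {}" using P(1) copyE' unfolding packing_def by auto
      moreover have "m * (card P + card L) + card L + embed_slack r l \<le> M"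
      proof -
        have "card P + card L = t + 1" using P(2) n'(2) by simp
        then show ?thesis using Lt by (simp add: M_def)
      qed
      ultimately have "\<exists>P'. packing r l E P' \<and> card P' = card P + card L"
        using high by (intro extend_packing[OF L(2), where M = M and q = "embed_slack r l"]) (auto simp: m_def)
      then show False using np P(2) n'(2) by auto
    qed
    obtain P where P: "packing r l E' P" "card P \<le> t'" "\<And>W. copy r l E' W \<Longrightarrow> W \<inter> \<Union>P \<noteq> {}"
      using exists_maximal_packing[OF np'] by blast
    define U where "U = \<Union>P"
    define s' where "s' = card U"
    have U: "finite U" "s' \<le> m * t'" "U \<subseteq> V - L"
    proof -
      show "finite U" using packing_card_Union[OF P(1)] by (simp add: U_def)
      show "s' \<le> m * t'" using packing_card_Union[OF P(1)] P(2) by (simp add: s'_def U_def m_def)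
      have "W \<subseteq> V - L" if "W \<in> P" for W
      proof -
        have "copy r l E' W" using P(1) that by (simp add: packing_def)
        from copy_subset_Union[OF l(2) this] show ?thesis using E' by (auto simp: ksubsets_def)
      qed
      then show "U \<subseteq> V - L" unfolding U_def by blast
    qed
    define E'' where "E'' = {e \<in> E'. e \<inter> U = {}}"
    have E'': "E'' \<subseteq> ksubsets r (V - L - U)" using E' by (auto simp: E''_def ksubsets_def)
    have free: "\<forall>W. \<not> copy r l E'' W"
      unfolding E''_def copy_avoid_iff[OF l(2)] using P(3) by (auto simp: U_def)
    have cV: "card (V - L - U) = n' - s'"
      using U L V by (simp add: card_Diff_subset n'_def s'_def)
    have size: "s' + t \<le> (m + 1) * t"
    proof -
      have "m * t' \<le> m * t" using n'(2) by (intro mult_le_mono2) linarith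
      then have "s' + t \<le> m * t + t" using U(2) by linarith
      then show ?thesis by simp
    qed
    have sn': "s' + t \<le> n" "s' \<le> n'" "n1 \<le> n' - s'"
      using size t1 ns(5) n' by linarith+
    have tur: "card E'' \<le> turan_number r l (n' - s')"
      "card E'' = turan_number r l (n' - s') \<Longrightarrow> \<exists>g. balanced l (V - L - U) g \<and> E'' = rainbow r (V - L - U) g"
      using ex V(1) sn'(3) cV E'' free by (metis finite_Diff)+
    have fE': "finite E'" using fE by (simp add: E'_def)
    \<comment> \<open>The vertices of \<open>U\<close> lie outside \<open>L\<close>, so each of them
      carries at most \<open>D * n ^ (r - 1)\<close> edges.\<close>
    have dE': "real (card E') \<le> real (card E'') + real s' * (D * real n ^ (r - 1))"
    proof -
      have "E' = E'' \<union> (\<Union>u\<in>U. {e \<in> E'. u \<in> e})" by (auto simp: E''_def)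
      then have "card E' \<le> card E'' + card (\<Union>u\<in>U. {e \<in> E'. u \<in> e})" by (metis card_Un_le)
      also have "card (\<Union>u\<in>U. {e \<in> E'. u \<in> e}) \<le> (\<Sum>u\<in>U. card {e \<in> E'. u \<in> e})"
        by (rule card_UN_le[OF U(1)])
      finally have "real (card E') \<le> real (card E'') + (\<Sum>u\<in>U. real (card {e \<in> E'. u \<in> e}))"
        by (simp only: of_nat_sum[symmetric] of_nat_add[symmetric] of_nat_le_iff)
      also have "(\<Sum>u\<in>U. real (card {e \<in> E'. u \<in> e})) \<le> (\<Sum>u\<in>U. D * real n ^ (r - 1))"
      proof (rule sum_mono)
        fix u assume "u \<in> U"
        then have "u \<in> V" "u \<notin> L" using U(3) by auto
        then have "real (card {e \<in> E. u \<in> e}) \<le> D * real n ^ (r - 1)" using V(2) by (simp add: L_def)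
        moreover have "card {e \<in> E'. u \<in> e} \<le> card {e \<in> E. u \<in> e}"
          using fE by (intro card_mono) (auto simp: E'_def)
        ultimately show "real (card {e \<in> E'. u \<in> e}) \<le> D * real n ^ (r - 1)" by linarith
      qed
      finally show ?thesis by (simp add: s'_def)
    qed
    have split: "card E = card E' + card (E \<inter> meeting r V L)"
    proof -
      have "E = E' \<union> (E \<inter> meeting r V L)" "E' \<inter> (E \<inter> meeting r V L) = {}"
        using E by (auto simp: E'_def meeting_def)
      then show ?thesis using fE card_Un_disjoint[of E' "E \<inter> meeting r V L"] fE' by auto
    qed
    have fm: "finite (meeting r V L)" using V by (simp add: meeting_def finite_ksubsets)
    have mL: "card (E \<inter> meeting r V L) \<le> card (meeting r V L)" using fm by (intro card_mono) auto
    have cm: "card (meeting r V L) + (n' choose r) = (n choose r)"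
      using card_meeting[OF V(1) L(1), of r] V(2) by (simp add: n'_def)
    \<comment> \<open>Edges meeting \<open>L\<close> are at most all \<open>r\<close>-sets meeting
      \<open>L\<close>. Cancelling these leaves a comparison in which the remaining
      \<open>t'\<close> vertices would still be joined.\<close>
    have key: "turan_number r l (n - t) + (n' choose r) \<le> card E' + (n - t choose r)"
      using many split mL cm by linarith
    \<comment> \<open>Each of the \<open>t'\<close> missing joined vertices would contribute at
      least \<open>(1 / fact (r - 1) - \<gamma> / 4) * n ^ (r - 1)\<close> edges. Without them,
      growing the Turan part and the loss on one removed copy account for at most
      \<open>(D' + \<gamma> / 4) * n ^ (r - 1)\<close> each, a contradiction since the two differ by
      \<open>\<gamma> / 2\<close>.\<close>
    have t'0: "t' = 0"
    proof (rule ccontr)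
      assume "t' \<noteq> 0"
      then have t'p: "real t' > 0" by simp
      have np: "real n ^ (r - 1) > 0" using n0 by simp
      have "(D' - \<eta>) * real n ^ (r - 1) \<le> real (turan_degree r l j)" if j: "n' - s' \<le> j" for j
      proof (rule B(2)[OF ns(2)])
        have "n \<le> j + (m + 1) * t" using j size sn' n' by linarith
        then have "real n \<le> real (j + (m + 1) * t)" by (simp only: of_nat_le_iff)
        also have "\<dots> = real j + real (m + 1) * real t" by (simp only: of_nat_add of_nat_mult)
        also have "\<dots> \<le> real j + cB * real n" using tB by (intro add_left_mono)
        finally show "(1 - cB) * real n \<le> real j" by (simp add: algebra_simps)
      qed
      from turan_number_add_lower[OF l(4) this, of "n' - s'" s']
      have a: "real (turan_number r l (n' - s')) + real s' * ((D' - \<eta>) * real n ^ (r - 1)) \<le> real (turan_number r l n')"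
        using sn'(2) by simp
      have "real (turan_degree r l j) \<le> D' * real n ^ (r - 1)" if "j < (n - t) + t'" for j
      proof -
        have "real (turan_degree r l j) \<le> real (l - 1 choose (r - 1)) * (real (Suc j) / real l) ^ (r - 1)"
          by (rule turan_degree_upper[OF l(3)])
        also have "\<dots> \<le> real (l - 1 choose (r - 1)) * (real n / real l) ^ (r - 1)"
          using that n' by (intro mult_left_mono power_mono divide_right_mono) auto
        also have "\<dots> = D' * real n ^ (r - 1)" by (simp add: D'_def power_divide)
        finally show ?thesis .
      qed
      from turan_number_add_upper[OF l(4) this]
      have b: "real (turan_number r l n') \<le> real (turan_number r l (n - t)) + real t' * (D' * real n ^ (r - 1))"
        unfolding n'(1) .
      have d: "real (n - t choose r) + real t' * real (n - t choose (r - 1)) \<le> real (n' choose r)"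
        using choose_add_lower[OF l(4), of "n - t" t'] unfolding n'(1)
        by (metis of_nat_add of_nat_le_iff of_nat_mult)
      have "(1 - cC) * real n \<le> real (n - t)" using tC tn by (simp add: algebra_simps of_nat_diff)
      from C(2)[OF ns(3) this]
      have e: "(1 / fact (r - 1) - \<gamma> / 4) * real n ^ (r - 1) \<le> real (n - t choose (r - 1))" .
      have "real (card E') \<le> real (turan_number r l (n' - s')) + real s' * (D * real n ^ (r - 1))"
        using dE' tur(1) by linarith
      also have "\<dots> = real (turan_number r l (n' - s')) + real s' * ((D' - \<eta>) * real n ^ (r - 1)) + real s' * (2 * \<eta> * real n ^ (r - 1))"
        by (simp add: D_def algebra_simps)
      also have "\<dots> \<le> real (turan_number r l n') + real s' * (2 * \<eta> * real n ^ (r - 1))" using a by linarith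
      also have "\<dots> \<le> real (turan_number r l n') + (real m * real t') * (2 * \<eta> * real n ^ (r - 1))"
      proof -
        have "real s' \<le> real m * real t'" using U(2) by (metis of_nat_le_iff of_nat_mult)
        then show ?thesis using \<eta>(1) by (intro add_left_mono mult_right_mono) auto
      qed
      also have "(real m * real t') * (2 * \<eta> * real n ^ (r - 1)) = real t' * ((2 * \<eta> * real m) * real n ^ (r - 1))"
        by (simp only: mult_ac)
      also have "\<dots> = real t' * (\<gamma> / 4 * real n ^ (r - 1))" unfolding \<eta>(2) ..
      finally have up: "real (card E') \<le> real (turan_number r l (n - t)) + real t' * (D' * real n ^ (r - 1))
          + real t' * (\<gamma> / 4 * real n ^ (r - 1))" using b by linarith
      have "real (turan_number r l (n - t)) + real (n' choose r) \<le> real (card E') + real (n - t choose r)"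
        using key by (metis of_nat_add of_nat_le_iff)
      then have "real t' * real (n - t choose (r - 1)) \<le> real t' * (D' * real n ^ (r - 1)) + real t' * (\<gamma> / 4 * real n ^ (r - 1))"
        using d up by linarith
      also have "\<dots> = real t' * ((D' + \<gamma> / 4) * real n ^ (r - 1))" by (simp only: distrib_left distrib_right)
      finally have "real (n - t choose (r - 1)) \<le> (D' + \<gamma> / 4) * real n ^ (r - 1)"
        using t'p by (simp only: mult_le_cancel_left_pos)
      then have "(1 / fact (r - 1) - \<gamma> / 4) * real n ^ (r - 1) \<le> (D' + \<gamma> / 4) * real n ^ (r - 1)"
        using e by linarith
      then have "1 / fact (r - 1) - \<gamma> / 4 \<le> D' + \<gamma> / 4" using np by (simp only: mult_le_cancel_right_pos)
      then show False using \<gamma> by (simp add: \<gamma>_def) argo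
    qed
    have "s' = 0" using U(2) t'0 by simp
    then have "U = {}" using U(1) by (simp add: s'_def)
    then have eq: "E'' = E'" "V - L - U = V - L" "n' - s' = n - t" using t'0 n' \<open>s' = 0\<close> by (auto simp: E''_def)
    have "n' = n - t" using t'0 n' by simp
    then have c1: "card E' = turan_number r l (n - t)" using key tur(1) unfolding eq by simp
    then obtain g where g: "balanced l (V - L) g" "E' = rainbow r (V - L) g" using tur(2) unfolding eq by blast
    \<comment> \<open>With \<open>t' = 0\<close> the inequalities above are tight, so every
      \<open>r\<close>-set meeting \<open>L\<close> is an edge.\<close>
    have "card (meeting r V L) \<le> card (E \<inter> meeting r V L)"
      using many split cm[unfolded \<open>n' = n - t\<close>] c1 by linarith
    then have "E \<inter> meeting r V L = meeting r V L" using card_seteq[OF fm] by blast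
    moreover have "E = E' \<union> (E \<inter> meeting r V L)" using E by (auto simp: E'_def meeting_def)
    ultimately have "E = meeting r V L \<union> rainbow r (V - L) g" using g(2) by blast
    moreover have "card L = t" using n'(2) t'0 by simp
    ultimately show "\<exists>L g. L \<subseteq> V \<and> card L = t \<and> balanced l (V - L) g \<and> E = meeting r V L \<union> rainbow r (V - L) g"
      using L(1) g(1) by blast
  qed (rule c0)
qed

section \<open>The extremal hypergraph\<close>

text \<open>Edges have to lie inside the vertex set, since the inverse of \<open>f\<close> undoes
  images only there.\<close>

lemma isomorphic_sym:
  assumes i: "isomorphic G H" and e: "\<And>e. e \<in> edges G \<Longrightarrow> e \<subseteq> verts G"
  shows "isomorphic H G"
proof -
  obtain f where f: "bij_betw f (verts G) (verts H)" "edges H = (\<lambda>e. f ` e) ` edges G"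
    using i unfolding isomorphic_def by blast
  let ?g = "inv_into (verts G) f"
  have "?g ` f ` e = e" if "e \<in> edges G" for e
    using f(1) e[OF that] by (simp add: bij_betw_def inv_into_image_cancel)
  then have "edges G = (\<lambda>e. ?g ` e) ` edges H" unfolding f(2) by (force simp: image_image)
  then show ?thesis unfolding isomorphic_def using bij_betw_inv_into[OF f(1)] by blast
qed

lemma isomorphic_trans:
  assumes "isomorphic G H" "isomorphic H K"
  shows "isomorphic G K"
proof -
  obtain f where f: "bij_betw f (verts G) (verts H)" "edges H = (\<lambda>e. f ` e) ` edges G"
    using assms(1) unfolding isomorphic_def by blast
  obtain g where g: "bij_betw g (verts H) (verts K)" "edges K = (\<lambda>e. g ` e) ` edges H"
    using assms(2) unfolding isomorphic_def by blast
  have "edges K = (\<lambda>e. (g \<circ> f) ` e) ` edges G" unfolding g(2) f(2) by (simp add: image_image image_comp)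
  then show ?thesis unfolding isomorphic_def using bij_betw_trans[OF f(1) g(1)] by blast
qed

lemma iso_class_eq:
  assumes "isomorphic G H" "\<And>e. e \<in> edges G \<Longrightarrow> e \<subseteq> verts G"
  shows "iso_class G = iso_class H"
proof -
  have "isomorphic H G" by (rule isomorphic_sym[OF assms(1)]) (rule assms(2))
  then have "isomorphic G X \<longleftrightarrow> isomorphic H X" for X :: "nat hypergraph"
    using isomorphic_trans assms(1) by metis
  then show ?thesis unfolding iso_class_def by blast
qed

lemma meeting_image:
  assumes b: "bij_betw b V V'" and L: "L \<subseteq> V"
  shows "(\<lambda>e. b ` e) ` meeting k V L = meeting k V' (b ` L)"
proof (intro equalityI subsetI)
  fix e assume "e \<in> (\<lambda>e. b ` e) ` meeting k V L"
  then obtain d where d: "e = b ` d" "d \<subseteq> V" "card d = k" "d \<inter> L \<noteq> {}" by (auto simp: meeting_def ksubsets_def)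
  have "inj_on b d" using b d by (meson bij_betw_def inj_on_subset)
  then show "e \<in> meeting k V' (b ` L)"
    using d b by (auto simp: meeting_def ksubsets_def card_image bij_betw_def)
next
  fix e assume "e \<in> meeting k V' (b ` L)"
  then have e: "e \<subseteq> V'" "card e = k" "e \<inter> b ` L \<noteq> {}" by (auto simp: meeting_def ksubsets_def)
  then have "e \<subseteq> b ` V" using b by (simp add: bij_betw_def)
  then obtain d where d: "d \<subseteq> V" "e = b ` d" by (meson subset_image_iff)
  have i: "inj_on b V" using b by (simp add: bij_betw_def)
  have "b ` (d \<inter> L) = e \<inter> b ` L" using inj_on_image_Int[OF i d(1) L] d(2) by simp
  then have "d \<inter> L \<noteq> {}" using e(3) by auto
  moreover have "card d = k" using e(2) d inj_on_subset[OF i d(1)] by (simp add: card_image)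
  ultimately show "e \<in> (\<lambda>e. b ` e) ` meeting k V L" using d by (auto simp: meeting_def ksubsets_def)
qed

definition turan_join :: "nat \<Rightarrow> nat \<Rightarrow> nat \<Rightarrow> nat \<Rightarrow> nat hypergraph" where
  "turan_join r l n t = join r (complete_hypergraph r {n - t..<n}) (turan r (n - t) l)"

lemma verts_turan_join:
  assumes "0 < l" "t \<le> n"
  shows "verts (turan_join r l n t) = {..<n}"
  using assms unfolding turan_join_def join_def complete_hypergraph_def by (auto simp: verts_turan)

lemma edges_turan_join:
  assumes "0 < l" "t \<le> n" "1 \<le> r"
  shows "edges (turan_join r l n t) = meeting r {..<n} {n - t..<n} \<union> rainbow r {..<n - t} (\<lambda>v. v mod l)"
proof -
  let ?L = "{n - t..<n}" and ?V = "{..<n - t}"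
  have U: "?L \<union> ?V = {..<n}" using assms by auto
  have "meeting r {..<n} ?L = {e. e \<subseteq> ?L \<and> card e = r} \<union>
     {e. e \<subseteq> ?L \<union> ?V \<and> card e = r \<and> e \<inter> ?L \<noteq> {} \<and> e \<inter> ?V \<noteq> {}}" (is "?A = ?B")
  proof (intro equalityI subsetI)
    fix e assume "e \<in> ?A"
    then have "e \<subseteq> ?L \<union> ?V" "card e = r" "e \<inter> ?L \<noteq> {}" unfolding U by (auto simp: meeting_def ksubsets_def)
    then show "e \<in> ?B" by blast
  next
    fix e assume e: "e \<in> ?B"
    then have "e \<subseteq> {..<n}" "card e = r" unfolding U[symmetric] by auto
    moreover have "e \<noteq> {}" using \<open>card e = r\<close> assms(3) by auto
    then have "e \<inter> ?L \<noteq> {}" using e by blast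
    ultimately show "e \<in> ?A" by (simp add: meeting_def ksubsets_def)
  qed
  then show ?thesis
    unfolding turan_join_def join_def complete_hypergraph_def
    using assms by (auto simp: verts_turan edges_turan)
qed

lemma is_rgraph_turan_join:
  assumes "0 < l" "t \<le> n" "1 \<le> r"
  shows "is_rgraph r (turan_join r l n t)"
  unfolding is_rgraph_def verts_turan_join[OF assms(1,2)] edges_turan_join[OF assms]
  by (auto simp: meeting_def rainbow_def ksubsets_def)

lemma card_edges_turan_join:
  assumes "0 < l" "t \<le> n" "1 \<le> r"
  shows "card (edges (turan_join r l n t)) + (n - t choose r) = (n choose r) + turan_number r l (n - t)"
proof -
  let ?M = "meeting r {..<n} {n - t..<n}" and ?R = "rainbow r {..<n - t} (\<lambda>v. v mod l)"
  have "?M \<inter> ?R = {}" by (auto simp: meeting_def rainbow_def ksubsets_def)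
  then have "card (?M \<union> ?R) = card ?M + card ?R"
    by (intro card_Un_disjoint) (auto simp: meeting_def finite_ksubsets finite_rainbow)
  moreover have "card ?M + (n - t choose r) = (n choose r)"
  proof -
    have "{n - t..<n} \<subseteq> {..<n}" by auto
    from card_meeting[OF _ this, of r] assms(2) show ?thesis by simp
  qed
  ultimately show ?thesis unfolding edges_turan_join[OF assms] turan_number_def by simp
qed

text \<open>Every copy uses one of the \<open>t\<close> joined vertices, as the core of a copy avoiding them would be a
  rainbow set of \<open>l + 1\<close> vertices.\<close>
lemma turan_join_no_packing:
  assumes l: "1 \<le> l" and t: "t \<le> n" and r: "1 \<le> r"
  shows "\<not> (\<exists>P. packing r l (edges (turan_join r l n t)) P \<and> card P = Suc t)"
proof
  let ?E = "edges (turan_join r l n t)" and ?L = "{n - t..<n}"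
  assume "\<exists>P. packing r l ?E P \<and> card P = Suc t"
  then obtain P where P: "packing r l ?E P" "card P = Suc t" by blast
  have l0: "0 < l" using l by simp
  have meet: "W \<inter> ?L \<noteq> {}" if W: "copy r l ?E W" for W
  proof
    assume "W \<inter> ?L = {}"
    then have "copy r l {e \<in> ?E. e \<inter> ?L = {}} W" using W copy_avoid_iff[OF l] by blast
    then have "copy r l (rainbow r {..<n - t} (\<lambda>v. v mod l)) W"
      by (rule copy_mono) (auto simp: edges_turan_join[OF l0 t r] meeting_def)
    from copy_core[OF this] obtain K where K: "card K = l + 1"
      "\<And>u v. u \<in> K \<Longrightarrow> v \<in> K \<Longrightarrow> u \<noteq> v \<Longrightarrow> \<exists>e\<in>rainbow r {..<n - t} (\<lambda>v. v mod l). u \<in> e \<and> v \<in> e" by blast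
    have "inj_on (\<lambda>v. v mod l) K"
    proof (rule inj_onI, rule ccontr)
      fix u v assume uv: "u \<in> K" "v \<in> K" "u mod l = v mod l" "u \<noteq> v"
      then obtain e where "e \<in> rainbow r {..<n - t} (\<lambda>v. v mod l)" "u \<in> e" "v \<in> e" using K(2) by blast
      then show False using uv by (auto simp: rainbow_def inj_on_def)
    qed
    then have "card ((\<lambda>v. v mod l) ` K) = l + 1" using K(1) by (simp add: card_image)
    moreover have "(\<lambda>v. v mod l) ` K \<subseteq> {..<l}" using l0 by auto
    then have "card ((\<lambda>v. v mod l) ` K) \<le> card {..<l}" by (intro card_mono) auto
    ultimately show False by simp
  qed
  have "\<exists>x. x \<in> W \<inter> ?L" if "W \<in> P" for W using meet[of W] P(1) that by (auto simp: packing_def)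
  then obtain x where x: "\<And>W. W \<in> P \<Longrightarrow> x W \<in> W \<inter> ?L" by metis
  have "inj_on x P"
  proof (rule inj_onI, rule ccontr)
    fix W W' assume W: "W \<in> P" "W' \<in> P" "x W = x W'" "W \<noteq> W'"
    then have "W \<inter> W' = {}" using P(1) by (auto simp: packing_def disjoint_def)
    then show False using x[OF W(1)] x[OF W(2)] W(3) by auto
  qed
  moreover have "x ` P \<subseteq> ?L" using x by blast
  ultimately have "card P \<le> card ?L" by (rule card_inj_on_le) simp
  then show False using P(2) t by simp
qed

text \<open>\<open>L\<close> is mapped to the top \<open>t\<close> labels, and the rest, class by
  class, to the residue classes modulo \<open>l\<close> on the lower labels.\<close>

lemma isomorphic_turan_join:
  assumes l: "0 < l" and r: "1 \<le> r" and t: "t \<le> n"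
    and V: "finite (verts G)" "card (verts G) = n" and L: "L \<subseteq> verts G" "card L = t"
    and g: "balanced l (verts G - L) g"
    and E: "edges G = meeting r (verts G) L \<union> rainbow r (verts G - L) g"
  shows "isomorphic G (turan_join r l n t)"
proof -
  let ?V = "verts G"
  have fL: "finite L" using L V finite_subset by blast
  have "card (?V - L) = card {..<n - t}" using V L fL by (simp add: card_Diff_subset)
  then obtain b2 where b2: "bij_betw b2 (?V - L) {..<n - t}"
    "\<And>u v. u \<in> ?V - L \<Longrightarrow> v \<in> ?V - L \<Longrightarrow> b2 u mod l = b2 v mod l \<longleftrightarrow> g u = g v"
    using balanced_bij[OF _ g _ balanced_mod[OF l, of "n - t"] _ l] V by blast
  obtain b1 where b1: "bij_betw b1 L {n - t..<n}"
    using finite_same_card_bij[OF fL, of "{n - t..<n}"] L(2) t by auto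
  define b where "b v = (if v \<in> L then b1 v else b2 v)" for v
  have "bij_betw b (L \<union> (?V - L)) ({n - t..<n} \<union> {..<n - t})"
    unfolding b_def using b1 b2(1) by (intro bij_betw_disjoint_Un) auto
  moreover have "L \<union> (?V - L) = ?V" "{n - t..<n} \<union> {..<n - t} = {..<n}" using L t by auto
  ultimately have b: "bij_betw b ?V {..<n}" by simp
  have bL: "b ` L = {n - t..<n}" using b1 by (auto simp: b_def bij_betw_def)
  have bV: "bij_betw b (?V - L) {..<n - t}" using b2(1) by (rule bij_betw_cong[THEN iffD1, rotated]) (simp add: b_def)
  have "(\<lambda>e. b ` e) ` rainbow r (?V - L) g = rainbow r {..<n - t} (\<lambda>v. v mod l)"
    by (rule rainbow_image[OF bV]) (use b2(2) in \<open>auto simp: b_def\<close>)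
  then have "(\<lambda>e. b ` e) ` edges G = edges (turan_join r l n t)"
    unfolding E edges_turan_join[OF l t r] using meeting_image[OF b L(1), of r] bL by (simp add: image_Un)
  then show ?thesis
    unfolding isomorphic_def using b verts_turan_join[OF l t, of r] by (intro exI[of _ b]) simp
qed

theorem theorem2p6:
  fixes l r :: nat
  assumes "r \<ge> 2" and "l \<ge> r"
  shows "\<exists>(N0 :: nat) (c :: real). c > 0 \<and>
    (\<forall>(n :: nat) (t :: nat). n \<ge> N0 \<longrightarrow> real t \<le> c * real n \<longrightarrow>
      extremal r n (t + 1) (H_expansion r l) =
        {iso_class (join r (complete_hypergraph r {n - t..<n}) (turan r (n - t) l))})"
proof -
  have l: "0 < l" "1 \<le> l" "1 \<le> r" using assms by auto
  obtain N0 c where c: "c > 0" and main: "\<forall>n t (V :: nat set) E. N0 \<le> n \<longrightarrow> real t \<le> c * real n \<longrightarrow> finite V \<longrightarrow> card V = n \<longrightarrow>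
     E \<subseteq> ksubsets r V \<longrightarrow> \<not> (\<exists>P. packing r l E P \<and> card P = Suc t) \<longrightarrow>
     (n choose r) + turan_number r l (n - t) \<le> card E + (n - t choose r) \<longrightarrow>
     (\<exists>L g. L \<subseteq> V \<and> card L = t \<and> balanced l (V - L) g \<and> E = meeting r V L \<union> rainbow r (V - L) g)"
    using main_structure[OF assms, where 'a=nat] by (elim exE conjE) (rule that)
  show ?thesis
  \<comment> \<open>The minimum with 1 guarantees \<open>t \<le> n\<close>, so that the top block
    really has \<open>t\<close> vertices.\<close>
  proof (rule exI[of _ N0], rule exI[of _ "min c 1"], intro conjI allI impI)
    fix n t assume n: "N0 \<le> n" and t: "real t \<le> min c 1 * real n"
    have tc: "real t \<le> c * real n" using t mult_right_mono[of "min c 1" c "real n"] by simp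
    have tn: "t \<le> n" using t mult_right_mono[of "min c 1" 1 "real n"] by simp
    let ?J = "turan_join r l n t" and ?F = "H_expansion r l"
    have J: "is_rgraph r ?J" by (rule is_rgraph_turan_join[OF l(1) tn l(3)])
    have freeJ: "free_rgraph r n (t + 1) ?F ?J"
      using J turan_join_no_packing[OF l(2) tn l(3)] contains_disjoint_copies_iff[OF J l(2)]
        verts_turan_join[OF l(1) tn, of r] by (simp add: free_rgraph_def)
    have iso: "isomorphic ?J G" if G: "free_rgraph r n (t + 1) ?F G" "card (edges ?J) \<le> card (edges G)"
      for G :: "nat hypergraph"
    proof -
      have rG: "is_rgraph r G" "card (verts G) = n" "\<not> contains_disjoint_copies G (t + 1) ?F"
        using G(1) by (auto simp: free_rgraph_def)
      have V: "finite (verts G)" and E: "edges G \<subseteq> ksubsets r (verts G)"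
        using rG(1) by (auto simp: is_rgraph_def ksubsets_def)
      have np: "\<not> (\<exists>P. packing r l (edges G) P \<and> card P = Suc t)"
        using rG(3) contains_disjoint_copies_iff[OF rG(1) l(2)] by simp
      have many: "(n choose r) + turan_number r l (n - t) \<le> card (edges G) + (n - t choose r)"
        using card_edges_turan_join[OF l(1) tn l(3)] G(2) by linarith
      obtain L g where "L \<subseteq> verts G" "card L = t" "balanced l (verts G - L) g"
        "edges G = meeting r (verts G) L \<union> rainbow r (verts G - L) g"
        using main[rule_format, OF n tc V rG(2) E np many] by blast
      then have "isomorphic G ?J"
        using V rG(2) tn l by (intro isomorphic_turan_join) auto
      then show ?thesis
        by (rule isomorphic_sym) (use rG(1) in \<open>auto simp: is_rgraph_def\<close>)
    qed
    \<comment> \<open>A competitor with more edges would be isomorphic to the join by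
      \<open>iso\<close>, but the image of a finite edge set cannot be larger.\<close>
    have max: "card (edges G) \<le> card (edges ?J)" if G: "free_rgraph r n (t + 1) ?F G" for G :: "nat hypergraph"
    proof (rule ccontr)
      assume less: "\<not> ?thesis"
      then obtain f where "edges G = (\<lambda>e. f ` e) ` edges ?J"
        using iso[OF G] unfolding isomorphic_def by auto
      moreover have "edges ?J \<subseteq> ksubsets r {..<n}"
        using J verts_turan_join[OF l(1) tn, of r] by (auto simp: is_rgraph_def ksubsets_def)
      then have "finite (edges ?J)" using finite_subset finite_ksubsets by blast
      ultimately show False using less card_image_le by metis
    qed
    have cls: "iso_class G = iso_class ?J" if "isomorphic ?J G" for G :: "nat hypergraph"
      using iso_class_eq[OF that] J by (auto simp: is_rgraph_def)
    show "extremal r n (t + 1) ?F =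
        {iso_class (join r (complete_hypergraph r {n - t..<n}) (turan r (n - t) l))}"
      unfolding turan_join_def[symmetric] extremal_def
    proof (intro equalityI subsetI)
      fix X assume "X \<in> iso_class ` {G. free_rgraph r n (t + 1) ?F (G :: nat hypergraph) \<and>
        (\<forall>G' :: nat hypergraph. free_rgraph r n (t + 1) ?F G' \<longrightarrow> card (edges G') \<le> card (edges G))}"
      then show "X \<in> {iso_class ?J}" using iso cls freeJ by blast
    next
      fix X assume "X \<in> {iso_class ?J}"
      then show "X \<in> iso_class ` {G. free_rgraph r n (t + 1) ?F (G :: nat hypergraph) \<and>
        (\<forall>G' :: nat hypergraph. free_rgraph r n (t + 1) ?F G' \<longrightarrow> card (edges G') \<le> card (edges G))}"
        using freeJ max by blast
    qed
  qed (use c in simp)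
qed

end
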